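(* Let $0<\alpha<1$ and let $E$ be a $C^{1,\alpha}$ real Banach space. Let $U$ be an open neighborhood of $0$ in $E$ and let $T:U\to E$ be a $C^{1,\alpha}$ map such that $T(0)=0$ and $L=DT(0)$ is an $\alpha$-hyperbolic automorphism of $E$. Then there are a neighborhood $V\subset U$ of $0$, a real number $\beta\in(0,\alpha)$, and a $C^{1,\beta}$ diffeomorphism $R$ from $V$ onto its image such that $R(0)=0$ and $$L(R(x))=R(T(x))\quad\text{for all } x\in V\cap T^{-1}(V).$$
   Context: Open sets are assumed connected. For $0<\gamma<1$, an open set $U\subset E$ and a Banach space $F$, a map $f:U\to F$ is $C^{1,\gamma}$ (in $U$) if it is continuously Fréchet differentiable and $Hol(Df,U)=\sup_{x\ne y\in U}\frac{|Df(x)-Df(y)|}{|x-y|^{\gamma}}<\infty$ (operator norm). A real Banach space $E$ is a $C^{1,\alpha}$ Banach space if there is a $C^{1,\alpha}$ function $\phi:E\to\mathbb R$ with $\phi(E)=[0,1]$ and numbers $0<c_1<c_2$ such that $\phi(x)=1$ for $|x|<c_1$ and $\phi(x)=0$ for $|x|\ge c_2$. For a linear automorphism $L$ (bounded, with bounded inverse) of a Banach space, $\rho(L)=\lim_{n\to\infty}|L^n|^{1/n}$ is its spectral radius and $c(L)=\rho(L)\rho(L^{-1})$. $L$ is contracting if $\rho(L)<1$ and expanding if $\rho(L^{-1})<1$. $L$ is hyperbolic of saddle type if $L=A\oplus B$ with respect to an $L$-invariant direct sum decomposition $E=E^u\oplus E^s$ into (nonzero) closed subspaces, with $A=L|E^u$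 expanding and $B=L|E^s$ contracting. Such an $L$ is $\alpha$-hyperbolic if $\max(c(A),c(B))\cdot\max(\rho(A^{-1}),\rho(B))^{\alpha}<1$. *)

theory Defs
  imports "HOL-Analysis.Analysis"
begin

text \<open>
  A map on an open set \<open>U\<close> is represented by a total function whose values outside \<open>U\<close> are
  irrelevant. The norm on \<open>'a \<Rightarrow>\<^sub>L 'b\<close> is the operator norm, and \<open>bdd_above\<close> expresses
  that the supremum \<open>Hol(Df, U)\<close> is finite.
\<close>

definition C1_holder_on ::
    "real \<Rightarrow> 'a::banach set \<Rightarrow> ('a \<Rightarrow> 'b::banach) \<Rightarrow> bool" where
  "C1_holder_on \<gamma> U f \<longleftrightarrow> open U \<and>
     (\<exists>Df :: 'a \<Rightarrow> 'a \<Rightarrow>\<^sub>L 'b.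
        (\<forall>x\<in>U. (f has_derivative blinfun_apply (Df x)) (at x)) \<and>
        continuous_on U Df \<and>
        bdd_above {norm (Df x - Df y) / norm (x - y) powr \<gamma> | x y. x \<in> U \<and> y \<in> U \<and> x \<noteq> y})"

definition C1_holder_diffeo_on ::
    "real \<Rightarrow> 'a::banach set \<Rightarrow> ('a \<Rightarrow> 'b::banach) \<Rightarrow> bool" where
  "C1_holder_diffeo_on \<gamma> V R \<longleftrightarrow>
     C1_holder_on \<gamma> V R \<and> inj_on R V \<and> open (R ` V) \<and> C1_holder_on \<gamma> (R ` V) (inv_into V R)"

definition C1_holder_banach_space :: "real \<Rightarrow> 'a::banach itself \<Rightarrow> bool" where
  "C1_holder_banach_space \<alpha> _ \<longleftrightarrow>
     (\<exists>(\<phi> :: 'a \<Rightarrow> real) c1 c2.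
        C1_holder_on \<alpha> UNIV \<phi> \<and> range \<phi> = {0..1} \<and> 0 < c1 \<and> c1 < c2 \<and>
        (\<forall>x. norm x < c1 \<longrightarrow> \<phi> x = 1) \<and> (\<forall>x. c2 \<le> norm x \<longrightarrow> \<phi> x = 0))"

text \<open>
  The restriction of an operator to a closed subspace \<open>S\<close>, itself a Banach space, is represented
  by a total function together with the carrier \<open>S\<close>; its inverse is \<open>inv_into S A\<close>.
  Taking \<open>S = UNIV\<close> gives the notions for the whole space.
\<close>

definition onorm_on ::
    "'a::real_normed_vector set \<Rightarrow> ('a \<Rightarrow> 'b::real_normed_vector) \<Rightarrow> real" where
  "onorm_on S A = (SUP x\<in>S. norm (A x) / norm x)"

definition bounded_linear_on ::
    "'a::real_normed_vector set \<Rightarrow> ('a \<Rightarrow> 'b::real_normed_vector) \<Rightarrow> bool" where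
  "bounded_linear_on S A \<longleftrightarrow>
     (\<forall>x\<in>S. \<forall>y\<in>S. A (x + y) = A x + A y) \<and> (\<forall>c. \<forall>x\<in>S. A (c *\<^sub>R x) = c *\<^sub>R A x) \<and>
     (\<exists>K. \<forall>x\<in>S. norm (A x) \<le> K * norm x)"

definition automorphism_on :: "'a::banach set \<Rightarrow> ('a \<Rightarrow> 'a) \<Rightarrow> bool" where
  "automorphism_on S A \<longleftrightarrow> subspace S \<and> closed S \<and> bij_betw A S S \<and>
     bounded_linear_on S A \<and> bounded_linear_on S (inv_into S A)"

definition spectral_radius_on :: "'a::banach set \<Rightarrow> ('a \<Rightarrow> 'a) \<Rightarrow> real" where
  "spectral_radius_on S A = lim (\<lambda>n. root n (onorm_on S (A ^^ n)))"

definition spectral_condition_on :: "'a::banach set \<Rightarrow> ('a \<Rightarrow> 'a) \<Rightarrow> real" where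
  "spectral_condition_on S A = spectral_radius_on S A * spectral_radius_on S (inv_into S A)"

definition contracting_on :: "'a::banach set \<Rightarrow> ('a \<Rightarrow> 'a) \<Rightarrow> bool" where
  "contracting_on S A \<longleftrightarrow> automorphism_on S A \<and> spectral_radius_on S A < 1"

definition expanding_on :: "'a::banach set \<Rightarrow> ('a \<Rightarrow> 'a) \<Rightarrow> bool" where
  "expanding_on S A \<longleftrightarrow> automorphism_on S A \<and> spectral_radius_on S (inv_into S A) < 1"

definition saddle_splitting :: "('a::banach \<Rightarrow> 'a) \<Rightarrow> 'a set \<Rightarrow> 'a set \<Rightarrow> bool" where
  "saddle_splitting L Eu Es \<longleftrightarrow>
     subspace Eu \<and> closed Eu \<and> Eu \<noteq> {0} \<and> subspace Es \<and> closed Es \<and> Es \<noteq> {0} \<and>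
     Eu \<inter> Es = {0} \<and> (\<forall>x. \<exists>u\<in>Eu. \<exists>s\<in>Es. x = u + s) \<and>
     L ` Eu \<subseteq> Eu \<and> L ` Es \<subseteq> Es \<and> expanding_on Eu L \<and> contracting_on Es L"

text \<open>
  A hyperbolic automorphism has only one such splitting, so quantifying over it existentially
  is unambiguous.
\<close>

definition alpha_hyperbolic :: "real \<Rightarrow> ('a::banach \<Rightarrow> 'a) \<Rightarrow> bool" where
  "alpha_hyperbolic \<alpha> L \<longleftrightarrow> automorphism_on UNIV L \<and>
     (\<exists>Eu Es. saddle_splitting L Eu Es \<and>
        max (spectral_condition_on Eu L) (spectral_condition_on Es L) *
        max (spectral_radius_on Eu (inv_into Eu L)) (spectral_radius_on Es L) powr \<alpha> < 1)"

end

theory Submission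
  imports Defs
begin

text \<open>
  Let \<open>P\<close> and \<open>Q\<close> be the projections onto the expanding and the contracting subspace. It is
  enough to find two germs \<open>R1\<close>, \<open>R2\<close> at \<open>0\<close> with Hoelder continuous derivative, whose derivatives
  at \<open>0\<close> are \<open>P\<close> and \<open>Q\<close> and which satisfy \<open>R1 \<circ> T = L \<circ> R1\<close> and \<open>R2 \<circ> T = L \<circ> R2\<close>:
  the sum \<open>R = R1 + R2\<close> then has the identity as derivative at \<open>0\<close>, so it is a local
  diffeomorphism. Passing from \<open>T\<close> to its local inverse exchanges the roles of \<open>P\<close> and \<open>Q\<close>, so
  that a construction of \<open>R1\<close> (\<open>expanding_semiconjugacy\<close>) serves for both.

  Put \<open>f = T - L\<close> and \<open>M = L\<^sup>-\<^sup>1 P\<close>. The equation \<open>R1 \<circ> T = L \<circ> R1\<close> is solved formally by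
  \<open>R1 = P + (\<Sum>n. M\<^sup>n\<^sup>+\<^sup>1 \<circ> f \<circ> T\<^sup>n)\<close>. The obstacle is the convergence of the derivatives: in
  the expanding directions the factors \<open>M\<^sup>n\<close> and \<open>DT\<^sup>n\<close> together grow like the \<open>n\<close>-th power of a
  number \<open>\<ge> 1\<close>, and the point \<open>T\<^sup>n x\<close> moves away from \<open>0\<close>, so the smallness of \<open>Df\<close> near \<open>0\<close> does
  not help. What does shrink along an orbit is the contracting component \<open>Q (T\<^sup>n x)\<close>. If \<open>f\<close>
  vanishes on the expanding subspace, then so does \<open>Df\<close> in the expanding directions, its size at
  \<open>T\<^sup>n x\<close> is at most a multiple of the \<open>\<alpha>\<close>-th power of \<open>norm (Q (T\<^sup>n x))\<close>, and
  \<open>\<alpha>\<close>-hyperbolicity says that this gain beats the loss. The terms of the series then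
  have geometrically decreasing derivatives. Their Hoelder constants may still grow geometrically;
  interpolating between the two estimates costs a part of the exponent, and this is why \<open>\<beta>\<close> is
  smaller than \<open>\<alpha>\<close> (\<open>expanding_semiconjugacy_on_tube\<close>).

  That \<open>f\<close> vanishes on the expanding subspace means that \<open>T\<close> is linear there. A change of
  coordinates achieves it: the unstable manifold has a parametrization \<open>y + k y\<close> that conjugates
  \<open>T\<close> to \<open>L\<close>, where \<open>k = L \<circ> k \<circ> M + f \<circ> (M + k \<circ> M)\<close>. On maps that vanish to first
  order at \<open>0\<close> the right-hand side preserves a bound for the \<open>\<alpha>\<close>-Hoelder constant of the
  derivative and contracts distances weighted by \<open>norm x powr (1 + \<alpha>)\<close>, again by
  \<open>\<alpha>\<close>-hyperbolicity. Here no exponent is lost (\<open>unstable_manifold_in_unit_ball\<close>). In the new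
  coordinates the bump function of the space extends \<open>f\<close> to the whole space, small in the
  \<open>C\<^sup>1\<close> sense and still zero on the expanding subspace (\<open>cutoff_of_germ\<close>).

  Spectral radii control the norms of high powers only. Instead of changing the norm, the argument
  is applied to an iterate of \<open>T\<close> for which all relevant products of operator norms are small
  (\<open>alpha_hyperbolic_iterate\<close>), and a conjugacy for the iterate is averaged into one for \<open>T\<close>
  (\<open>conjugacy_from_iterate\<close>).
\<close>

section \<open>Maps with Hoelder continuous derivative and their germs\<close>

text \<open>
  The derivative is carried along explicitly, because all estimates below concern it, and so
  is the Hoelder constant \<open>H\<close>, because the fixed point and series arguments need to know how
  it changes.
\<close>

definition holder_derivative ::
    "real \<Rightarrow> real \<Rightarrow> 'a::real_normed_vector set \<Rightarrow> ('a \<Rightarrow> 'b::real_normed_vector) \<Rightarrow> ('a \<Rightarrow> 'a \<Rightarrow>\<^sub>L 'b) \<Rightarrow> bool"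
  where "holder_derivative \<gamma> H S f Df \<longleftrightarrow>
     (\<forall>x\<in>S. (f has_derivative blinfun_apply (Df x)) (at x)) \<and>
     (\<forall>x\<in>S. \<forall>y\<in>S. norm (Df x - Df y) \<le> H * norm (x - y) powr \<gamma>)"

lemma holder_derivativeD:
  assumes "holder_derivative \<gamma> H S f Df" "x \<in> S"
  shows "(f has_derivative blinfun_apply (Df x)) (at x)"
    and "y \<in> S \<Longrightarrow> norm (Df x - Df y) \<le> H * norm (x - y) powr \<gamma>"
  using assms by (auto simp: holder_derivative_def)

lemma holder_derivative_subset:
  "holder_derivative \<gamma> H S f Df \<Longrightarrow> S' \<subseteq> S \<Longrightarrow> holder_derivative \<gamma> H S' f Df"
  unfolding holder_derivative_def by blast

lemma holder_derivative_weaken: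
  assumes "holder_derivative \<gamma> H S f Df" "H \<le> H'"
  shows "holder_derivative \<gamma> H' S f Df"
  using assms unfolding holder_derivative_def
  by (meson mult_right_mono order_trans powr_ge_zero)

lemma powr_le_bounded_diameter:
  fixes t :: real
  assumes "0 \<le> t" "t \<le> d" "\<delta> \<le> \<gamma>"
  shows "t powr \<gamma> \<le> d powr (\<gamma> - \<delta>) * t powr \<delta>"
proof (cases "t = 0")
  case False
  then have "t powr \<gamma> = t powr (\<gamma> - \<delta>) * t powr \<delta>"
    by (simp flip: powr_add)
  also have "\<dots> \<le> d powr (\<gamma> - \<delta>) * t powr \<delta>"
    using assms by (intro mult_right_mono powr_mono2) auto
  finally show ?thesis .
qed auto

lemma le_powr_bounded_diameter:
  fixes t :: real
  assumes "0 \<le> t" "t \<le> d" "\<gamma> \<le> 1"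
  shows "t \<le> d powr (1 - \<gamma>) * t powr \<gamma>"
  using powr_le_bounded_diameter[of t d \<gamma> 1] assms by auto

lemma lipschitz_from_derivative:
  fixes f :: "'a::real_normed_vector \<Rightarrow> 'b::real_normed_vector"
  assumes "convex S" "\<And>x. x \<in> S \<Longrightarrow> (f has_derivative blinfun_apply (Df x)) (at x)"
    and "\<And>x. x \<in> S \<Longrightarrow> norm (Df x) \<le> B" "x \<in> S" "y \<in> S"
  shows "norm (f x - f y) \<le> B * norm (x - y)"
  using assms
  by (intro differentiable_bound[where f' = "\<lambda>x. blinfun_apply (Df x)"])
     (auto simp: norm_blinfun.rep_eq[symmetric] has_derivative_at_withinI)

lemma norm_blinfun_apply_le: "norm f \<le> c \<Longrightarrow> norm (blinfun_apply f x) \<le> c * norm x"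
  by (meson mult_right_mono norm_blinfun norm_ge_zero order_trans)

lemma norm_blinfun_compose_le:
  "norm f \<le> a \<Longrightarrow> norm g \<le> b \<Longrightarrow> norm (f o\<^sub>L g) \<le> a * b"
  by (meson mult_mono norm_blinfun_compose norm_ge_zero order_trans)

text \<open>
  The product rule for differences, \<open>X Y - X' Y' = (X - X') Y + X' (Y - Y')\<close>.
\<close>

lemma norm_compose_diff_le:
  fixes X :: "'b::real_normed_vector \<Rightarrow>\<^sub>L 'c::real_normed_vector" and Y :: "'a::real_normed_vector \<Rightarrow>\<^sub>L 'b"
  assumes "norm (X - X') \<le> a" "norm Y \<le> b" "norm X' \<le> c" "norm (Y - Y') \<le> d"
  shows "norm ((X o\<^sub>L Y) - (X' o\<^sub>L Y')) \<le> a * b + c * d"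
proof -
  have "(X o\<^sub>L Y) - (X' o\<^sub>L Y') = ((X - X') o\<^sub>L Y) + (X' o\<^sub>L (Y - Y'))"
    by (intro blinfun_eqI) (simp add: blinfun.bilinear_simps)
  moreover have "norm ((X - X') o\<^sub>L Y) \<le> a * b" "norm (X' o\<^sub>L (Y - Y')) \<le> c * d"
    using assms by (auto intro: norm_blinfun_compose_le)
  ultimately show ?thesis
    using norm_triangle_ineq[of "(X - X') o\<^sub>L Y" "X' o\<^sub>L (Y - Y')"] by simp
qed

lemma holder_derivative_compose:
  assumes f: "holder_derivative \<gamma> H S f Df" and g: "holder_derivative \<gamma> G S' g Dg"
    and "f ` S \<subseteq> S'" "convex S" "0 \<le> \<gamma>" "0 \<le> G"
    and B: "\<And>x. x \<in> S \<Longrightarrow> norm (Df x) \<le> B" and C: "\<And>x. x \<in> S' \<Longrightarrow> norm (Dg x) \<le> C"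
  shows "holder_derivative \<gamma> (G * B powr \<gamma> * B + C * H) S (g \<circ> f) (\<lambda>x. Dg (f x) o\<^sub>L Df x)"
  unfolding holder_derivative_def
proof safe
  fix x assume x: "x \<in> S"
  show "((g \<circ> f) has_derivative blinfun_apply (Dg (f x) o\<^sub>L Df x)) (at x)"
    using diff_chain_at[OF holder_derivativeD(1)[OF f x] holder_derivativeD(1)[OF g, of "f x"]] x assms(3)
    by (auto simp: blinfun_compose.rep_eq)
  fix y assume y: "y \<in> S"
  have B0: "0 \<le> B" using B[OF x] norm_ge_zero order_trans by blast
  have "norm (f x - f y) \<le> B * norm (x - y)"
    by (rule lipschitz_from_derivative[OF \<open>convex S\<close> holder_derivativeD(1)[OF f] B x y])
  then have "norm (f x - f y) powr \<gamma> \<le> (B * norm (x - y)) powr \<gamma>"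
    using \<open>0 \<le> \<gamma>\<close> by (intro powr_mono2) auto
  also have "\<dots> = B powr \<gamma> * norm (x - y) powr \<gamma>" using B0 by (simp add: powr_mult)
  finally have "norm (Dg (f x) - Dg (f y)) \<le> G * (B powr \<gamma> * norm (x - y) powr \<gamma>)"
    using holder_derivativeD(2)[OF g, of "f x" "f y"] x y assms(3) \<open>0 \<le> G\<close>
    by (meson image_subset_iff mult_left_mono order_trans)
  then show "norm ((Dg (f x) o\<^sub>L Df x) - (Dg (f y) o\<^sub>L Df y))
      \<le> (G * B powr \<gamma> * B + C * H) * norm (x - y) powr \<gamma>"
    using norm_compose_diff_le[OF _ B[OF x] C[of "f y"] holder_derivativeD(2)[OF f x y],
        of "Dg (f x)" "G * (B powr \<gamma> * norm (x - y) powr \<gamma>)"] x y assms(3)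
    by (auto simp: algebra_simps)
qed

lemma holder_derivative_bounded:
  assumes "holder_derivative \<gamma> H S f Df" "S \<subseteq> ball 0 r" "0 \<in> S" "0 \<le> \<gamma>" "0 \<le> H" "x \<in> S"
  shows "norm (Df x) \<le> norm (Df 0) + H * r powr \<gamma>"
proof -
  have "norm (Df x - Df 0) \<le> H * norm x powr \<gamma>"
    using holder_derivativeD(2)[OF assms(1) \<open>x \<in> S\<close> \<open>0 \<in> S\<close>] by simp
  also have "\<dots> \<le> H * r powr \<gamma>"
    using assms by (intro mult_left_mono powr_mono2) (auto simp: subset_iff)
  finally show ?thesis using norm_triangle_sub[of "Df x" "Df 0"] by linarith
qed

lemma holder_derivative_linear: "holder_derivative \<gamma> 0 S (blinfun_apply A) (\<lambda>_. A)"
  unfolding holder_derivative_def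
  by (auto intro: bounded_linear_imp_has_derivative blinfun.bounded_linear_right)

lemma holder_derivative_add:
  assumes f: "holder_derivative \<gamma> H S f Df" and g: "holder_derivative \<gamma> G S g Dg"
  shows "holder_derivative \<gamma> (H + G) S (\<lambda>x. f x + g x) (\<lambda>x. Df x + Dg x)"
  unfolding holder_derivative_def
proof safe
  fix x assume x: "x \<in> S"
  show "((\<lambda>x. f x + g x) has_derivative blinfun_apply (Df x + Dg x)) (at x)"
    using has_derivative_add[OF holder_derivativeD(1)[OF f x] holder_derivativeD(1)[OF g x]]
    by (simp add: blinfun.add_left[abs_def] plus_blinfun.rep_eq)
  fix y assume y: "y \<in> S"
  have "norm (Df x + Dg x - (Df y + Dg y)) \<le> norm (Df x - Df y) + norm (Dg x - Dg y)"
    by (rule norm_diff_triangle_ineq)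
  then show "norm (Df x + Dg x - (Df y + Dg y)) \<le> (H + G) * norm (x - y) powr \<gamma>"
    using holder_derivativeD(2)[OF f x y] holder_derivativeD(2)[OF g x y]
    by (simp add: algebra_simps)
qed

lemma holder_derivative_linear_add:
  fixes A :: "'a::real_normed_vector \<Rightarrow>\<^sub>L 'b::real_normed_vector"
  assumes "holder_derivative \<gamma> H S f Df"
  shows "holder_derivative \<gamma> H S (\<lambda>x. A x + f x) (\<lambda>x. A + Df x)"
  unfolding holder_derivative_def
proof safe
  fix x assume "x \<in> S"
  then show "((\<lambda>x. A x + f x) has_derivative blinfun_apply (A + Df x)) (at x)"
    by (auto intro!: derivative_eq_intros holder_derivativeD(1)[OF assms] simp: blinfun.bilinear_simps)
  fix y assume "y \<in> S"
  with \<open>x \<in> S\<close> show "norm (A + Df x - (A + Df y)) \<le> H * norm (x - y) powr \<gamma>"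
    using holder_derivativeD(2)[OF assms] by simp
qed

lemma holder_derivative_compose_linear_left:
  assumes "holder_derivative \<gamma> H S g Dg"
  shows "holder_derivative \<gamma> (norm A * H) S (\<lambda>x. blinfun_apply A (g x)) (\<lambda>x. A o\<^sub>L Dg x)"
  unfolding holder_derivative_def
proof safe
  fix x assume "x \<in> S"
  then show "((\<lambda>x. A (g x)) has_derivative blinfun_apply (A o\<^sub>L Dg x)) (at x)"
    by (auto intro!: derivative_eq_intros holder_derivativeD(1)[OF assms])
  fix y assume "y \<in> S"
  have "(A o\<^sub>L Dg x) - (A o\<^sub>L Dg y) = A o\<^sub>L (Dg x - Dg y)"
    by (intro blinfun_eqI) (simp add: blinfun.bilinear_simps)
  then show "norm ((A o\<^sub>L Dg x) - (A o\<^sub>L Dg y)) \<le> norm A * H * norm (x - y) powr \<gamma>"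
    using norm_blinfun_compose_le[OF order_refl holder_derivativeD(2)[OF assms \<open>x \<in> S\<close> \<open>y \<in> S\<close>], of A]
    by (simp add: mult.assoc)
qed

lemma holder_derivative_at_zero:
  assumes f: "holder_derivative \<gamma> H (ball 0 r) f Df" and "Df 0 = 0" and "x \<in> ball 0 r"
  shows "norm (Df x) \<le> H * norm x powr \<gamma>"
proof -
  have "0 \<in> ball 0 r" using norm_ge_zero[of x] \<open>x \<in> ball 0 r\<close> by (simp del: norm_ge_zero)
  then show ?thesis using holder_derivativeD(2)[OF f \<open>x \<in> ball 0 r\<close>, of 0] assms(2) by simp
qed

text \<open>
  The mean value inequality on the ball of radius \<open>norm x\<close>, where the derivative is at most
  \<open>H * norm x powr \<gamma>\<close>.
\<close>

lemma holder_derivative_remainder: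
  fixes f :: "'a::real_normed_vector \<Rightarrow> 'b::real_normed_vector"
  assumes f: "holder_derivative \<gamma> H (ball 0 r) f Df" and "f 0 = 0" "Df 0 = 0" "0 \<le> H" "0 \<le> \<gamma>" and "x \<in> ball 0 r"
  shows "norm (f x) \<le> H * norm x powr \<gamma> * norm x"
proof -
  have sub: "cball 0 (norm x) \<subseteq> ball 0 r" using \<open>x \<in> ball 0 r\<close> by auto
  have "norm (f x - f 0) \<le> (H * norm x powr \<gamma>) * norm (x - 0)"
  proof (rule lipschitz_from_derivative[of "cball 0 (norm x)"])
    fix y :: 'a assume y: "y \<in> cball 0 (norm x)"
    then have "y \<in> ball 0 r" using sub by blast
    show "(f has_derivative blinfun_apply (Df y)) (at y)"
      by (rule holder_derivativeD(1)[OF f \<open>y \<in> ball 0 r\<close>])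
    have "norm (Df y) \<le> H * norm y powr \<gamma>"
      by (rule holder_derivative_at_zero[OF f \<open>Df 0 = 0\<close> \<open>y \<in> ball 0 r\<close>])
    also have "\<dots> \<le> H * norm x powr \<gamma>"
      using y assms(4,5) by (intro mult_left_mono powr_mono2) auto
    finally show "norm (Df y) \<le> H * norm x powr \<gamma>" .
  qed auto
  then show ?thesis using assms(2) by simp
qed

text \<open>
  Germs at \<open>0\<close> of maps that fix \<open>0\<close>. They are closed under composition, sums and local
  inversion without any bookkeeping of domains, which suits the changes of coordinates and
  the passage to iterates below.
\<close>

definition C1_germ ::
    "real \<Rightarrow> ('a::real_normed_vector \<Rightarrow> 'b::real_normed_vector) \<Rightarrow> ('a \<Rightarrow>\<^sub>L 'b) \<Rightarrow> bool"
  where "C1_germ \<gamma> f A \<longleftrightarrow>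
     f 0 = 0 \<and> (\<exists>r>0. \<exists>H\<ge>0. \<exists>Df. holder_derivative \<gamma> H (ball 0 r) f Df \<and> Df 0 = A)"

lemma C1_germE:
  assumes "C1_germ \<gamma> f A"
  obtains r H Df where "0 < r" "0 \<le> H" "holder_derivative \<gamma> H (ball 0 r) f Df" "Df 0 = A" "f 0 = 0"
  using assms unfolding C1_germ_def by blast

lemma C1_germ_has_derivative: "C1_germ \<gamma> f A \<Longrightarrow> (f has_derivative blinfun_apply A) (at 0)"
  by (auto simp: holder_derivative_def elim!: C1_germE)

lemma C1_germ_tendsto:
  assumes "C1_germ \<gamma> f A" shows "filterlim f (nhds 0) (nhds 0)"
proof -
  have "isCont f 0" "f 0 = 0"
    using assms C1_germ_has_derivative has_derivative_continuous by (blast elim: C1_germE)+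
  then show ?thesis by (simp add: isCont_def tendsto_nhds_iff)
qed

lemma C1_germ_eventually:
  "C1_germ \<gamma> f A \<Longrightarrow> \<forall>\<^sub>F x in nhds 0. Pr x \<Longrightarrow> \<forall>\<^sub>F x in nhds 0. Pr (f x)"
  using C1_germ_tendsto eventually_compose_filterlim by blast

lemma C1_germ_compose:
  assumes "C1_germ \<gamma> f A" "C1_germ \<gamma> g B" "0 < \<gamma>"
  shows "C1_germ \<gamma> (g \<circ> f) (B o\<^sub>L A)"
proof -
  obtain r H Df where f: "0 < r" "0 \<le> H" "holder_derivative \<gamma> H (ball 0 r) f Df" "Df 0 = A" "f 0 = 0"
    using assms(1) by (rule C1_germE)
  obtain r' H' Dg where g: "0 < r'" "0 \<le> H'" "holder_derivative \<gamma> H' (ball 0 r') g Dg" "Dg 0 = B" "g 0 = 0"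
    using assms(2) by (rule C1_germE)
  have "\<forall>\<^sub>F x in nhds 0. f x \<in> ball 0 r'"
    by (rule C1_germ_eventually[OF assms(1)]) (use g(1) in \<open>auto simp: eventually_nhds_metric\<close>)
  then obtain d where d: "d > 0" "\<And>x. x \<in> ball 0 d \<Longrightarrow> f x \<in> ball 0 r'"
    by (auto simp: eventually_nhds_metric dist_commute)
  define s where "s = min d r"
  have s: "s > 0" "ball 0 s \<subseteq> ball (0::'a) r" "f ` ball 0 s \<subseteq> ball 0 r'"
    using d f(1) by (auto simp: s_def)
  have hf: "holder_derivative \<gamma> H (ball 0 s) f Df"
    using holder_derivative_subset[OF f(3) s(2)] .
  have B: "norm (Df x) \<le> norm A + H * r powr \<gamma>" if "x \<in> ball 0 s" for x
    using holder_derivative_bounded[OF f(3) order_refl] that s f \<open>0 < \<gamma>\<close> by auto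
  have C: "norm (Dg x) \<le> norm B + H' * r' powr \<gamma>" if "x \<in> ball 0 r'" for x
    using holder_derivative_bounded[OF g(3) order_refl] that g \<open>0 < \<gamma>\<close> by auto
  let ?B = "norm A + H * r powr \<gamma>" and ?C = "norm B + H' * r' powr \<gamma>"
  have *: "holder_derivative \<gamma> (H' * ?B powr \<gamma> * ?B + ?C * H) (ball 0 s) (g \<circ> f) (\<lambda>x. Dg (f x) o\<^sub>L Df x)"
    by (rule holder_derivative_compose[OF hf g(3) s(3) convex_ball _ g(2) B C]) (use \<open>0 < \<gamma>\<close> in auto)
  have H0: "0 \<le> H' * ?B powr \<gamma> * ?B + ?C * H"
    using f(2) g(2) by (intro add_nonneg_nonneg mult_nonneg_nonneg) auto
  have "(g \<circ> f) 0 = 0" "Dg (f 0) o\<^sub>L Df 0 = B o\<^sub>L A"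
    using f g by auto
  then show ?thesis
    unfolding C1_germ_def using s(1) H0 * by blast
qed

lemma C1_germ_linear: "C1_germ \<gamma> (blinfun_apply A) A"
  unfolding C1_germ_def holder_derivative_def
  by (auto intro!: exI[of _ 1] exI[of _ "\<lambda>_. A"] bounded_linear_imp_has_derivative blinfun.bounded_linear_right)

lemma C1_germ_add:
  assumes "C1_germ \<gamma> f A" "C1_germ \<gamma> g B"
  shows "C1_germ \<gamma> (\<lambda>x. f x + g x) (A + B)"
proof -
  obtain r H Df where f: "0 < r" "0 \<le> H" "holder_derivative \<gamma> H (ball 0 r) f Df" "Df 0 = A" "f 0 = 0"
    using assms(1) by (rule C1_germE)
  obtain r' H' Dg where g: "0 < r'" "0 \<le> H'" "holder_derivative \<gamma> H' (ball 0 r') g Dg" "Dg 0 = B" "g 0 = 0"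
    using assms(2) by (rule C1_germE)
  define s where "s = min r r'"
  have "holder_derivative \<gamma> (H + H') (ball 0 s) (\<lambda>x. f x + g x) (\<lambda>x. Df x + Dg x)"
    by (intro holder_derivative_add holder_derivative_subset[OF f(3)] holder_derivative_subset[OF g(3)])
       (auto simp: s_def)
  moreover have "s > 0" "0 \<le> H + H'" "Df 0 + Dg 0 = A + B" "f 0 + g 0 = 0"
    using f g by (auto simp: s_def)
  ultimately show ?thesis
    unfolding C1_germ_def by blast
qed

text \<open>
  On a ball of radius \<open>r\<close> distances are at most \<open>2 * r\<close>, so a higher power of a distance is
  bounded by a multiple of a lower one.
\<close>

lemma C1_germ_exponent:
  assumes "C1_germ \<gamma> f A" "\<delta> \<le> \<gamma>"
  shows "C1_germ \<delta> f A"
proof -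
  obtain r H Df where f: "0 < r" "0 \<le> H" "holder_derivative \<gamma> H (ball 0 r) f Df" "Df 0 = A" "f 0 = 0"
    using assms(1) by (rule C1_germE)
  have "holder_derivative \<delta> (H * (2 * r) powr (\<gamma> - \<delta>)) (ball 0 r) f Df"
    unfolding holder_derivative_def
  proof safe
    fix x y :: 'a assume *: "x \<in> ball 0 r" "y \<in> ball 0 r"
    have "norm (x - y) \<le> 2 * r" using * norm_triangle_ineq4[of x y] by auto
    then have "H * norm (x - y) powr \<gamma> \<le> H * ((2 * r) powr (\<gamma> - \<delta>) * norm (x - y) powr \<delta>)"
      using assms(2) f(2) by (intro mult_left_mono powr_le_bounded_diameter) auto
    then show "norm (Df x - Df y) \<le> H * (2 * r) powr (\<gamma> - \<delta>) * norm (x - y) powr \<delta>"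
      using holder_derivativeD(2)[OF f(3) *] by (simp add: mult.assoc)
  qed (use f holder_derivativeD in blast)
  moreover have "0 \<le> H * (2 * r) powr (\<gamma> - \<delta>)" using f(2) by simp
  ultimately show ?thesis
    unfolding C1_germ_def using f(1,4,5) by blast
qed

definition blinfun_power :: "('a::real_normed_vector \<Rightarrow>\<^sub>L 'a) \<Rightarrow> nat \<Rightarrow> 'a \<Rightarrow>\<^sub>L 'a"
  where "blinfun_power A n = ((o\<^sub>L) A ^^ n) id_blinfun"

lemma blinfun_power_apply: "blinfun_apply (blinfun_power A n) = (blinfun_apply A ^^ n)"
  by (induction n) (auto simp: blinfun_power_def fun_eq_iff)

lemma C1_germ_funpow:
  fixes f :: "'a::real_normed_vector \<Rightarrow> 'a"
  assumes "C1_germ \<gamma> f A" "0 < \<gamma>"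
  shows "C1_germ \<gamma> (f ^^ n) (blinfun_power A n)"
  unfolding blinfun_power_def
proof (induction n)
  case 0
  have "blinfun_apply id_blinfun = (f ^^ 0)" by (rule ext) simp
  then show ?case using C1_germ_linear[of \<gamma> "id_blinfun :: 'a \<Rightarrow>\<^sub>L 'a"] by simp
next
  case (Suc n)
  then show ?case using C1_germ_compose[OF Suc.IH assms(1,2)] by (simp add: o_def)
qed

lemma C1_germ_scale:
  assumes "C1_germ \<gamma> f A" "s > 0" "0 < \<gamma>"
  shows "C1_germ \<gamma> (\<lambda>x. f (s *\<^sub>R x) /\<^sub>R s) A"
proof -
  have "C1_germ \<gamma> (blinfun_apply (inverse s *\<^sub>R id_blinfun) \<circ> (f \<circ> blinfun_apply (s *\<^sub>R id_blinfun)))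
      ((inverse s *\<^sub>R id_blinfun) o\<^sub>L (A o\<^sub>L (s *\<^sub>R id_blinfun)))"
    by (intro C1_germ_compose C1_germ_linear assms)
  moreover have "(inverse s *\<^sub>R id_blinfun) o\<^sub>L (A o\<^sub>L (s *\<^sub>R id_blinfun)) = A"
    using assms(2) by (intro blinfun_eqI) (simp add: blinfun.bilinear_simps)
  moreover have "blinfun_apply (inverse s *\<^sub>R id_blinfun) \<circ> (f \<circ> blinfun_apply (s *\<^sub>R id_blinfun)) = (\<lambda>x. f (s *\<^sub>R x) /\<^sub>R s)"
    by (auto simp: fun_eq_iff blinfun.bilinear_simps)
  ultimately show ?thesis by simp
qed

text \<open>
  Zooming in by the factor \<open>s\<close> multiplies the Hoelder constant by \<open>s powr \<alpha>\<close> and enlarges the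
  radius of the domain by the factor \<open>1 / s\<close>. So a germ may be studied on a ball of any
  prescribed radius with a Hoelder constant that is as small as desired.
\<close>

lemma C1_germ_zoom:
  assumes "C1_germ \<alpha> f A" "0 < \<eta>" "0 < R" "0 < \<alpha>"
  obtains s0 Df where "0 < s0" "Df 0 = A"
    "\<And>s. 0 < s \<Longrightarrow> s \<le> s0 \<Longrightarrow>
       holder_derivative \<alpha> \<eta> (ball 0 R) (\<lambda>x. f (s *\<^sub>R x) /\<^sub>R s) (\<lambda>x. Df (s *\<^sub>R x))"
proof -
  obtain r H Df where f: "0 < r" "0 \<le> H" "holder_derivative \<alpha> H (ball 0 r) f Df" "Df 0 = A" "f 0 = 0"
    using assms(1) by (rule C1_germE)
  have "((\<lambda>s. H * s powr \<alpha>) \<longlongrightarrow> H * 0 powr \<alpha>) (at_right 0)"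
    using assms(4) by (intro tendsto_intros) (auto simp: eventually_at_filter)
  then have "\<forall>\<^sub>F s in at_right 0. H * s powr \<alpha> < \<eta>"
    by (rule order_tendstoD) (use assms in simp)
  moreover have "\<forall>\<^sub>F s in at_right 0. s \<in> {0<..<r / R}"
    using f(1) assms(3) by (intro eventually_at_right_real) auto
  ultimately have "\<forall>\<^sub>F s in at_right 0. H * s powr \<alpha> < \<eta> \<and> s \<in> {0<..<r / R}"
    by (rule eventually_conj)
  from eventually_happens[OF this] obtain s0 where s0: "H * s0 powr \<alpha> < \<eta>" "0 < s0" "s0 < r / R" by auto
  have "holder_derivative \<alpha> \<eta> (ball 0 R) (\<lambda>x. f (s *\<^sub>R x) /\<^sub>R s) (\<lambda>x. Df (s *\<^sub>R x))"
    if s: "0 < s" "s \<le> s0" for s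
    unfolding holder_derivative_def
  proof safe
    have in_r: "s *\<^sub>R x \<in> ball 0 r" if "x \<in> ball 0 R" for x :: 'a
    proof -
      have "s * norm x < s * R" using that s(1) by simp
      also have "\<dots> \<le> s0 * R" using s(2) assms(3) by simp
      also have "\<dots> < r" using s0(3) assms(3) by (simp add: pos_less_divide_eq)
      finally show ?thesis using s(1) by simp
    qed
    fix x :: 'a assume x: "x \<in> ball 0 R"
    have "((\<lambda>x. f (s *\<^sub>R x) /\<^sub>R s) has_derivative (\<lambda>h. Df (s *\<^sub>R x) (s *\<^sub>R h) /\<^sub>R s)) (at x)"
      by (intro has_derivative_scaleR_right has_derivative_ident
          has_derivative_compose[where f = "\<lambda>x. s *\<^sub>R x" and g = f, OF _ holder_derivativeD(1)[OF f(3) in_r[OF x]]])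
    then show "((\<lambda>x. f (s *\<^sub>R x) /\<^sub>R s) has_derivative blinfun_apply (Df (s *\<^sub>R x))) (at x)"
      using s(1) by (simp add: blinfun.scaleR_right)
    fix y :: 'a assume y: "y \<in> ball 0 R"
    have "norm (Df (s *\<^sub>R x) - Df (s *\<^sub>R y)) \<le> H * (s * norm (x - y)) powr \<alpha>"
      using holder_derivativeD(2)[OF f(3) in_r[OF x] in_r[OF y]] s(1)
      by (simp flip: scaleR_diff_right)
    also have "\<dots> = (H * s powr \<alpha>) * norm (x - y) powr \<alpha>"
      using s(1) by (simp add: powr_mult)
    also have "H * s powr \<alpha> \<le> H * s0 powr \<alpha>"
      using s f(2) assms(4) by (intro mult_left_mono powr_mono2) auto
    then have "(H * s powr \<alpha>) * norm (x - y) powr \<alpha> \<le> \<eta> * norm (x - y) powr \<alpha>"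
      using s0(1) by (intro mult_right_mono) auto
    finally show "norm (Df (s *\<^sub>R x) - Df (s *\<^sub>R y)) \<le> \<eta> * norm (x - y) powr \<alpha>" .
  qed
  then show ?thesis using that[of s0 Df] s0(2) f(4) by blast
qed

section \<open>The inverse function theorem in Banach spaces\<close>

text \<open>
  Solving \<open>K x = y\<close> amounts to finding the fixed point of the contraction
  \<open>x \<mapsto> y - (K - id) x\<close>.
\<close>

lemma blinfun_near_identity_invertible:
  fixes K :: "'a::banach \<Rightarrow>\<^sub>L 'a"
  assumes K: "norm (K - id_blinfun) \<le> 1/2"
  obtains G where "G o\<^sub>L K = id_blinfun" "K o\<^sub>L G = id_blinfun" "norm G \<le> 2"
proof -
  let ?E = "K - id_blinfun"
  have E: "norm (?E x) \<le> norm x / 2" for x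
    using norm_blinfun_apply_le[OF K, of x] by simp
  have "\<exists>!x. y - ?E x = x" for y
  proof (rule banach_fix_type[of "1/2"])
    have "dist (y - ?E u) (y - ?E v) \<le> 1/2 * dist u v" for u v
      using E[of "v - u"] by (simp add: dist_norm norm_minus_commute blinfun.diff_right)
    then show "\<forall>u v. dist (y - ?E u) (y - ?E v) \<le> 1/2 * dist u v" by blast
  qed auto
  moreover have "y - ?E x = x \<longleftrightarrow> K x = y" for x y
    by (auto simp: blinfun.bilinear_simps)
  ultimately have ex: "\<exists>!x. K x = y" for y by simp
  define g where "g y = (THE x. K x = y)" for y
  have Kg: "K (g y) = y" for y unfolding g_def by (rule theI'[OF ex])
  have gK: "g (K x) = x" for x using ex Kg by metis
  have g_le: "norm (g y) \<le> norm y * 2" for y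
  proof -
    have "norm (g y) \<le> norm (K (g y)) + norm (?E (g y))"
      using norm_triangle_ineq4[of "K (g y)" "?E (g y)"] by (simp add: blinfun.bilinear_simps)
    then show ?thesis using E[of "g y"] Kg by simp
  qed
  have "bounded_linear g"
    by (rule bounded_linear_intro[of _ 2])
       (metis Kg gK blinfun.add_right, metis Kg gK blinfun.scaleR_right, rule g_le)
  then have "blinfun_apply (Blinfun g) = g" by (rule bounded_linear_Blinfun_apply)
  moreover from this have "norm (Blinfun g) \<le> 2"
    using g_le by (intro norm_blinfun_bound) (auto simp: mult.commute)
  ultimately show ?thesis
    using that[of "Blinfun g"] Kg gK by (simp add: blinfun_eqI)
qed

text \<open>
  As \<open>J \<circ> f\<close> differs from the identity by a map with Lipschitz constant \<open>1/2\<close>, the distance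
  of two points is at most \<open>2 * norm J\<close> times the distance of their images, and Newton's
  iteration \<open>x - J (f x - y)\<close> with fixed slope is a contraction. The derivative of the
  inverse is Hoelder continuous because \<open>G a - G b = G a (Df b - Df a) G b\<close> for the inverses
  \<open>G\<close> of the derivatives.
\<close>

lemma inverse_function_C1_holder:
  fixes f :: "'a::banach \<Rightarrow> 'a"
  assumes f: "holder_derivative \<gamma> H (ball 0 r) f Df" and "0 \<le> H" "0 < \<gamma>"
    and J: "J o\<^sub>L A = id_blinfun" "A o\<^sub>L J = id_blinfun"
    and near: "\<And>x. x \<in> ball 0 r \<Longrightarrow> norm ((J o\<^sub>L Df x) - id_blinfun) \<le> 1/2"
  shows "inj_on f (ball 0 r)" "open (f ` ball 0 r)"
    "\<exists>H' Dg. 0 \<le> H' \<and> holder_derivative \<gamma> H' (f ` ball 0 r) (inv_into (ball 0 r) f) Dg \<and>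
        (\<forall>x\<in>ball 0 r. Dg (f x) o\<^sub>L Df x = id_blinfun)"
proof -
  let ?B = "ball (0::'a) r"
  have Jinj: "y = 0" if "J y = 0" for y
    using that J(2) by (metis blinfun.zero_right blinfun_apply_blinfun_compose blinfun_apply_id_blinfun)
  have pert: "norm ((J (f x) - x) - (J (f y) - y)) \<le> 1/2 * norm (x - y)" if "x \<in> ?B" "y \<in> ?B" for x y
  proof (rule lipschitz_from_derivative[OF convex_ball _ near that])
    fix x assume "x \<in> ?B"
    then show "((\<lambda>x. J (f x) - x) has_derivative blinfun_apply ((J o\<^sub>L Df x) - id_blinfun)) (at x)"
      by (auto intro!: derivative_eq_intros holder_derivativeD(1)[OF f] simp: blinfun.bilinear_simps)
  qed
  have expand: "norm (x - y) \<le> 2 * norm J * norm (f x - f y)" if "x \<in> ?B" "y \<in> ?B" for x y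
  proof -
    have "norm (x - y) \<le> norm (J (f x - f y)) + norm ((J (f x) - x) - (J (f y) - y))"
      using norm_triangle_ineq4[of "J (f x - f y)" "(J (f x) - x) - (J (f y) - y)"]
      by (simp add: blinfun.bilinear_simps algebra_simps)
    then show ?thesis
      using pert[OF that] norm_blinfun[of J "f x - f y"] by linarith
  qed
  show inj: "inj_on f ?B"
    using expand by (fastforce intro!: inj_onI)
  show op: "open (f ` ?B)"
    unfolding open_dist
  proof safe
    fix x0 assume x0: "x0 \<in> ?B"
    then obtain \<rho> where \<rho>: "\<rho> > 0" "cball x0 \<rho> \<subseteq> ?B"
      using open_contains_cball open_ball by blast
    define \<delta> where "\<delta> = \<rho> / (2 * (norm J + 1))"
    have "\<delta> > 0" unfolding \<delta>_def using \<rho>(1) by (intro divide_pos_pos) (auto intro: add_nonneg_pos)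
    have "y \<in> f ` ?B" if y: "dist y (f x0) < \<delta>" for y
    proof -
      let ?\<Phi> = "\<lambda>x. x - J (f x - y)"
      have lip: "norm (?\<Phi> x - ?\<Phi> x') \<le> 1/2 * norm (x - x')" if "x \<in> cball x0 \<rho>" "x' \<in> cball x0 \<rho>" for x x'
        using pert[of x' x] subsetD[OF \<rho>(2)] that by (simp add: blinfun.bilinear_simps algebra_simps norm_minus_commute)
      have "norm (J (f x0 - y)) \<le> norm J * \<delta>"
        using y by (intro order_trans[OF norm_blinfun] mult_left_mono) (auto simp: dist_norm norm_minus_commute)
      also have "\<dots> \<le> (norm J + 1) * \<delta>" using \<open>\<delta> > 0\<close> by (intro mult_right_mono) auto
      also have "\<dots> = \<rho> / 2"
      proof -
        have "norm J + 1 \<noteq> 0" using norm_ge_zero[of J] by linarith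
        then show ?thesis unfolding \<delta>_def by (metis nonzero_mult_div_cancel_left mult.commute divide_divide_eq_left times_divide_eq_right)
      qed
      finally have x0': "norm (?\<Phi> x0 - x0) \<le> \<rho> / 2" by simp
      have "\<exists>!x\<in>cball x0 \<rho>. ?\<Phi> x = x"
      proof (rule Banach_fix[of _ "1/2"])
        show "?\<Phi> ` cball x0 \<rho> \<subseteq> cball x0 \<rho>"
        proof safe
          fix x assume x: "x \<in> cball x0 \<rho>"
          have "norm (?\<Phi> x - x0) \<le> norm (?\<Phi> x - ?\<Phi> x0) + norm (?\<Phi> x0 - x0)"
            using norm_triangle_ineq[of "?\<Phi> x - ?\<Phi> x0" "?\<Phi> x0 - x0"] by simp
          also have "\<dots> \<le> 1/2 * norm (x - x0) + \<rho> / 2"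
            using lip[OF x, of x0] \<rho>(1) x0' by auto
          also have "\<dots> \<le> \<rho>" using x by (simp add: dist_norm norm_minus_commute)
          finally show "?\<Phi> x \<in> cball x0 \<rho>" by (simp add: dist_norm norm_minus_commute)
        qed
      qed (use lip \<rho>(1) in \<open>auto simp: dist_norm complete_eq_closed\<close>)
      then obtain x where "x \<in> cball x0 \<rho>" "J (f x - y) = 0" by auto
      then show ?thesis using Jinj \<rho>(2) by (metis eq_iff_diff_eq_0 image_eqI subsetD)
    qed
    then show "\<exists>e>0. \<forall>y. dist y (f x0) < e \<longrightarrow> y \<in> f ` ?B"
      using \<open>\<delta> > 0\<close> by blast
  qed
  let ?g = "inv_into ?B f"
  have gf: "?g (f x) = x" if "x \<in> ?B" for x using inj that by simp
  have fg: "f (?g y) = y" if "y \<in> f ` ?B" for y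
    using that by (rule f_inv_into_f)
  have gB: "?g y \<in> ?B" if "y \<in> f ` ?B" for y
    using that by (rule inv_into_into)
  have ginv: "\<exists>G. G o\<^sub>L Df x = id_blinfun \<and> norm G \<le> 2 * norm J" if x: "x \<in> ?B" for x
  proof -
    obtain G where G: "G o\<^sub>L (J o\<^sub>L Df x) = id_blinfun" "norm G \<le> 2"
      using blinfun_near_identity_invertible[OF near[OF x]] by metis
    have "(G o\<^sub>L J) o\<^sub>L Df x = id_blinfun"
      using G(1) by (metis (no_types, lifting) blinfun_apply_blinfun_compose blinfun_eqI)
    then show ?thesis using norm_blinfun_compose_le[OF G(2) order_refl] by blast
  qed
  define G where "G x = (SOME G. G o\<^sub>L Df x = id_blinfun \<and> norm G \<le> 2 * norm J)" for x
  have G: "G x o\<^sub>L Df x = id_blinfun" "norm (G x) \<le> 2 * norm J" if "x \<in> ?B" for x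
    using someI_ex[OF ginv[OF that]] by (auto simp: G_def)
  have G2: "Df x o\<^sub>L G x = id_blinfun" if x: "x \<in> ?B" for x
  proof (rule blinfun_eqI)
    fix v
    obtain K where K: "(J o\<^sub>L Df x) o\<^sub>L K = id_blinfun"
      using blinfun_near_identity_invertible[OF near[OF x]] by metis
    define w where "w = K (J v)"
    have "J (Df x w) = J v" using K unfolding w_def
      by (metis blinfun_apply_blinfun_compose blinfun_apply_id_blinfun)
    then have "Df x w = v" using Jinj[of "Df x w - v"] by (simp add: blinfun.bilinear_simps)
    then show "(Df x o\<^sub>L G x) v = id_blinfun v"
      using G(1)[OF x] by (metis blinfun_apply_blinfun_compose blinfun_apply_id_blinfun)
  qed
  let ?H = "(2 * norm J)^2 * H * (2 * norm J) powr \<gamma>"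
  have "holder_derivative \<gamma> ?H (f ` ?B) ?g (\<lambda>y. G (?g y))"
    unfolding holder_derivative_def
  proof (intro conjI ballI)
    fix y assume y: "y \<in> f ` ?B"
    have "continuous_on (f ` ?B) ?g"
    proof (rule lipschitz_on_continuous_on[OF lipschitz_onI])
      show "dist (?g y) (?g z) \<le> (2 * norm J) * dist y z" if "y \<in> f ` ?B" "z \<in> f ` ?B" for y z
        using expand[OF gB[OF that(1)] gB[OF that(2)]] fg that by (simp add: dist_norm)
    qed simp
    then have "continuous (at y) ?g"
      using op y continuous_on_eq_continuous_at by blast
    then show "(?g has_derivative blinfun_apply (G (?g y))) (at y)"
    proof (intro has_derivative_inverse_basic[OF holder_derivativeD(1)[OF f gB[OF y]] _ _ _ op y fg])
      show "blinfun_apply (G (?g y)) \<circ> blinfun_apply (Df (?g y)) = id"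
        using G(1)[OF gB[OF y]]
        by (simp add: fun_eq_iff flip: blinfun_apply_blinfun_compose)
    qed (simp_all add: blinfun.bounded_linear_right)
    fix z assume z: "z \<in> f ` ?B"
    let ?a = "?g y" and ?b = "?g z"
    have ab: "?a \<in> ?B" "?b \<in> ?B" using gB y z by auto
    have "G ?a - G ?b = (G ?a o\<^sub>L (Df ?b - Df ?a)) o\<^sub>L G ?b"
    proof (rule blinfun_eqI)
      fix v
      have "G ?a (Df ?a (G ?b v)) = G ?b v" "Df ?b (G ?b v) = v"
        using G(1)[OF ab(1)] G2[OF ab(2)] by (metis blinfun_apply_blinfun_compose blinfun_apply_id_blinfun)+
      then show "(G ?a - G ?b) v = ((G ?a o\<^sub>L (Df ?b - Df ?a)) o\<^sub>L G ?b) v"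
        by (simp add: blinfun.bilinear_simps)
    qed
    moreover have "norm (?a - ?b) powr \<gamma> \<le> (2 * norm J * norm (y - z)) powr \<gamma>"
      using expand[OF ab] fg y z \<open>0 < \<gamma>\<close> by (intro powr_mono2) auto
    then have "H * norm (?b - ?a) powr \<gamma> \<le> H * ((2 * norm J) powr \<gamma> * norm (y - z) powr \<gamma>)"
      using \<open>0 \<le> H\<close> by (intro mult_left_mono) (simp_all add: powr_mult norm_minus_commute)
    then have "norm (Df ?b - Df ?a) \<le> H * ((2 * norm J) powr \<gamma> * norm (y - z) powr \<gamma>)"
      using holder_derivativeD(2)[OF f ab(2) ab(1)] by linarith
    ultimately have "norm (G ?a - G ?b) \<le>
        (2 * norm J) * (H * ((2 * norm J) powr \<gamma> * norm (y - z) powr \<gamma>)) * (2 * norm J)"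
      by (simp only: norm_blinfun_compose_le[OF norm_blinfun_compose_le[OF G(2)[OF ab(1)]] G(2)[OF ab(2)]])
    then show "norm (G ?a - G ?b) \<le> ?H * norm (y - z) powr \<gamma>"
      by (simp add: power2_eq_square algebra_simps)
  qed
  moreover have "0 \<le> ?H" using \<open>0 \<le> H\<close> by simp
  moreover have "\<forall>x\<in>?B. G (?g (f x)) o\<^sub>L Df x = id_blinfun"
    using G(1) gf by simp
  ultimately show "\<exists>H' Dg. 0 \<le> H' \<and> holder_derivative \<gamma> H' (f ` ?B) ?g Dg \<and>
        (\<forall>x\<in>?B. Dg (f x) o\<^sub>L Df x = id_blinfun)" by blast
qed

lemma C1_germ_near_identity:
  assumes "C1_germ \<gamma> f A" and "J o\<^sub>L A = id_blinfun" "0 < \<gamma>"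
  obtains r H Df where "0 < r" "0 \<le> H" "holder_derivative \<gamma> H (ball 0 r) f Df" "Df 0 = A" "f 0 = 0"
    "\<And>x. x \<in> ball 0 r \<Longrightarrow> norm ((J o\<^sub>L Df x) - id_blinfun) \<le> 1/2"
proof -
  obtain r H Df where f: "0 < r" "0 \<le> H" "holder_derivative \<gamma> H (ball 0 r) f Df" "Df 0 = A" "f 0 = 0"
    using assms(1) by (rule C1_germE)
  have "((\<lambda>s. norm J * (H * s powr \<gamma>)) \<longlongrightarrow> norm J * (H * 0 powr \<gamma>)) (at_right 0)"
    using assms(3) by (intro tendsto_intros) (auto simp: eventually_at_filter)
  then have "\<forall>\<^sub>F s in at_right 0. norm J * (H * s powr \<gamma>) < 1/2"
    by (rule order_tendstoD) simp
  moreover have "\<forall>\<^sub>F s in at_right 0. s \<in> {0<..<r}"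
    using f(1) eventually_at_right_real by blast
  ultimately obtain s where s: "norm J * (H * s powr \<gamma>) < 1/2" "0 < s" "s < r"
    using eventually_happens[OF eventually_conj] by fastforce
  show ?thesis
  proof
    fix x :: 'a assume x: "x \<in> ball 0 s"
    have "(J o\<^sub>L Df x) - id_blinfun = J o\<^sub>L (Df x - Df 0)"
      unfolding assms(2)[symmetric] f(4) by (intro blinfun_eqI) (simp add: blinfun.bilinear_simps)
    moreover have "norm (Df x - Df 0) \<le> H * norm x powr \<gamma>"
      using holder_derivativeD(2)[OF f(3), of x 0] x s by simp
    then have "norm (Df x - Df 0) \<le> H * s powr \<gamma>"
      using x f(2) assms(3) by (elim order_trans) (auto intro!: mult_left_mono powr_mono2)
    ultimately show "norm ((J o\<^sub>L Df x) - id_blinfun) \<le> 1/2"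
      using norm_blinfun_compose_le[OF order_refl, of _ "H * s powr \<gamma>" J] s(1) by fastforce
  next
    show "holder_derivative \<gamma> H (ball 0 s) f Df"
      using s by (intro holder_derivative_subset[OF f(3)]) auto
  qed (use s f in auto)
qed

lemma C1_germ_inverse:
  fixes f :: "'a::banach \<Rightarrow> 'a"
  assumes f: "C1_germ \<gamma> f A" and J: "J o\<^sub>L A = id_blinfun" "A o\<^sub>L J = id_blinfun" and "0 < \<gamma>"
  obtains g where "C1_germ \<gamma> g J" "\<forall>\<^sub>F x in nhds 0. g (f x) = x" "\<forall>\<^sub>F x in nhds 0. f (g x) = x"
proof -
  obtain r H Df where r: "0 < r" "0 \<le> H" "holder_derivative \<gamma> H (ball 0 r) f Df" "Df 0 = A" "f 0 = 0"
    "\<And>x. x \<in> ball 0 r \<Longrightarrow> norm ((J o\<^sub>L Df x) - id_blinfun) \<le> 1/2"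
    using C1_germ_near_identity[OF f J(1) \<open>0 < \<gamma>\<close>] by metis
  note I = inverse_function_C1_holder[OF r(3,2) \<open>0 < \<gamma>\<close> J r(6)]
  let ?g = "inv_into (ball 0 r) f"
  obtain H' Dg where g: "0 \<le> H'" "holder_derivative \<gamma> H' (f ` ball 0 r) ?g Dg"
    "\<And>x. x\<in>ball 0 r \<Longrightarrow> Dg (f x) o\<^sub>L Df x = id_blinfun"
    using I(3) by blast
  have "0 \<in> f ` ball 0 r" using r(1,5) by force
  then obtain d where d: "d > 0" "ball 0 d \<subseteq> f ` ball 0 r"
    using I(2) open_contains_ball by blast
  have "?g 0 = 0" using inv_into_f_f[OF I(1), of 0] r(1,5) by simp
  moreover have "Dg 0 = J"
  proof (rule blinfun_eqI)
    fix v
    have "Dg 0 (A (J v)) = J v"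
      using g(3)[of 0] r(1,4,5) by (metis blinfun_apply_blinfun_compose blinfun_apply_id_blinfun centre_in_ball)
    then show "Dg 0 v = J v" using J(2) by (metis blinfun_apply_blinfun_compose blinfun_apply_id_blinfun)
  qed
  ultimately have "C1_germ \<gamma> ?g J"
    unfolding C1_germ_def using d(1) g(1) holder_derivative_subset[OF g(2) d(2)] by blast
  moreover have "\<forall>\<^sub>F x in nhds 0. ?g (f x) = x"
    unfolding eventually_nhds_metric using r(1) inv_into_f_f[OF I(1)]
    by (intro exI[of _ r]) (auto simp: dist_commute)
  moreover have "\<forall>\<^sub>F x in nhds 0. f (?g x) = x"
    unfolding eventually_nhds_metric using d by (intro exI[of _ d]) (auto simp: dist_commute f_inv_into_f subset_iff)
  ultimately show ?thesis using that by blast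
qed

lemma holder_derivative_imp_C1_holder_on:
  assumes "open S" "holder_derivative \<gamma> H S f Df" "0 < \<gamma>"
  shows "C1_holder_on \<gamma> S f"
proof -
  have H: "norm (Df x - Df y) \<le> H * norm (x - y) powr \<gamma>" if "x \<in> S" "y \<in> S" for x y
    using holder_derivativeD(2)[OF assms(2) that] .
  have "continuous_on S Df"
    unfolding continuous_on_def
  proof
    fix x assume x: "x \<in> S"
    have "((\<lambda>y. H * norm (y - x) powr \<gamma>) \<longlongrightarrow> H * norm (x - x) powr \<gamma>) (at x within S)"
      using assms(3) by (intro tendsto_intros) auto
    then have "((\<lambda>y. H * norm (y - x) powr \<gamma>) \<longlongrightarrow> 0) (at x within S)" by simp
    then have "((\<lambda>y. Df y - Df x) \<longlongrightarrow> 0) (at x within S)"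
      by (rule Lim_null_comparison[rotated]) (use H x in \<open>auto simp: eventually_at_filter\<close>)
    then show "(Df \<longlongrightarrow> Df x) (at x within S)" by (rule Lim_null[THEN iffD2])
  qed
  moreover have "norm (Df x - Df y) / norm (x - y) powr \<gamma> \<le> H" if "x \<in> S" "y \<in> S" "x \<noteq> y" for x y
    using H[OF that(1,2)] that(3) by (simp add: pos_divide_le_eq)
  then have "bdd_above {norm (Df x - Df y) / norm (x - y) powr \<gamma> | x y. x \<in> S \<and> y \<in> S \<and> x \<noteq> y}"
    by (intro bdd_aboveI[of _ H]) blast
  ultimately show ?thesis
    unfolding C1_holder_on_def using assms(1) holder_derivativeD(1)[OF assms(2)] by blast
qed

lemma C1_holder_on_imp_holder_derivative:
  assumes "C1_holder_on \<gamma> S f"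
  obtains H Df where "0 \<le> H" "holder_derivative \<gamma> H S f Df"
proof -
  obtain Df where Df: "\<And>x. x \<in> S \<Longrightarrow> (f has_derivative blinfun_apply (Df x)) (at x)"
    "bdd_above {norm (Df x - Df y) / norm (x - y) powr \<gamma> | x y. x \<in> S \<and> y \<in> S \<and> x \<noteq> y}"
    using assms unfolding C1_holder_on_def by blast
  then obtain H where H: "\<And>x y. x \<in> S \<Longrightarrow> y \<in> S \<Longrightarrow> x \<noteq> y \<Longrightarrow> norm (Df x - Df y) / norm (x - y) powr \<gamma> \<le> H"
    unfolding bdd_above_def by blast
  have "norm (Df x - Df y) \<le> max H 0 * norm (x - y) powr \<gamma>" if "x \<in> S" "y \<in> S" for x y
  proof (cases "x = y")
    case False
    then have "norm (Df x - Df y) \<le> H * norm (x - y) powr \<gamma>"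
      using H[OF that False] by (simp add: pos_divide_le_eq)
    also have "\<dots> \<le> max H 0 * norm (x - y) powr \<gamma>" by (intro mult_right_mono) auto
    finally show ?thesis .
  qed auto
  then show ?thesis using that[of "max H 0" Df] Df(1) unfolding holder_derivative_def by auto
qed

lemma C1_germ_local_diffeo:
  fixes f :: "'a::banach \<Rightarrow> 'a"
  assumes f: "C1_germ \<gamma> f id_blinfun" and "0 < \<gamma>"
  obtains r where "0 < r" "\<And>s. 0 < s \<Longrightarrow> s \<le> r \<Longrightarrow> C1_holder_diffeo_on \<gamma> (ball 0 s) f"
proof -
  have [simp]: "id_blinfun o\<^sub>L X = X" for X :: "'a \<Rightarrow>\<^sub>L 'a" by (rule blinfun_eqI) simp
  obtain r H Df where r: "0 < r" "0 \<le> H" "holder_derivative \<gamma> H (ball 0 r) f Df" "Df 0 = id_blinfun" "f 0 = 0"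
    "\<And>x. x \<in> ball 0 r \<Longrightarrow> norm ((id_blinfun o\<^sub>L Df x) - id_blinfun) \<le> 1/2"
    by (rule C1_germ_near_identity[OF f _ \<open>0 < \<gamma>\<close>, of id_blinfun]) auto
  have "C1_holder_diffeo_on \<gamma> (ball 0 s) f" if s: "0 < s" "s \<le> r" for s
  proof -
    have sub: "ball 0 s \<subseteq> ball (0::'a) r" using s by auto
    note fs = holder_derivative_subset[OF r(3) sub]
    have "norm ((id_blinfun o\<^sub>L Df x) - id_blinfun) \<le> 1/2" if "x \<in> ball 0 s" for x
      using r(6) that sub by blast
    note I = inverse_function_C1_holder[OF fs r(2) \<open>0 < \<gamma>\<close> _ _ this, of id_blinfun]
    show ?thesis
      unfolding C1_holder_diffeo_on_def
      using I holder_derivative_imp_C1_holder_on[OF _ _ \<open>0 < \<gamma>\<close>] fs open_ball by simp blast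
  qed
  then show ?thesis using that r(1) by blast
qed

section \<open>Series of maps with Hoelder continuous derivative\<close>

lemma min_le_powr_interpolation:
  fixes x a b t :: real
  assumes "0 \<le> x" "x \<le> a" "x \<le> b" "0 \<le> t" "t \<le> 1"
  shows "x \<le> a powr (1 - t) * b powr t"
proof (cases "x = 0")
  case False
  then have "x = x powr (1 - t) * x powr t" using assms(1) by (simp flip: powr_add)
  also have "\<dots> \<le> a powr (1 - t) * b powr t"
    using assms by (intro mult_mono powr_mono2) auto
  finally show ?thesis .
qed (use assms in auto)

text \<open>
  At \<open>t = 0\<close> the expression is \<open>1/2\<close>, and it is continuous in \<open>t\<close>.
\<close>

lemma interpolation_exponent:
  fixes \<Gamma> :: real
  assumes "1 \<le> \<Gamma>"
  obtains t where "0 < t" "t < 1" "(1/2) powr (1 - t) * \<Gamma> powr t < 1"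
proof -
  have "((\<lambda>t. (1/2) powr (1 - t) * \<Gamma> powr t) \<longlongrightarrow> (1/2) powr (1 - 0) * \<Gamma> powr 0) (at_right 0)"
    using assms by (intro tendsto_intros) auto
  then have "\<forall>\<^sub>F t in at_right 0. (1/2) powr (1 - t) * \<Gamma> powr t < 1"
    by (rule order_tendstoD) (use assms in auto)
  moreover have "\<forall>\<^sub>F t in at_right 0. t \<in> {0<..<1::real}"
    by (rule eventually_at_right_real) simp
  ultimately have "\<forall>\<^sub>F t in at_right 0. (1/2) powr (1 - t) * \<Gamma> powr t < 1 \<and> t \<in> {0<..<1}"
    by (rule eventually_conj)
  from eventually_happens[OF this] show ?thesis using that by auto
qed

text \<open>
  Derivatives that decay like \<open>(1/2)\<^sup>n\<close> but have Hoelder constants growing like \<open>\<Gamma>\<^sup>n\<close>: for an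
  increment of length \<open>d\<close> the \<open>n\<close>-th derivative changes by at most both \<open>2 C (1/2)\<^sup>n\<close> and
  \<open>\<Gamma>\<^sup>n d\<^sup>\<gamma>\<close>, hence by at most their weighted geometric mean with weights \<open>1 - t\<close> and \<open>t\<close>. For
  small \<open>t\<close> these means are summable, and the sum is a multiple of the \<open>\<gamma> t\<close>-th power of \<open>d\<close>.
\<close>

lemma holder_derivative_suminf:
  fixes F :: "nat \<Rightarrow> 'a::real_normed_vector \<Rightarrow> 'b::banach" and D :: "nat \<Rightarrow> 'a \<Rightarrow> 'a \<Rightarrow>\<^sub>L 'b"
  assumes S: "open S" "convex S"
    and F: "\<And>n. holder_derivative \<gamma> (\<Gamma> ^ n) S (F n) (D n)"
    and F_le: "\<And>n x. x \<in> S \<Longrightarrow> norm (F n x) \<le> C * (1/2) ^ n"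
    and D_le: "\<And>n x. x \<in> S \<Longrightarrow> norm (D n x) \<le> C * (1/2) ^ n"
    and t: "0 < t" "t < 1" "(1/2) powr (1 - t) * \<Gamma> powr t < 1" and "1 \<le> \<Gamma>" "0 \<le> C"
  obtains H where "0 \<le> H"
    "holder_derivative (\<gamma> * t) H S (\<lambda>x. \<Sum>n. F n x) (\<lambda>x. \<Sum>n. D n x)"
proof -
  define q where "q = (1/2) powr (1 - t) * \<Gamma> powr t"
  have q: "0 \<le> q" "q < 1" using t by (auto simp: q_def)
  have geo: "summable (\<lambda>n. C * (1/2::real) ^ n)" by (intro summable_mult summable_geometric) auto
  have sumD: "summable (\<lambda>n. D n x)" if "x \<in> S" for x
    using D_le that by (intro summable_comparison_test[OF _ geo]) auto
  have sumF: "summable (\<lambda>n. F n x)" if "x \<in> S" for x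
    using F_le that by (intro summable_comparison_test[OF _ geo]) auto
  have tail: "norm ((\<Sum>i<n. D i x) - (\<Sum>i. D i x)) \<le> 2 * C * (1/2) ^ n" if x: "x \<in> S" for n x
  proof -
    have geo': "(\<lambda>i. C * (1/2) ^ n * (1/2::real) ^ i) sums (C * (1/2) ^ n * 2)"
      using geometric_sums[of "1/2::real"] by (intro sums_mult) auto
    have D_shift: "norm (D (i + n) x) \<le> C * (1/2) ^ n * (1/2) ^ i" for i
      using D_le[OF x, of "i + n"] by (simp add: power_add algebra_simps)
    have "norm ((\<Sum>i. D i x) - (\<Sum>i<n. D i x)) = norm (\<Sum>i. D (i + n) x)"
      by (simp add: suminf_minus_initial_segment[OF sumD[OF x]])
    also have "\<dots> \<le> (\<Sum>i. C * (1/2) ^ n * (1/2::real) ^ i)"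
      by (intro norm_suminf_le sums_summable[OF geo'] D_shift)
    also have "\<dots> = C * (1/2) ^ n * 2" using geo' by (rule sums_unique[symmetric])
    finally show ?thesis by (simp add: norm_minus_commute algebra_simps)
  qed
  have deriv: "((\<lambda>x. \<Sum>n. F n x) has_derivative blinfun_apply (\<Sum>n. D n x)) (at x)" if x: "x \<in> S" for x
  proof -
    have "\<exists>g. \<forall>x\<in>S. (\<lambda>n. F n x) sums (g x) \<and> (g has_derivative blinfun_apply (\<Sum>n. D n x)) (at x within S)"
    proof (rule has_derivative_series[where f = F and f' = "\<lambda>n x. blinfun_apply (D n x)",
          OF \<open>convex S\<close> _ _ x summable_sums[OF sumF[OF x]]])
      show "(F n has_derivative blinfun_apply (D n y)) (at y within S)" if "y \<in> S" for n y
        using holder_derivativeD(1)[OF F that] by (rule has_derivative_at_withinI)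
      fix e :: real assume "e > 0"
      have "(\<lambda>n. 2 * C * (1/2::real) ^ n) \<longlonglongrightarrow> 2 * C * 0" by (intro tendsto_intros) auto
      then have "\<forall>\<^sub>F n in sequentially. 2 * C * (1/2::real) ^ n < e"
        by (rule order_tendstoD) (use \<open>e > 0\<close> in auto)
      then show "\<forall>\<^sub>F n in sequentially. \<forall>y\<in>S. \<forall>h. norm ((\<Sum>i<n. blinfun_apply (D i y) h) - blinfun_apply (\<Sum>i. D i y) h) \<le> e * norm h"
      proof eventually_elim
        case (elim n)
        show ?case
        proof safe
          fix y h assume "y \<in> S"
          then have "norm ((\<Sum>i<n. D i y) - (\<Sum>i. D i y)) \<le> e" using tail[of y n] elim by linarith
          from norm_blinfun_apply_le[OF this, of h]
          show "norm ((\<Sum>i<n. blinfun_apply (D i y) h) - blinfun_apply (\<Sum>i. D i y) h) \<le> e * norm h"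
            by (simp add: blinfun.diff_left blinfun.sum_left)
        qed
      qed
    qed
    then obtain g where g: "\<And>x. x \<in> S \<Longrightarrow> (\<lambda>n. F n x) sums g x"
      "(g has_derivative blinfun_apply (\<Sum>n. D n x)) (at x within S)" using x by blast
    then have "(g has_derivative blinfun_apply (\<Sum>n. D n x)) (at x)"
      using at_within_open[OF x \<open>open S\<close>] by simp
    then show ?thesis
      by (rule has_derivative_transform_within_open[OF _ \<open>open S\<close> x]) (use g(1) in \<open>auto simp: sums_iff\<close>)
  qed
  have holder: "norm ((\<Sum>n. D n x) - (\<Sum>n. D n y)) \<le> (2 * C) powr (1 - t) / (1 - q) * norm (x - y) powr (\<gamma> * t)"
    if xy: "x \<in> S" "y \<in> S" for x y
  proof -
    let ?d = "norm (x - y)"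
    let ?K = "(2 * C) powr (1 - t) * ?d powr (\<gamma> * t)"
    have sums: "(\<lambda>n. ?K * q ^ n) sums (?K * (1 / (1 - q)))"
      using q by (intro sums_mult geometric_sums) auto
    have "norm ((\<Sum>n. D n x) - (\<Sum>n. D n y)) = norm (\<Sum>n. D n x - D n y)"
      by (simp add: suminf_diff sumD xy)
    also have "\<dots> \<le> (\<Sum>n. ?K * q ^ n)"
    proof (intro norm_suminf_le sums_summable[OF sums])
      fix n
      have "norm (D n x - D n y) \<le> 2 * C * (1/2) ^ n"
        using norm_triangle_ineq4[of "D n x" "D n y"] D_le[OF xy(1), of n] D_le[OF xy(2), of n] by linarith
      then have "norm (D n x - D n y) \<le> (2 * C * (1/2) ^ n) powr (1 - t) * (\<Gamma> ^ n * ?d powr \<gamma>) powr t"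
        using holder_derivativeD(2)[OF F xy] t by (intro min_le_powr_interpolation) auto
      also have "\<dots> = ?K * q ^ n"
      proof -
        have pw: "(a ^ n) powr s = (a powr s) ^ n" if "0 < a" for a s :: real
          using that by (simp add: powr_power powr_powr mult.commute flip: powr_realpow)
        have "(2 * C * (1/2) ^ n) powr (1 - t) = (2 * C) powr (1 - t) * ((1/2) powr (1 - t)) ^ n"
          using \<open>0 \<le> C\<close> pw[of "1/2" "1 - t"] powr_mult[of "2 * C" "(1/2) ^ n" "1 - t"] by simp
        moreover have "(\<Gamma> ^ n * ?d powr \<gamma>) powr t = (\<Gamma> powr t) ^ n * ?d powr (\<gamma> * t)"
          using \<open>1 \<le> \<Gamma>\<close> pw[of \<Gamma> t] powr_mult[of "\<Gamma> ^ n" "?d powr \<gamma>" t] by (simp add: powr_powr)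
        ultimately show ?thesis by (simp only: q_def power_mult_distrib mult.assoc mult.commute mult.left_commute)
      qed
      finally show "norm (D n x - D n y) \<le> ?K * q ^ n" .
    qed
    also have "\<dots> = ?K * (1 / (1 - q))" using sums by (rule sums_unique[symmetric])
    finally show ?thesis by (simp add: field_simps)
  qed
  have "holder_derivative (\<gamma> * t) ((2 * C) powr (1 - t) / (1 - q)) S (\<lambda>x. \<Sum>n. F n x) (\<lambda>x. \<Sum>n. D n x)"
    unfolding holder_derivative_def using deriv holder by blast
  moreover have "0 \<le> (2 * C) powr (1 - t) / (1 - q)" using q by simp
  ultimately show ?thesis using that by blast
qed

section \<open>The semiconjugacy for maps that are linear on the expanding subspace\<close>

text \<open>
  The tube \<open>S\<close> around the expanding subspace is mapped into itself by \<open>T = L + f\<close>, since \<open>T\<close>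
  contracts the component \<open>Q x\<close> by the factor \<open>b\<close>; along the expanding subspace orbits may
  escape to infinity. Write \<open>D n\<close> for the derivative of \<open>M\<^sup>n\<^sup>+\<^sup>1 \<circ> f \<circ> T\<^sup>n\<close>. It is essential
  to estimate its restrictions to the two subspaces separately, in the form
  \<open>norm (D n x \<circ> P) \<le> (1/2)\<^sup>n * norm (Q x) powr \<alpha>\<close> and \<open>norm (D n x \<circ> Q) \<le> (1/2)\<^sup>n\<close>. In
  passing from \<open>n\<close> to \<open>n + 1\<close>, up to terms with the small factor \<open>\<eta>\<close>, the first bound is
  multiplied by the norm of \<open>M\<close>, by the norm of \<open>L \<circ> P\<close> and, since \<open>Q x\<close> is replaced by
  \<open>Q (T x)\<close>, by \<open>b powr \<alpha>\<close>: this is \<open>small_u\<close>. The second one only meets the norms of \<open>M\<close> and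
  of \<open>L \<circ> Q\<close>: this is \<open>small_s\<close>.
\<close>

lemma expanding_semiconjugacy_on_tube:
  fixes L Li P Q :: "'a::banach \<Rightarrow>\<^sub>L 'a" and f :: "'a \<Rightarrow> 'a" and \<eta> :: real
  defines "S \<equiv> {x. norm (Q x) < 1}" and "M \<equiv> Li o\<^sub>L P"
  defines "b \<equiv> norm (L o\<^sub>L Q) + norm Q * \<eta>"
  assumes inv: "\<And>x. L (Li x) = x" and inv': "\<And>x. Li (L x) = x"
    and PQ: "\<And>x. P x + Q x = x" "\<And>x. P (P x) = P x" and PL: "\<And>x. P (L x) = L (P x)"
    and f: "holder_derivative \<alpha> \<eta> S f Df" "\<And>x. x \<in> S \<Longrightarrow> norm (Df x) \<le> \<eta>" "\<And>x. f (P x) = 0" "Df 0 = 0"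
    and "0 < \<alpha>" "0 \<le> \<eta>" "\<eta> \<le> 1" "b \<le> 1" and M: "norm M \<le> 1/2"
    and small_u: "norm M * (norm (L o\<^sub>L P) * b powr \<alpha> + 2 * \<eta> * norm P) \<le> 1/2"
    and small_s: "norm M * (norm (L o\<^sub>L Q) + 2 * \<eta> * norm Q) \<le> 1/2"
  obtains \<beta> R where "0 < \<beta>" "\<beta> < \<alpha>" "C1_germ \<beta> R P"
    "\<And>x. x \<in> S \<Longrightarrow> R (L x + f x) = L (R x)"
proof -
  define T where "T x = L x + f x" for x
  have QP: "Q (P x) = 0" "P (Q x) = 0" "Q (Q x) = Q x" "Q (L x) = L (Q x)" for x
  proof -
    show "Q (P x) = 0" for x using PQ(1)[of "P x"] PQ(2)[of x] by simp
    show 2: "P (Q x) = 0" for x using PQ(1)[of x] PQ(2)[of x]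
      by (metis add_cancel_right_right blinfun.add_right)
    show "Q (Q x) = Q x" using PQ(1)[of "Q x"] 2 by simp
    show "Q (L x) = L (Q x)" using PQ(1)[of x] PQ(1)[of "L x"] PL[of x]
      by (metis add_left_cancel blinfun.add_right)
  qed
  have Li_P: "P (Li x) = Li (P x)" for x
    using inv PL by (metis inv')
  have PM: "P (M x) = M x" "L (M x) = P x" for x
    by (simp_all add: M_def Li_P PQ inv)
  have S: "open S" "convex S" "0 \<in> S" "\<And>x. P x \<in> S"
  proof -
    have *: "S = blinfun_apply Q -` ball 0 1" by (auto simp: S_def)
    show "open S" unfolding *
      by (intro open_vimage continuous_on_id blinfun.continuous_on continuous_on_const open_ball)
    show "convex S" unfolding *
      by (intro convex_linear_vimage bounded_linear.linear blinfun.bounded_linear_right convex_ball)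
  qed (auto simp: S_def QP)
  have f0: "f 0 = 0" using f(3)[of 0] by simp
  have f_le: "norm (f x) \<le> \<eta> * norm (Q x)" if x: "x \<in> S" for x
  proof -
    have "norm (f x - f (P x)) \<le> \<eta> * norm (x - P x)"
      by (rule lipschitz_from_derivative[OF S(2) holder_derivativeD(1)[OF f(1)] f(2) x S(4)])
    moreover have "x - P x = Q x" using PQ(1)[of x] by (simp add: algebra_simps)
    ultimately show ?thesis using f(3) by simp
  qed
  have b0: "0 \<le> b" using \<open>0 \<le> \<eta>\<close> by (simp add: b_def)
  have QT: "norm (Q (T x)) \<le> b * norm (Q x)" if x: "x \<in> S" for x
  proof -
    have "Q (T x) = (L o\<^sub>L Q) (Q x) + Q (f x)" by (simp add: T_def blinfun.add_right QP)
    then have "norm (Q (T x)) \<le> norm (L o\<^sub>L Q) * norm (Q x) + norm Q * norm (f x)"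
      by (simp only: norm_triangle_mono norm_blinfun)
    also have "\<dots> \<le> norm (L o\<^sub>L Q) * norm (Q x) + norm Q * (\<eta> * norm (Q x))"
      using f_le[OF x] by (intro add_left_mono mult_left_mono) auto
    finally show ?thesis by (simp add: b_def algebra_simps)
  qed
  have TS: "T x \<in> S" if x: "x \<in> S" for x
  proof -
    have "b * norm (Q x) \<le> 1 * norm (Q x)" by (intro mult_right_mono \<open>b \<le> 1\<close>) auto
    then show ?thesis using QT[OF x] x by (simp add: S_def)
  qed
  have powr_le1: "norm (Q x) powr \<alpha> \<le> 1" if "x \<in> S" for x
    using that \<open>0 < \<alpha>\<close> powr_mono2[of \<alpha> "norm (Q x)" 1] by (auto simp: S_def)
  \<comment> \<open>Along the range of \<open>P\<close> the map \<open>f\<close> is constant, so \<open>Df (P x) \<circ> P = 0\<close>, and \<open>x\<close> has distance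
    \<open>norm (Q x)\<close> from \<open>P x\<close>.\<close>
  have DfP: "norm (Df x o\<^sub>L P) \<le> \<eta> * norm P * norm (Q x) powr \<alpha>" if x: "x \<in> S" for x
  proof -
    have "(f \<circ> blinfun_apply P) = (\<lambda>x. 0)" using f(3) by auto
    moreover have "(f \<circ> blinfun_apply P has_derivative blinfun_apply (Df (P (P x))) \<circ> blinfun_apply P) (at (P x))"
      using holder_derivativeD(1)[OF f(1) S(4)[of "P x"]]
      by (intro diff_chain_at bounded_linear_imp_has_derivative blinfun.bounded_linear_right)
    ultimately have "blinfun_apply (Df (P (P x))) \<circ> blinfun_apply P = (\<lambda>x. 0)"
      using has_derivative_unique[OF _ has_derivative_const] by simp
    then have "Df (P x) o\<^sub>L P = 0" using PQ(2) by (intro blinfun_eqI) (auto simp: fun_eq_iff)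
    then have "Df x o\<^sub>L P = (Df x - Df (P x)) o\<^sub>L P"
      by (intro blinfun_eqI) (metis blinfun.diff_left blinfun_apply_blinfun_compose diff_zero zero_blinfun.rep_eq)
    moreover have "norm (Df x - Df (P x)) \<le> \<eta> * norm (Q x) powr \<alpha>"
      using holder_derivativeD(2)[OF f(1) x S(4), of x] PQ(1)[of x] by (metis add_diff_cancel_left')
    ultimately show ?thesis
      using norm_blinfun_compose_le[OF _ order_refl, of "Df x - Df (P x)" "\<eta> * norm (Q x) powr \<alpha>" P]
      by (simp add: mult_ac)
  qed
  define F where "F = rec_nat (\<lambda>x. M (f x)) (\<lambda>n Fn x. M (Fn (T x)))"
  define D where "D = rec_nat (\<lambda>x. M o\<^sub>L Df x) (\<lambda>n Dn x. M o\<^sub>L (Dn (T x) o\<^sub>L (L + Df x)))"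
  have F_simps: "F 0 x = M (f x)" "F (Suc n) x = M (F n (T x))" for n x by (simp_all add: F_def)
  have D_simps: "D 0 x = M o\<^sub>L Df x" "D (Suc n) x = M o\<^sub>L (D n (T x) o\<^sub>L (L + Df x))" for n x
    by (simp_all add: D_def)
  have D_split: "norm X \<le> norm (X o\<^sub>L P) + norm (X o\<^sub>L Q)" for X :: "'a \<Rightarrow>\<^sub>L 'a"
  proof -
    have "X = (X o\<^sub>L P) + (X o\<^sub>L Q)"
      by (intro blinfun_eqI) (simp add: blinfun.bilinear_simps PQ flip: blinfun.add_right)
    then show ?thesis by (metis norm_triangle_ineq)
  qed
  have DPQ: "norm (D n x o\<^sub>L P) \<le> (1/2) ^ n * norm (Q x) powr \<alpha> \<and> norm (D n x o\<^sub>L Q) \<le> (1/2) ^ n"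
    if "x \<in> S" for n x
    using that
  proof (induction n arbitrary: x)
    case 0
    have "norm (D 0 x o\<^sub>L P) \<le> norm M * (\<eta> * norm P * norm (Q x) powr \<alpha>)"
    proof -
      have "D 0 x o\<^sub>L P = M o\<^sub>L (Df x o\<^sub>L P)" by (intro blinfun_eqI) (simp add: D_simps)
      then show ?thesis using norm_blinfun_compose_le[OF order_refl DfP[OF 0]] by simp
    qed
    also have "\<dots> = (norm M * (\<eta> * norm P)) * norm (Q x) powr \<alpha>" by simp
    also have "\<dots> \<le> 1 * norm (Q x) powr \<alpha>"
    proof (rule mult_right_mono)
      have "0 \<le> norm M * (norm (L o\<^sub>L P) * b powr \<alpha>)" by simp
      moreover have "0 \<le> norm M * (\<eta> * norm P)" using \<open>0 \<le> \<eta>\<close> by simp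
      moreover have "norm M * (norm (L o\<^sub>L P) * b powr \<alpha> + 2 * \<eta> * norm P)
          = norm M * (norm (L o\<^sub>L P) * b powr \<alpha>) + 2 * (norm M * (\<eta> * norm P))"
        by (simp add: algebra_simps)
      ultimately show "norm M * (\<eta> * norm P) \<le> 1" using small_u by linarith
    qed simp
    finally have 1: "norm (D 0 x o\<^sub>L P) \<le> (1/2) ^ 0 * norm (Q x) powr \<alpha>" by simp
    have "norm (D 0 x o\<^sub>L Q) \<le> norm M * \<eta> * norm Q"
      unfolding D_simps using f(2)[OF 0] by (intro norm_blinfun_compose_le) auto
    also have "\<dots> \<le> 1"
    proof -
      have "0 \<le> norm M * norm (L o\<^sub>L Q)" "0 \<le> norm M * \<eta> * norm Q" using \<open>0 \<le> \<eta>\<close> by simp_all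
      moreover have "norm M * (norm (L o\<^sub>L Q) + 2 * \<eta> * norm Q)
          = norm M * norm (L o\<^sub>L Q) + 2 * (norm M * \<eta> * norm Q)"
        by (simp add: algebra_simps)
      ultimately show ?thesis using small_s by linarith
    qed
    finally show ?case using 1 by simp
  next
    case (Suc n)
    let ?X = "D n (T x)" and ?w = "norm (Q x) powr \<alpha>"
    have IH: "norm (?X o\<^sub>L P) \<le> (1/2) ^ n * norm (Q (T x)) powr \<alpha>" "norm (?X o\<^sub>L Q) \<le> (1/2) ^ n"
      using Suc.IH[OF TS[OF Suc.prems]] by auto
    have "norm (Q (T x)) powr \<alpha> \<le> (b * norm (Q x)) powr \<alpha>"
      using QT[OF Suc.prems] \<open>0 < \<alpha>\<close> by (intro powr_mono2) auto
    then have qw: "norm (Q (T x)) powr \<alpha> \<le> b powr \<alpha> * ?w" using b0 by (simp add: powr_mult)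
    have X: "norm ?X \<le> 2 * (1/2) ^ n"
    proof -
      have "(1/2) ^ n * norm (Q (T x)) powr \<alpha> \<le> (1/2) ^ n * 1"
        by (intro mult_left_mono powr_le1 TS Suc.prems) auto
      then show ?thesis using IH D_split[of ?X] by linarith
    qed
    have "norm (?X o\<^sub>L P) \<le> (1/2) ^ n * (b powr \<alpha> * ?w)"
      by (rule order_trans[OF IH(1) mult_left_mono[OF qw]]) simp
    then have A: "norm ((?X o\<^sub>L P) o\<^sub>L (L o\<^sub>L P)) \<le> (1/2) ^ n * (b powr \<alpha> * ?w) * norm (L o\<^sub>L P)"
      by (rule norm_blinfun_compose_le) simp
    have B: "norm (?X o\<^sub>L (Df x o\<^sub>L P)) \<le> 2 * (1/2) ^ n * (\<eta> * norm P * ?w)"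
      by (rule norm_blinfun_compose_le[OF X DfP[OF Suc.prems]])
    \<comment> \<open>Since \<open>L\<close> preserves the range of \<open>P\<close>, its contribution only involves \<open>?X \<circ> P\<close>, where the
      bound carries the factor \<open>norm (Q (T x)) powr \<alpha>\<close>. The mixed term has no such factor, but
      \<open>Df x \<circ> P\<close> supplies it.\<close>
    have "D (Suc n) x o\<^sub>L P = M o\<^sub>L (((?X o\<^sub>L P) o\<^sub>L (L o\<^sub>L P)) + (?X o\<^sub>L (Df x o\<^sub>L P)))"
      by (intro blinfun_eqI) (simp add: D_simps blinfun.bilinear_simps PL PQ)
    then have "norm (D (Suc n) x o\<^sub>L P) \<le> norm M * ((1/2) ^ n * (b powr \<alpha> * ?w) * norm (L o\<^sub>L P) + 2 * (1/2) ^ n * (\<eta> * norm P * ?w))"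
      using norm_blinfun_compose_le[OF order_refl norm_triangle_mono[OF A B]] by metis
    also have "\<dots> = (norm M * (norm (L o\<^sub>L P) * b powr \<alpha> + 2 * \<eta> * norm P)) * ((1/2) ^ n * ?w)"
      by (simp add: algebra_simps)
    also have "\<dots> \<le> 1/2 * ((1/2) ^ n * ?w)" by (intro mult_right_mono small_u) auto
    finally have 1: "norm (D (Suc n) x o\<^sub>L P) \<le> (1/2) ^ Suc n * ?w" by simp
    have A: "norm ((?X o\<^sub>L Q) o\<^sub>L (L o\<^sub>L Q)) \<le> (1/2) ^ n * norm (L o\<^sub>L Q)"
      by (rule norm_blinfun_compose_le[OF IH(2) order_refl])
    have B: "norm (?X o\<^sub>L (Df x o\<^sub>L Q)) \<le> 2 * (1/2) ^ n * (\<eta> * norm Q)"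
      by (intro norm_blinfun_compose_le[OF X] norm_blinfun_compose_le f(2) Suc.prems order_refl)
    have "D (Suc n) x o\<^sub>L Q = M o\<^sub>L (((?X o\<^sub>L Q) o\<^sub>L (L o\<^sub>L Q)) + (?X o\<^sub>L (Df x o\<^sub>L Q)))"
      by (intro blinfun_eqI) (simp add: D_simps blinfun.bilinear_simps QP)
    then have "norm (D (Suc n) x o\<^sub>L Q) \<le> norm M * ((1/2) ^ n * norm (L o\<^sub>L Q) + 2 * (1/2) ^ n * (\<eta> * norm Q))"
      using norm_blinfun_compose_le[OF order_refl norm_triangle_mono[OF A B]] by metis
    also have "\<dots> = (norm M * (norm (L o\<^sub>L Q) + 2 * \<eta> * norm Q)) * (1/2) ^ n"
      by (simp add: algebra_simps)
    also have "\<dots> \<le> 1/2 * (1/2) ^ n" by (intro mult_right_mono small_s) auto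
    finally show ?case using 1 by simp
  qed
  have D_le: "norm (D n x) \<le> 2 * (1/2) ^ n" if "x \<in> S" for n x
  proof -
    have "(1/2) ^ n * norm (Q x) powr \<alpha> \<le> (1/2) ^ n * 1"
      by (intro mult_left_mono powr_le1 that) auto
    then show ?thesis using DPQ[OF that, of n] D_split[of "D n x"] by linarith
  qed
  have F_le: "norm (F n x) \<le> 2 * (1/2) ^ n" if "x \<in> S" for n x
    using that
  proof (induction n arbitrary: x)
    case 0
    have "\<eta> * norm (Q x) \<le> 1 * 1"
      using 0 \<open>\<eta> \<le> 1\<close> \<open>0 \<le> \<eta>\<close> by (intro mult_mono) (auto simp: S_def)
    then have "norm (f x) \<le> 1" using f_le[OF 0] by linarith
    then show ?case using norm_blinfun_apply_le[OF M, of "f x"] by (simp add: F_simps)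
  next
    case (Suc n)
    show ?case using norm_blinfun_apply_le[OF M, of "F n (T x)"] Suc.IH[OF TS[OF Suc.prems]] by (simp add: F_simps)
  qed
  define \<Lambda> where "\<Lambda> = norm L + \<eta>"
  \<comment> \<open>The rate at which the Hoelder constants of the terms may grow.\<close>
  define \<Gamma> where "\<Gamma> = max 1 (\<Lambda> powr \<alpha> * \<Lambda> + 2 * \<eta>)"
  have hT: "holder_derivative \<alpha> \<eta> S T (\<lambda>x. L + Df x)"
    unfolding T_def by (rule holder_derivative_linear_add[OF f(1)])
  have DT_le: "norm (L + Df x) \<le> \<Lambda>" if "x \<in> S" for x
    using norm_triangle_ineq[of L "Df x"] f(2)[OF that] by (simp add: \<Lambda>_def)
  have hF: "holder_derivative \<alpha> (\<Gamma> ^ n) S (F n) (D n)" for n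
  proof (induction n)
    case 0
    have "norm M * \<eta> \<le> 1 * 1" using M \<open>\<eta> \<le> 1\<close> \<open>0 \<le> \<eta>\<close> by (intro mult_mono) auto
    then show ?case
      using holder_derivative_compose_linear_left[OF f(1), of M] by (auto simp: F_simps[abs_def] D_simps[abs_def] intro: holder_derivative_weaken)
  next
    case (Suc n)
    have D2: "norm (D n x) \<le> 2" if "x \<in> S" for x
      using D_le[OF that, of n] power_le_one[of "1/2::real" n] by auto
    have "0 \<le> \<Gamma> ^ n" by (simp add: \<Gamma>_def)
    have "holder_derivative \<alpha> (\<Gamma> ^ n * \<Lambda> powr \<alpha> * \<Lambda> + 2 * \<eta>) S (F n \<circ> T) (\<lambda>x. D n (T x) o\<^sub>L (L + Df x))"
      by (rule holder_derivative_compose[OF hT Suc.IH _ S(2) _ \<open>0 \<le> \<Gamma> ^ n\<close> DT_le D2])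
         (use TS \<open>0 < \<alpha>\<close> in auto)
    note h = holder_derivative_compose_linear_left[OF this, of M]
    have "norm M * (\<Gamma> ^ n * \<Lambda> powr \<alpha> * \<Lambda> + 2 * \<eta>) \<le> 1 * (\<Gamma> ^ n * \<Lambda> powr \<alpha> * \<Lambda> + \<Gamma> ^ n * (2 * \<eta>))"
    proof (rule mult_mono)
      have "1 \<le> \<Gamma> ^ n" by (rule one_le_power) (simp add: \<Gamma>_def)
      then have "1 * (2 * \<eta>) \<le> \<Gamma> ^ n * (2 * \<eta>)" using \<open>0 \<le> \<eta>\<close> by (intro mult_right_mono) auto
      then show "\<Gamma> ^ n * \<Lambda> powr \<alpha> * \<Lambda> + 2 * \<eta> \<le> \<Gamma> ^ n * \<Lambda> powr \<alpha> * \<Lambda> + \<Gamma> ^ n * (2 * \<eta>)" by simp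
      show "0 \<le> \<Gamma> ^ n * \<Lambda> powr \<alpha> * \<Lambda> + 2 * \<eta>"
        using \<open>0 \<le> \<Gamma> ^ n\<close> \<open>0 \<le> \<eta>\<close> by (simp add: \<Lambda>_def)
    qed (use M in auto)
    also have "\<dots> = \<Gamma> ^ n * (\<Lambda> powr \<alpha> * \<Lambda> + 2 * \<eta>)" by (simp add: algebra_simps)
    also have "\<dots> \<le> \<Gamma> ^ n * \<Gamma>" using \<open>0 \<le> \<Gamma> ^ n\<close> by (intro mult_left_mono) (auto simp: \<Gamma>_def)
    finally show ?case
      using holder_derivative_weaken[OF h] by (simp add: F_simps[abs_def] D_simps[abs_def] mult.commute)
  qed
  have "1 \<le> \<Gamma>" by (simp add: \<Gamma>_def)
  obtain t where t: "0 < t" "t < 1" "(1/2) powr (1 - t) * \<Gamma> powr t < 1"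
    using interpolation_exponent[OF \<open>1 \<le> \<Gamma>\<close>] .
  define h where "h x = (\<Sum>n. F n x)" for x
  obtain H where H: "0 \<le> H" "holder_derivative (\<alpha> * t) H S h (\<lambda>x. \<Sum>n. D n x)"
    using holder_derivative_suminf[OF S(1,2) hF F_le D_le t \<open>1 \<le> \<Gamma>\<close>] unfolding h_def by auto
  have T0: "T 0 = 0" by (simp add: T_def f0)
  have F0: "F n 0 = 0" for n by (induction n) (simp_all add: F_simps f0 T0)
  have D0: "D n 0 = 0" for n by (induction n) (simp_all add: D_simps f(4) T0)
  obtain r where r: "r > 0" "ball 0 r \<subseteq> S" using S(1,3) open_contains_ball by blast
  have "C1_germ (\<alpha> * t) h 0"
    unfolding C1_germ_def
    using r(1) H(1) holder_derivative_subset[OF H(2) r(2)]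
    by (intro conjI exI[of _ r] exI[of _ H] exI[of _ "\<lambda>x. \<Sum>n. D n x"]) (simp_all add: h_def F0 D0)
  then have "C1_germ (\<alpha> * t) (\<lambda>x. P x + h x) (P + 0)"
    by (intro C1_germ_add C1_germ_linear)
  moreover have "P (T x) + h (T x) = L (P x + h x)" if x: "x \<in> S" for x
  proof -
    have geo: "summable (\<lambda>n. 2 * (1/2::real) ^ n)" by (intro summable_mult summable_geometric) auto
    have sumF: "summable (\<lambda>n. F n y)" if "y \<in> S" for y
      using F_le[OF that] by (intro summable_comparison_test[OF _ geo]) auto
    have PF: "P (F n y) = F n y" for n y by (cases n) (simp_all add: F_simps PM)
    have "h x = F 0 x + (\<Sum>n. F (Suc n) x)"
      unfolding h_def using suminf_split_head[OF sumF[OF x]] by simp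
    also have "(\<Sum>n. F (Suc n) x) = M (h (T x))"
      unfolding h_def F_simps
      by (rule bounded_linear.suminf[OF blinfun.bounded_linear_right sumF[OF TS[OF x]], symmetric])
    finally have "L (h x) = P (f x) + P (h (T x))" by (simp add: F_simps blinfun.bilinear_simps PM)
    moreover have "P (h (T x)) = h (T x)"
      unfolding h_def
      using bounded_linear.suminf[OF blinfun.bounded_linear_right sumF[OF TS[OF x]], of P] by (simp add: PF)
    ultimately show ?thesis by (simp add: T_def blinfun.bilinear_simps PL)
  qed
  ultimately show ?thesis
    using that[of "\<alpha> * t" "\<lambda>x. P x + h x"] t \<open>0 < \<alpha>\<close> by (auto simp: T_def)
qed

section \<open>Global extension of germs by a bump function\<close>

text \<open>
  Multiplication by the bump function, as a statement that is uniform in the map \<open>g\<close>: the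
  constant \<open>C\<close> depends on the bump function only. The radius \<open>R\<close> exceeds by \<open>1\<close> the radius
  \<open>c2\<close> beyond which the bump function vanishes. This margin gives the Hoelder estimate
  between a point of the ball of radius \<open>R\<close>, where the product rule applies, and a point
  outside, where \<open>g\<close> is not controlled: either the derivative is zero at both points, or
  their distance is at least \<open>1\<close>.
\<close>

lemma cutoff_function:
  assumes "C1_holder_banach_space \<alpha> TYPE('a::banach)" "0 < \<alpha>" "\<alpha> \<le> 1" and nontrivial: "\<exists>v::'a::banach. v \<noteq> 0"
  obtains \<phi> :: "'a::banach \<Rightarrow> real" and R C where "0 < R" "0 \<le> C" "\<forall>\<^sub>F x in nhds 0. \<phi> x = 1"
    "\<And>x. R \<le> norm x \<Longrightarrow> \<phi> x = 0"
    "\<And>(g :: 'a::banach \<Rightarrow> 'a) H Dg. 0 \<le> H \<Longrightarrow> holder_derivative \<alpha> H (ball 0 R) g Dg \<Longrightarrow> g 0 = 0 \<Longrightarrow> Dg 0 = 0 \<Longrightarrow>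
       \<exists>Df. holder_derivative \<alpha> (C * H) UNIV (\<lambda>x. \<phi> x *\<^sub>R g x) Df \<and> (\<forall>x. norm (Df x) \<le> C * H) \<and> Df 0 = 0"
proof -
  obtain \<phi> :: "'a \<Rightarrow> real" and c1 c2 where \<phi>: "C1_holder_on \<alpha> UNIV \<phi>" "range \<phi> = {0..1}" "0 < c1" "c1 < c2"
    "\<And>x. norm x < c1 \<Longrightarrow> \<phi> x = 1" "\<And>x. c2 \<le> norm x \<Longrightarrow> \<phi> x = 0"
    using assms(1) unfolding C1_holder_banach_space_def by blast
  obtain K D\<phi> where K: "0 \<le> K" "holder_derivative \<alpha> K UNIV \<phi> D\<phi>"
    using C1_holder_on_imp_holder_derivative[OF \<phi>(1)] .
  define R where "R = c2 + 1"
  have R: "0 < R" "c2 < R" using \<phi>(3,4) by (auto simp: R_def)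
  have \<phi>_le: "\<bar>\<phi> x\<bar> \<le> 1" for x
  proof -
    have "\<phi> x \<in> {0..1}" unfolding \<phi>(2)[symmetric] by simp
    then show ?thesis by auto
  qed
  have D\<phi>0: "D\<phi> x = 0" if "c2 < norm x" for x
  proof -
    have "open {x::'a. c2 < norm x}" by (intro open_Collect_less continuous_intros)
    then have "((\<lambda>_. 0) has_derivative blinfun_apply (D\<phi> x)) (at x)"
      by (rule has_derivative_transform_within_open[OF holder_derivativeD(1)[OF K(2) UNIV_I]])
         (use that \<phi>(6) in auto)
    then have "blinfun_apply (D\<phi> x) = (\<lambda>_. 0)"
      using has_derivative_unique has_derivative_const by blast
    then show ?thesis by (intro blinfun_eqI) simp
  qed
  \<comment> \<open>The derivative of the bump function vanishes at a point \<open>y\<close> of norm \<open>R\<close>, which exists as the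
    space is not zero; Hoelder continuity bounds it elsewhere on the ball.\<close>
  define N where "N = K * (2 * R) powr \<alpha>"
  have "0 \<le> N" using K(1) by (simp add: N_def)
  have N: "norm (D\<phi> x) \<le> N" if "x \<in> ball 0 R" for x
  proof -
    obtain v :: 'a where "v \<noteq> 0" using nontrivial by blast
    define y where "y = (R / norm v) *\<^sub>R v"
    have y: "norm y = R" using \<open>v \<noteq> 0\<close> R(1) by (simp add: y_def)
    have "norm (x - y) \<le> 2 * R" using norm_triangle_ineq4[of x y] that y by auto
    then have "K * norm (x - y) powr \<alpha> \<le> N"
      unfolding N_def using K(1) assms(2) by (intro mult_left_mono powr_mono2) auto
    then show ?thesis
      using holder_derivativeD(2)[OF K(2), of x y] D\<phi>0[of y] y R(2) by simp
  qed
  define a where "a = R powr \<alpha>"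
  define d where "d = (2 * R) powr (1 - \<alpha>)"
  define C1 where "C1 = 2 * N * d * a + 1 + a * R * K"
  define C2 where "C2 = a + a * R * N"
  have pos: "0 \<le> a" "0 \<le> d" "0 \<le> C1" "0 \<le> C2"
    using \<open>0 \<le> N\<close> K(1) R(1) by (auto simp: a_def d_def C1_def C2_def)
  have "\<exists>Df. holder_derivative \<alpha> ((C1 + C2) * H) UNIV (\<lambda>x. \<phi> x *\<^sub>R g x) Df \<and> (\<forall>x. norm (Df x) \<le> (C1 + C2) * H) \<and> Df 0 = 0"
    if H: "0 \<le> H" and g: "holder_derivative \<alpha> H (ball 0 R) g Dg" "g 0 = 0" "Dg 0 = 0"
    for g :: "'a \<Rightarrow> 'a" and H Dg
  proof -
    let ?B = "ball (0::'a) R"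
    define Df where "Df x = (if x \<in> ?B then \<phi> x *\<^sub>R Dg x + (blinfun_scaleR_left (g x) o\<^sub>L D\<phi> x) else 0)" for x
    have Df_out: "Df x = 0" if "c2 < norm x" for x
      using that D\<phi>0[OF that] \<phi>(6)[of x] by (simp add: Df_def)
    have Dg_le: "norm (Dg x) \<le> H * a" if "x \<in> ?B" for x
      using holder_derivative_bounded[OF g(1) order_refl _ _ H that] R(1) assms(2) g(3) by (simp add: a_def)
    have g_lip: "norm (g x - g y) \<le> H * a * norm (x - y)" if "x \<in> ?B" "y \<in> ?B" for x y
      by (rule lipschitz_from_derivative[OF convex_ball holder_derivativeD(1)[OF g(1)] Dg_le that])
    have g_le: "norm (g x) \<le> H * a * R" if "x \<in> ?B" for x
    proof -
      have "norm (g x) \<le> H * a * norm x" using g_lip[OF that, of 0] R(1) g(2) by simp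
      also have "\<dots> \<le> H * a * R" using that H pos by (intro mult_left_mono) auto
      finally show ?thesis .
    qed
    have \<phi>_lip: "\<bar>\<phi> x - \<phi> y\<bar> \<le> N * norm (x - y)" if "x \<in> ?B" "y \<in> ?B" for x y
      using lipschitz_from_derivative[OF convex_ball holder_derivativeD(1)[OF K(2)] N that] by simp
    have dist_le: "norm (x - y) \<le> d * norm (x - y) powr \<alpha>" if "x \<in> ?B" "y \<in> ?B" for x y
      unfolding d_def using that norm_triangle_ineq4[of x y] assms(3)
      by (intro le_powr_bounded_diameter) auto
    have sL: "norm (blinfun_scaleR_left v o\<^sub>L A) \<le> v' * A'" if "norm v \<le> v'" "norm A \<le> A'"
      for v :: 'a and A :: "'a \<Rightarrow>\<^sub>L real" and v' A'
    proof (rule norm_blinfun_compose_le[OF _ that(2)])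
      show "norm (blinfun_scaleR_left v) \<le> v'"
        using that(1) order_trans[OF norm_ge_zero that(1)]
        by (intro norm_blinfun_bound) (simp_all add: mult.commute[of v'] mult_left_mono)
    qed
    have Df_le: "norm (Df x) \<le> C2 * H" for x
    proof (cases "x \<in> ?B")
      case True
      have "norm (Df x) \<le> norm (\<phi> x *\<^sub>R Dg x) + norm (blinfun_scaleR_left (g x) o\<^sub>L D\<phi> x)"
        using True unfolding Df_def by (simp only: norm_triangle_ineq if_True)
      also have "\<dots> \<le> 1 * (H * a) + H * a * R * N"
        using mult_mono[OF \<phi>_le[of x] Dg_le[OF True]] sL[OF g_le[OF True] N[OF True]] by (intro add_mono) auto
      finally show ?thesis by (simp add: C2_def algebra_simps)
    qed (use pos H in \<open>auto simp: Df_def\<close>)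
    have deriv: "((\<lambda>x. \<phi> x *\<^sub>R g x) has_derivative blinfun_apply (Df x)) (at x)" for x
    proof (cases "x \<in> ?B")
      case True
      have "((\<lambda>x. \<phi> x *\<^sub>R g x) has_derivative (\<lambda>h. \<phi> x *\<^sub>R Dg x h + D\<phi> x h *\<^sub>R g x)) (at x)"
        by (rule has_derivative_scaleR[OF holder_derivativeD(1)[OF K(2) UNIV_I] holder_derivativeD(1)[OF g(1) True]])
      moreover have "(\<lambda>h. \<phi> x *\<^sub>R Dg x h + D\<phi> x h *\<^sub>R g x) = blinfun_apply (Df x)"
        using True by (auto simp: Df_def blinfun.bilinear_simps)
      ultimately show ?thesis by simp
    next
      case False
      have "open {x::'a. c2 < norm x}" by (intro open_Collect_less continuous_intros)
      have "((\<lambda>x. 0) has_derivative blinfun_apply (Df x)) (at x)"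
        using False by (simp add: Df_def zero_blinfun.rep_eq)
      then show ?thesis
        by (rule has_derivative_transform_within_open[OF _ \<open>open {x::'a. c2 < norm x}\<close>])
           (use False R(2) \<phi>(6) in auto)
    qed
    have in_B: "norm (Df x - Df y) \<le> C1 * H * norm (x - y) powr \<alpha>" if xy: "x \<in> ?B" "y \<in> ?B" for x y
    proof -
      let ?\<delta> = "norm (x - y) powr \<alpha>"
      have "Df x - Df y = ((\<phi> x - \<phi> y) *\<^sub>R Dg x + \<phi> y *\<^sub>R (Dg x - Dg y))
          + ((blinfun_scaleR_left (g x - g y) o\<^sub>L D\<phi> x) + (blinfun_scaleR_left (g y) o\<^sub>L (D\<phi> x - D\<phi> y)))"
        using xy by (intro blinfun_eqI) (simp add: Df_def blinfun.bilinear_simps algebra_simps)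
      moreover have "norm ((\<phi> x - \<phi> y) *\<^sub>R Dg x) \<le> N * (d * ?\<delta>) * (H * a)"
        unfolding norm_scaleR real_norm_def[symmetric]
        using order_trans[OF \<phi>_lip[OF xy] mult_left_mono[OF dist_le[OF xy] \<open>0 \<le> N\<close>]] \<open>0 \<le> N\<close> pos
        by (intro mult_mono Dg_le[OF xy(1)]) simp_all
      moreover have "norm (\<phi> y *\<^sub>R (Dg x - Dg y)) \<le> 1 * (H * ?\<delta>)"
        unfolding norm_scaleR by (intro mult_mono \<phi>_le holder_derivativeD(2)[OF g(1) xy]) simp_all
      moreover have "norm (blinfun_scaleR_left (g x - g y) o\<^sub>L D\<phi> x) \<le> H * a * (d * ?\<delta>) * N"
        using H pos
        by (intro sL N[OF xy(1)] order_trans[OF g_lip[OF xy] mult_left_mono[OF dist_le[OF xy]]]) simp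
      moreover have "norm (blinfun_scaleR_left (g y) o\<^sub>L (D\<phi> x - D\<phi> y)) \<le> H * a * R * (K * ?\<delta>)"
        by (intro sL g_le[OF xy(2)] holder_derivativeD(2)[OF K(2)]) simp_all
      ultimately have "norm (Df x - Df y) \<le> (N * (d * ?\<delta>) * (H * a) + 1 * (H * ?\<delta>)) + (H * a * (d * ?\<delta>) * N + H * a * R * (K * ?\<delta>))"
        by (simp only: norm_triangle_mono)
      then show ?thesis by (simp add: C1_def algebra_simps)
    qed
    have cross: "norm (Df x - Df y) \<le> C2 * H * norm (x - y) powr \<alpha>" if x: "x \<in> ?B" and y: "y \<notin> ?B" for x y
    proof (cases "c2 < norm x")
      case True
      have "c2 < norm y" using y R(2) by auto
      then show ?thesis using Df_out True pos H by simp
    next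
      case False
      have "1 \<le> norm (x - y)"
        using False y norm_triangle_ineq3[of y x] by (auto simp: R_def norm_minus_commute)
      then have "1 \<le> norm (x - y) powr \<alpha>" using assms(2) by (simp add: ge_one_powr_ge_zero)
      then have "C2 * H * 1 \<le> C2 * H * norm (x - y) powr \<alpha>" using pos H by (intro mult_left_mono) auto
      moreover have "Df y = 0" using y by (simp add: Df_def)
      ultimately show ?thesis using Df_le[of x] by simp
    qed
    have C12: "C1 * H * w \<le> (C1 + C2) * H * w" "C2 * H * w \<le> (C1 + C2) * H * w" if "0 \<le> w" for w
      using pos H that by (auto intro!: mult_right_mono)
    have "holder_derivative \<alpha> ((C1 + C2) * H) UNIV (\<lambda>x. \<phi> x *\<^sub>R g x) Df"
      unfolding holder_derivative_def
    proof (intro conjI ballI deriv)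
      fix x y :: 'a
      let ?w = "norm (x - y) powr \<alpha>"
      consider "x \<in> ?B" "y \<in> ?B" | "x \<in> ?B" "y \<notin> ?B" | "x \<notin> ?B" "y \<in> ?B" | "x \<notin> ?B" "y \<notin> ?B" by blast
      then show "norm (Df x - Df y) \<le> (C1 + C2) * H * ?w"
      proof cases
        case 1
        show ?thesis by (rule order_trans[OF in_B[OF 1] C12(1)]) simp
      next
        case 2
        show ?thesis by (rule order_trans[OF cross[OF 2] C12(2)]) simp
      next
        case 3
        have "norm (Df x - Df y) \<le> C2 * H * ?w" using cross[OF 3(2,1)] by (simp add: norm_minus_commute)
        then show ?thesis by (rule order_trans[OF _ C12(2)]) simp
      next
        case 4
        then show ?thesis using pos H by (simp add: Df_def)
      qed
    qed
    moreover have "norm (Df x) \<le> (C1 + C2) * H" for x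
      using Df_le[of x] C12(2)[of 1] by simp
    moreover have "Df 0 = 0"
    proof -
      have "blinfun_scaleR_left (0::'a) = 0" by (rule blinfun_eqI) simp
      then show ?thesis using g by (simp add: Df_def)
    qed
    ultimately show ?thesis by blast
  qed
  moreover have "\<forall>\<^sub>F x in nhds 0. \<phi> x = 1"
    unfolding eventually_nhds_metric using \<phi>(3,5) by (intro exI[of _ c1]) auto
  ultimately show ?thesis
  proof (intro that[of R "C1 + C2" \<phi>])
    show "0 \<le> C1 + C2" using pos by simp
    show "\<phi> x = 0" if "R \<le> norm x" for x using \<phi>(6)[of x] that R(2) by linarith
  qed (use R(1) in blast)+
qed

text \<open>
  Zooming in first makes the Hoelder constant of \<open>g\<close> as small as desired on the ball in which
  the bump function lives, so the bump function itself can be kept fixed. Multiplication by a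
  scalar function preserves the zeros on the range of \<open>P\<close>.
\<close>

lemma cutoff_of_germ:
  fixes g :: "'a::banach \<Rightarrow> 'a" and P :: "'a \<Rightarrow>\<^sub>L 'a"
  assumes "C1_holder_banach_space \<alpha> TYPE('a)" "0 < \<alpha>" "\<alpha> \<le> 1" "\<exists>v::'a. v \<noteq> 0"
    and g: "C1_germ \<alpha> g 0" and P: "\<And>x. P (P x) = P x" and gP: "\<forall>\<^sub>F x in nhds 0. g (P x) = 0" and "0 < \<eta>"
  obtains s f Df where "0 < s" "holder_derivative \<alpha> \<eta> UNIV f Df" "\<And>x. norm (Df x) \<le> \<eta>" "Df 0 = 0"
    "\<And>x. f (P x) = 0" "\<forall>\<^sub>F x in nhds 0. f x = g (s *\<^sub>R x) /\<^sub>R s"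
proof (rule cutoff_function[OF assms(1-4)])
  fix \<phi> :: "'a \<Rightarrow> real" and R C :: real
  assume R: "0 < R" "0 \<le> C" "\<forall>\<^sub>F x in nhds 0. \<phi> x = 1"
    "\<And>x. R \<le> norm x \<Longrightarrow> \<phi> x = 0"
    and cut: "\<And>(g :: 'a \<Rightarrow> 'a) H Dg. 0 \<le> H \<Longrightarrow> holder_derivative \<alpha> H (ball 0 R) g Dg \<Longrightarrow> g 0 = 0 \<Longrightarrow> Dg 0 = 0 \<Longrightarrow>
       \<exists>Df. holder_derivative \<alpha> (C * H) UNIV (\<lambda>x. \<phi> x *\<^sub>R g x) Df \<and> (\<forall>x. norm (Df x) \<le> C * H) \<and> Df 0 = 0"
  define \<eta>' where "\<eta>' = \<eta> / (C + 1)"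
  have \<eta>': "0 < \<eta>'" "C * \<eta>' \<le> \<eta>"
    using R(2) \<open>0 < \<eta>\<close> by (auto simp: \<eta>'_def field_simps)
  obtain s0 Dg where s0: "0 < s0" "Dg 0 = 0"
    "\<And>s. 0 < s \<Longrightarrow> s \<le> s0 \<Longrightarrow>
       holder_derivative \<alpha> \<eta>' (ball 0 R) (\<lambda>x. g (s *\<^sub>R x) /\<^sub>R s) (\<lambda>x. Dg (s *\<^sub>R x))"
    using C1_germ_zoom[OF g \<eta>'(1) R(1) assms(2)] by blast
  obtain e where e: "e > 0" "\<And>x. norm x < e \<Longrightarrow> g (P x) = 0"
    using gP unfolding eventually_nhds_metric by auto
  define s where "s = min s0 (e / R)"
  have s: "0 < s" "s \<le> s0" "s * R \<le> e"
    using s0(1) e(1) R(1) by (auto simp: s_def min_def field_simps)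
  have "g 0 = 0" using g by (rule C1_germE)
  then obtain Df where Df: "holder_derivative \<alpha> (C * \<eta>') UNIV (\<lambda>x. \<phi> x *\<^sub>R (g (s *\<^sub>R x) /\<^sub>R s)) Df"
    "\<And>x. norm (Df x) \<le> C * \<eta>'" "Df 0 = 0"
    using cut[OF less_imp_le[OF \<eta>'(1)] s0(3)[OF s(1,2)]] s0(2) by auto
  show ?thesis
  proof
    show "holder_derivative \<alpha> \<eta> UNIV (\<lambda>x. \<phi> x *\<^sub>R (g (s *\<^sub>R x) /\<^sub>R s)) Df"
      using holder_derivative_weaken[OF Df(1) \<eta>'(2)] .
    show "norm (Df x) \<le> \<eta>" for x using Df(2)[of x] \<eta>'(2) by linarith
    show "\<phi> (P x) *\<^sub>R (g (s *\<^sub>R P x) /\<^sub>R s) = 0" for x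
    proof (cases "R \<le> norm (P x)")
      case False
      then have "s * norm (P x) < s * R" using s(1) by simp
      moreover have "norm (s *\<^sub>R P x) = s * norm (P x)" using s(1) by simp
      ultimately have "norm (s *\<^sub>R P x) < e" using s(3) by linarith
      then show ?thesis using e(2)[of "s *\<^sub>R P x"] by (simp add: blinfun.scaleR_right P)
    qed (simp add: R(4))
    show "\<forall>\<^sub>F x in nhds 0. \<phi> x *\<^sub>R (g (s *\<^sub>R x) /\<^sub>R s) = g (s *\<^sub>R x) /\<^sub>R s"
      using R(3) by eventually_elim simp
  qed (use s Df in auto)
qed

section \<open>The unstable manifold and the linearization on it\<close>

text \<open>
  The map \<open>k\<close> is the limit of the iterates of \<open>k \<mapsto> L \<circ> k \<circ> M + f \<circ> (M + k \<circ> M)\<close> starting from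
  \<open>0\<close>, and \<open>K\<close> is the limit of their derivatives. The Hoelder constant \<open>1\<close> is preserved
  because \<open>k \<mapsto> L \<circ> k \<circ> M\<close> multiplies it by \<open>norm L * norm M powr (1 + \<alpha>)\<close>, which is small by
  \<open>LM\<close>, although \<open>norm L * norm M\<close> need not be. For the same reason differences are measured
  relative to \<open>norm x powr (1 + \<alpha>)\<close> for the maps and to \<open>norm x powr \<alpha>\<close> for their
  derivatives. As \<open>Df\<close> is only Hoelder continuous, the derivatives converge more slowly than
  the maps, at the rate \<open>\<mu>\<^sup>n\<close> with \<open>\<mu> \<ge> (1/4) powr \<alpha>\<close>.
\<close>

lemma unstable_manifold_in_unit_ball:
  fixes L M :: "'a::banach \<Rightarrow>\<^sub>L 'a" and f :: "'a \<Rightarrow> 'a" and \<eta> :: real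
  defines "B \<equiv> ball (0::'a) 1"
  assumes f: "holder_derivative \<alpha> \<eta> B f Df" "f 0 = 0" "Df 0 = 0"
    and "0 < \<alpha>" "0 \<le> \<eta>" "\<eta> \<le> 1/16"
    and M: "norm M \<le> 1/4" and LM: "norm L * (norm M powr \<alpha> * norm M) \<le> 1/8"
  obtains k K where "holder_derivative \<alpha> 1 B k K" "k 0 = 0" "K 0 = 0"
    "\<And>x. x \<in> B \<Longrightarrow> k x = L (k (M x)) + f (M x + k (M x))"
    "\<And>x y. M x = M y \<Longrightarrow> k x = k y"
proof -
  define kK :: "nat \<Rightarrow> ('a \<Rightarrow> 'a) \<times> ('a \<Rightarrow> 'a \<Rightarrow>\<^sub>L 'a)" where
    "kK = rec_nat (\<lambda>x. 0, \<lambda>x. 0) (\<lambda>n (k, K). (\<lambda>x. L (k (M x)) + f (M x + k (M x)),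
        \<lambda>x. (L o\<^sub>L (K (M x) o\<^sub>L M)) + (Df (M x + k (M x)) o\<^sub>L (M + (K (M x) o\<^sub>L M)))))"
  define k where "k n = fst (kK n)" for n
  define K where "K n = snd (kK n)" for n
  define j where "j n x = M x + k n (M x)" for n x
  define J where "J n x = M + (K n (M x) o\<^sub>L M)" for n x
  have k_simps: "k 0 x = 0" "k (Suc n) x = L (k n (M x)) + f (j n x)" for n x
    by (simp_all add: k_def kK_def j_def split_beta)
  have K_simps: "K 0 x = 0" "K (Suc n) x = (L o\<^sub>L (K n (M x) o\<^sub>L M)) + (Df (j n x) o\<^sub>L J n x)" for n x
    by (simp_all add: k_def K_def kK_def j_def J_def split_beta)
  have conv: "convex B" "open B" "0 \<in> B" by (simp_all add: B_def)
  have Mx: "norm (M x) \<le> norm x / 4" for x using norm_blinfun_apply_le[OF M, of x] by simp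
  have MB: "M x \<in> B" if "x \<in> B" for x using Mx[of x] that by (simp add: B_def)
  define a where "a = norm M powr \<alpha> * norm M"
  have a: "0 \<le> a" "a \<le> 1/4" "norm L * a \<le> 1/8"
  proof -
    have "norm M powr \<alpha> \<le> 1" using M \<open>0 < \<alpha>\<close> powr_mono2[of \<alpha> "norm M" 1] by auto
    then have "a \<le> 1 * (1/4)" unfolding a_def using M by (intro mult_mono) auto
    then show "a \<le> 1/4" by simp
  qed (use LM in \<open>simp_all add: a_def\<close>)
  have k_le: "norm (k' x) \<le> norm x powr \<alpha> * norm x" "norm (K' x) \<le> norm x powr \<alpha>"
    "norm (k' x) \<le> norm x" "norm (K' x) \<le> 1"
    if k': "holder_derivative \<alpha> 1 B k' K'" "k' 0 = 0" "K' 0 = 0" and x: "x \<in> B" for k' K' x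
  proof -
    show 1: "norm (k' x) \<le> norm x powr \<alpha> * norm x" "norm (K' x) \<le> norm x powr \<alpha>"
      using holder_derivative_remainder[OF k'(1)[unfolded B_def] k'(2,3) _ _ x[unfolded B_def]]
        holder_derivative_at_zero[OF k'(1)[unfolded B_def] k'(3) x[unfolded B_def]] \<open>0 < \<alpha>\<close> by simp_all
    have w: "norm x powr \<alpha> \<le> 1"
      using x \<open>0 < \<alpha>\<close> powr_mono2[of \<alpha> "norm x" 1] by (auto simp: B_def)
    show "norm (K' x) \<le> 1" using 1(2) w by linarith
    have "norm x powr \<alpha> * norm x \<le> 1 * norm x" by (rule mult_right_mono[OF w]) simp
    then show "norm (k' x) \<le> norm x" using 1(1) by linarith
  qed
  have Df_le: "norm (Df x) \<le> \<eta>" if x: "x \<in> B" for x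
  proof -
    have "norm (Df x) \<le> \<eta> * norm x powr \<alpha>"
      using holder_derivative_at_zero[OF f(1)[unfolded B_def] f(3) x[unfolded B_def]] .
    also have "\<dots> \<le> \<eta> * 1"
      using x \<open>0 < \<alpha>\<close> \<open>0 \<le> \<eta>\<close> powr_mono2[of \<alpha> "norm x" 1] by (intro mult_left_mono) (auto simp: B_def)
    finally show ?thesis by simp
  qed
  have f_lip: "norm (f x - f y) \<le> \<eta> * norm (x - y)" if "x \<in> B" "y \<in> B" for x y
    by (rule lipschitz_from_derivative[OF conv(1) holder_derivativeD(1)[OF f(1)] Df_le that])
  have kMB: "M x + k' (M x) \<in> B" if "\<And>y. y \<in> B \<Longrightarrow> norm (k' y) \<le> norm y" "x \<in> B" for k' x
  proof -
    have "norm (M x + k' (M x)) \<le> norm x / 4 + norm x / 4"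
      using Mx[of x] that(1)[OF MB[OF that(2)]] by (intro norm_triangle_mono) auto
    then show ?thesis using that(2) by (simp add: B_def)
  qed
  have inv: "holder_derivative \<alpha> 1 B (k n) (K n) \<and> k n 0 = 0 \<and> K n 0 = 0" for n
  proof (induction n)
    case 0
    have "holder_derivative \<alpha> 1 B (\<lambda>x. 0) (\<lambda>x. 0 :: 'a \<Rightarrow>\<^sub>L 'a)"
      by (simp add: holder_derivative_def zero_blinfun.rep_eq)
    then show ?case by (simp add: k_simps[abs_def] K_simps[abs_def])
  next
    case (Suc n)
    then have h: "holder_derivative \<alpha> 1 B (k n) (K n)" and z: "k n 0 = 0" "K n 0 = 0" by auto
    note le = k_le[OF h z]
    have jB: "j n x \<in> B" if "x \<in> B" for x unfolding j_def by (rule kMB[OF le(3) that])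
    have J_le: "norm (J n x) \<le> 1/2" if "x \<in> B" for x
      using norm_triangle_mono[OF M norm_blinfun_compose_le[OF le(4)[OF MB[OF that]] M]] by (simp add: J_def)
    have "holder_derivative \<alpha> (1 * norm M powr \<alpha> * norm M + 1 * 0) B (k n \<circ> blinfun_apply M) (\<lambda>x. K n (M x) o\<^sub>L M)"
      by (rule holder_derivative_compose[OF holder_derivative_linear h _ conv(1) _ _ order_refl le(4)])
         (use MB \<open>0 < \<alpha>\<close> in auto)
    then have h1: "holder_derivative \<alpha> a B (\<lambda>x. k n (M x)) (\<lambda>x. K n (M x) o\<^sub>L M)"
      by (simp add: a_def o_def)
    have h2: "holder_derivative \<alpha> a B (j n) (J n)"
      unfolding j_def J_def by (rule holder_derivative_linear_add[OF h1])
    have h3: "holder_derivative \<alpha> (\<eta> * (1/2) powr \<alpha> * (1/2) + \<eta> * a) B (f \<circ> j n) (\<lambda>x. Df (j n x) o\<^sub>L J n x)"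
      by (rule holder_derivative_compose[OF h2 f(1) _ conv(1) _ \<open>0 \<le> \<eta>\<close> J_le Df_le])
         (use jB \<open>0 < \<alpha>\<close> in auto)
    have "holder_derivative \<alpha> (norm L * a + (\<eta> * (1/2) powr \<alpha> * (1/2) + \<eta> * a)) B
       (\<lambda>x. L (k n (M x)) + (f \<circ> j n) x) (\<lambda>x. (L o\<^sub>L (K n (M x) o\<^sub>L M)) + (Df (j n x) o\<^sub>L J n x))"
      by (rule holder_derivative_add[OF holder_derivative_compose_linear_left[OF h1] h3])
    moreover have "norm L * a + (\<eta> * (1/2) powr \<alpha> * (1/2) + \<eta> * a) \<le> 1"
    proof -
      have "(1/2::real) powr \<alpha> \<le> 1" using \<open>0 < \<alpha>\<close> powr_mono2[of \<alpha> "1/2" 1] by auto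
      then have "\<eta> * (1/2) powr \<alpha> \<le> 1/16 * 1" using \<open>0 \<le> \<eta>\<close> \<open>\<eta> \<le> 1/16\<close> by (intro mult_mono) auto
      moreover have "\<eta> * a \<le> 1/16 * (1/4)" using \<open>0 \<le> \<eta>\<close> \<open>\<eta> \<le> 1/16\<close> a by (intro mult_mono) auto
      ultimately show ?thesis using a(3) by linarith
    qed
    ultimately have "holder_derivative \<alpha> 1 B (k (Suc n)) (K (Suc n))"
      unfolding k_simps[abs_def] K_simps[abs_def] o_def by (rule holder_derivative_weaken)
    moreover have "j n 0 = 0" by (simp add: j_def z)
    ultimately show ?case by (simp add: k_simps(2)[of n 0] K_simps(2)[of n 0] z f)
  qed
  note hk = inv[THEN conjunct1] and k0 = inv[THEN conjunct2, THEN conjunct1] and K0 = inv[THEN conjunct2, THEN conjunct2]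
  note kn_le = k_le[OF hk k0 K0]
  have jB: "j n x \<in> B" if "x \<in> B" for n x unfolding j_def by (rule kMB[OF kn_le(3) that])
  have Mw: "norm (M x) powr \<alpha> * norm (M x) \<le> a * (norm x powr \<alpha> * norm x)" for x
  proof -
    have "norm (M x) powr \<alpha> * norm (M x) \<le> (norm M * norm x) powr \<alpha> * (norm M * norm x)"
      using norm_blinfun[of M x] \<open>0 < \<alpha>\<close> by (intro mult_mono powr_mono2) auto
    then show ?thesis by (simp add: a_def powr_mult algebra_simps)
  qed
  have d_le: "norm (k (Suc n) x - k n x) \<le> (1/4) ^ n * (norm x powr \<alpha> * norm x)" if "x \<in> B" for n x
    using that
  proof (induction n arbitrary: x)
    case 0
    then show ?case using kn_le(1)[of x 1] by (simp add: k_simps(1))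
  next
    case (Suc n)
    let ?d = "k (Suc n) (M x) - k n (M x)"
    have "norm (f (j (Suc n) x) - f (j n x)) \<le> \<eta> * norm ?d"
      using f_lip[OF jB[OF Suc.prems] jB[OF Suc.prems], of "Suc n" n] by (simp add: j_def)
    moreover have "k (Suc (Suc n)) x - k (Suc n) x = L ?d + (f (j (Suc n) x) - f (j n x))"
      by (simp add: k_simps(2)[of "Suc n" x] k_simps(2)[of n x] blinfun.bilinear_simps)
    ultimately have "norm (k (Suc (Suc n)) x - k (Suc n) x) \<le> norm L * norm ?d + \<eta> * norm ?d"
      by (simp only: norm_triangle_mono norm_blinfun)
    also have "\<dots> = (norm L + \<eta>) * norm ?d" by (simp add: algebra_simps)
    also have "\<dots> \<le> (norm L + \<eta>) * ((1/4) ^ n * (a * (norm x powr \<alpha> * norm x)))"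
    proof (intro mult_left_mono)
      have "(1/4) ^ n * (norm (M x) powr \<alpha> * norm (M x)) \<le> (1/4) ^ n * (a * (norm x powr \<alpha> * norm x))"
        by (intro mult_left_mono Mw) simp
      then show "norm ?d \<le> (1/4) ^ n * (a * (norm x powr \<alpha> * norm x))"
        using Suc.IH[OF MB[OF Suc.prems]] by linarith
    qed (use \<open>0 \<le> \<eta>\<close> in simp)
    also have "\<dots> = ((norm L * a) + \<eta> * a) * ((1/4) ^ n * (norm x powr \<alpha> * norm x))"
      by (simp add: algebra_simps)
    also have "\<dots> \<le> 1/4 * ((1/4) ^ n * (norm x powr \<alpha> * norm x))"
    proof (intro mult_right_mono)
      have "\<eta> * a \<le> 1/16 * (1/4)" using \<open>0 \<le> \<eta>\<close> \<open>\<eta> \<le> 1/16\<close> a by (intro mult_mono) auto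
      then show "norm L * a + \<eta> * a \<le> 1/4" using a(3) by linarith
    qed simp
    finally show ?case by simp
  qed
  \<comment> \<open>The second entry is the rate at which \<open>Df\<close> varies between consecutive iterates; the first one
    leaves room for the contraction of the remaining terms.\<close>
  define \<mu> :: real where "\<mu> = max (1/2) ((1/4) powr \<alpha>)"
  have \<mu>: "1/2 \<le> \<mu>" "\<mu> < 1" "(1/4) powr \<alpha> \<le> \<mu>"
  proof -
    have "(1/4::real) powr \<alpha> < 1 powr \<alpha>" using \<open>0 < \<alpha>\<close> by (intro powr_less_mono2) auto
    then show "\<mu> < 1" by (simp add: \<mu>_def)
  qed (auto simp: \<mu>_def)
  have e_le: "norm (K (Suc n) x - K n x) \<le> \<mu> ^ n * norm x powr \<alpha>" if "x \<in> B" for n x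
    using that
  proof (induction n arbitrary: x)
    case 0
    then show ?case using kn_le(2)[of x 1] by (simp add: K_simps(1))
  next
    case (Suc n)
    let ?E = "K (Suc n) (M x) - K n (M x)" and ?w = "norm x powr \<alpha>"
    have "norm ?E \<le> \<mu> ^ n * norm (M x) powr \<alpha>" by (rule Suc.IH[OF MB[OF Suc.prems]])
    also have "\<dots> \<le> \<mu> ^ n * (norm M powr \<alpha> * ?w)"
    proof (rule mult_left_mono)
      have "norm (M x) powr \<alpha> \<le> (norm M * norm x) powr \<alpha>"
        using norm_blinfun[of M x] \<open>0 < \<alpha>\<close> by (intro powr_mono2) auto
      then show "norm (M x) powr \<alpha> \<le> norm M powr \<alpha> * ?w" by (simp add: powr_mult)
    qed (use \<mu> in simp)
    finally have "norm (?E o\<^sub>L M) \<le> \<mu> ^ n * (norm M powr \<alpha> * ?w) * norm M"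
      by (rule norm_blinfun_compose_le) simp
    then have E: "norm (?E o\<^sub>L M) \<le> a * (\<mu> ^ n * ?w)" by (simp add: a_def mult_ac)
    have J_le: "norm (J (Suc n) x) \<le> 1/2"
      using norm_triangle_mono[OF M norm_blinfun_compose_le[OF kn_le(4)[OF MB[OF Suc.prems]] M]] by (simp add: J_def)
    have "norm (j (Suc n) x - j n x) \<le> (1/4) ^ n * norm x"
    proof -
      have 1: "norm (M x) powr \<alpha> \<le> 1"
        using MB[OF Suc.prems] \<open>0 < \<alpha>\<close> powr_mono2[of \<alpha> "norm (M x)" 1] by (auto simp: B_def)
      have "norm (M x) powr \<alpha> * norm (M x) \<le> 1 * norm x"
      proof (rule mult_mono[OF 1])
        show "norm (M x) \<le> norm x" using Mx[of x] norm_ge_zero[of x] by linarith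
      qed auto
      then have "(1/4) ^ n * (norm (M x) powr \<alpha> * norm (M x)) \<le> (1/4) ^ n * norm x"
        by (intro mult_left_mono) auto
      moreover have "j (Suc n) x - j n x = k (Suc n) (M x) - k n (M x)" by (simp add: j_def)
      ultimately show ?thesis using d_le[OF MB[OF Suc.prems], of n] by (metis order_trans)
    qed
    then have "norm (j (Suc n) x - j n x) powr \<alpha> \<le> ((1/4) ^ n * norm x) powr \<alpha>"
      using \<open>0 < \<alpha>\<close> by (intro powr_mono2) auto
    also have "\<dots> = ((1/4) powr \<alpha>) ^ n * ?w"
      by (simp add: powr_mult powr_power powr_powr mult.commute flip: powr_realpow)
    also have "\<dots> \<le> \<mu> ^ n * ?w" using \<mu> by (intro mult_right_mono power_mono) auto
    finally have "\<eta> * norm (j (Suc n) x - j n x) powr \<alpha> \<le> \<eta> * (\<mu> ^ n * ?w)"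
      using \<open>0 \<le> \<eta>\<close> by (intro mult_left_mono)
    then have DfJ: "norm (Df (j (Suc n) x) - Df (j n x)) \<le> \<eta> * (\<mu> ^ n * ?w)"
      using holder_derivativeD(2)[OF f(1) jB[OF Suc.prems] jB[OF Suc.prems], of "Suc n" n] by linarith
    have JJ: "norm (J (Suc n) x - J n x) \<le> a * (\<mu> ^ n * ?w)"
    proof -
      have "J (Suc n) x - J n x = ?E o\<^sub>L M" by (intro blinfun_eqI) (simp add: J_def blinfun.bilinear_simps)
      then show ?thesis using E by simp
    qed
    have "K (Suc (Suc n)) x - K (Suc n) x = (L o\<^sub>L (?E o\<^sub>L M)) + ((Df (j (Suc n) x) o\<^sub>L J (Suc n) x) - (Df (j n x) o\<^sub>L J n x))"
      by (intro blinfun_eqI) (simp add: K_simps(2)[of "Suc n" x] K_simps(2)[of n x] blinfun.bilinear_simps)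
    moreover have "norm (L o\<^sub>L (?E o\<^sub>L M)) \<le> norm L * (a * (\<mu> ^ n * ?w))"
      by (rule norm_blinfun_compose_le[OF order_refl E])
    ultimately have "norm (K (Suc (Suc n)) x - K (Suc n) x) \<le> norm L * (a * (\<mu> ^ n * ?w))
        + (\<eta> * (\<mu> ^ n * ?w) * (1/2) + \<eta> * (a * (\<mu> ^ n * ?w)))"
      using norm_compose_diff_le[OF DfJ J_le Df_le[OF jB[OF Suc.prems]] JJ] by (simp only: norm_triangle_mono)
    also have "\<dots> = (norm L * a + \<eta> / 2 + \<eta> * a) * (\<mu> ^ n * ?w)" by (simp add: algebra_simps)
    also have "\<dots> \<le> \<mu> * (\<mu> ^ n * ?w)"
    proof (rule mult_right_mono)
      have "\<eta> * a \<le> 1/16 * (1/4)" using \<open>0 \<le> \<eta>\<close> \<open>\<eta> \<le> 1/16\<close> a by (intro mult_mono) auto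
      then show "norm L * a + \<eta> / 2 + \<eta> * a \<le> \<mu>" using a(3) \<mu>(1) \<open>\<eta> \<le> 1/16\<close> by linarith
    qed (use \<mu> in simp)
    finally show ?case by (simp add: mult_ac)
  qed
  define Kl where "Kl x = (\<Sum>n. K (Suc n) x - K n x)" for x
  have "uniform_limit B (\<lambda>n x. \<Sum>i<n. K (Suc i) x - K i x) Kl sequentially"
    unfolding Kl_def
  proof (rule Weierstrass_m_test)
    show "norm (K (Suc n) x - K n x) \<le> \<mu> ^ n" if "x \<in> B" for n x
    proof -
      have "norm x powr \<alpha> \<le> 1"
        using that \<open>0 < \<alpha>\<close> powr_mono2[of \<alpha> "norm x" 1] by (auto simp: B_def)
      then have "\<mu> ^ n * norm x powr \<alpha> \<le> \<mu> ^ n * 1" using \<mu> by (intro mult_left_mono) auto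
      then show ?thesis using e_le[OF that, of n] by linarith
    qed
    show "summable (\<lambda>n. \<mu> ^ n)" using \<mu> by (intro summable_geometric) auto
  qed
  moreover have "(\<lambda>n x. \<Sum>i<n. K (Suc i) x - K i x) = K"
  proof (intro ext)
    fix n x
    show "(\<Sum>i<n. K (Suc i) x - K i x) = K n x"
      using sum_lessThan_telescope[of "\<lambda>i. K i x" n] by (simp only: K_simps(1) diff_zero)
  qed
  ultimately have UL: "uniform_limit B K Kl sequentially" by simp
  have Klim: "(\<lambda>n. K n x) \<longlonglongrightarrow> Kl x" if "x \<in> B" for x
    by (rule tendsto_uniform_limitI[OF UL that])
  have "\<exists>g. \<forall>x\<in>B. (\<lambda>n. k n x) \<longlonglongrightarrow> g x \<and> (g has_derivative blinfun_apply (Kl x)) (at x within B)"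
  proof (rule has_derivative_sequence[where f = k and f' = "\<lambda>n x. blinfun_apply (K n x)", OF conv(1) _ _ conv(3)])
    show "(k n has_derivative blinfun_apply (K n x)) (at x within B)" if "x \<in> B" for n x
      using holder_derivativeD(1)[OF hk that] by (rule has_derivative_at_withinI)
    show "\<forall>\<^sub>F n in sequentially. \<forall>x\<in>B. \<forall>h. norm (K n x h - Kl x h) \<le> e * norm h" if "e > 0" for e
      using uniform_limitD[OF UL that]
    proof eventually_elim
      case (elim n)
      show ?case
      proof safe
        fix x h assume "x \<in> B"
        then have "norm (K n x - Kl x) \<le> e" using elim by (auto simp: dist_norm)
        from norm_blinfun_apply_le[OF this, of h] show "norm (K n x h - Kl x h) \<le> e * norm h"
          by (simp add: blinfun.diff_left)
      qed
    qed
    show "(\<lambda>n. k n 0) \<longlonglongrightarrow> 0" by (simp add: k0)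
  qed
  then obtain g where g: "\<And>x. x \<in> B \<Longrightarrow> (\<lambda>n. k n x) \<longlonglongrightarrow> g x"
    "\<And>x. x \<in> B \<Longrightarrow> (g has_derivative blinfun_apply (Kl x)) (at x within B)" by blast
  define kl where "kl x = lim (\<lambda>n. k n x)" for x
  have kl: "(\<lambda>n. k n x) \<longlonglongrightarrow> kl x" "kl x = g x" if "x \<in> B" for x
    using g(1)[OF that] limI[OF g(1)[OF that]] by (simp_all add: kl_def)
  have hkl: "holder_derivative \<alpha> 1 B kl Kl"
    unfolding holder_derivative_def
  proof (intro conjI ballI)
    fix x assume x: "x \<in> B"
    have "(g has_derivative blinfun_apply (Kl x)) (at x)"
      using g(2)[OF x] at_within_open[OF x conv(2)] by simp
    then show "(kl has_derivative blinfun_apply (Kl x)) (at x)"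
      by (rule has_derivative_transform_within_open[OF _ conv(2) x]) (simp add: kl(2))
    fix y assume y: "y \<in> B"
    show "norm (Kl x - Kl y) \<le> 1 * norm (x - y) powr \<alpha>"
      by (rule Lim_norm_ubound[OF _ tendsto_diff[OF Klim[OF x] Klim[OF y]]])
         (use holder_derivativeD(2)[OF hk x y] in auto)
  qed
  have z: "kl 0 = 0" "Kl 0 = 0"
    by (simp_all add: kl_def Kl_def k0 K0)
  note kl_le = k_le[OF hkl z]
  show ?thesis
  proof (rule that[of kl Kl])
    show "kl x = L (kl (M x)) + f (M x + kl (M x))" if x: "x \<in> B" for x
    proof -
      have lim: "(\<lambda>n. k n (M x)) \<longlonglongrightarrow> kl (M x)" by (rule kl(1)[OF MB[OF x]])
      have "isCont f (M x + kl (M x))"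
        using holder_derivativeD(1)[OF f(1) kMB[OF kl_le(3) x]] has_derivative_continuous by blast
      then have "(\<lambda>n. f (j n x)) \<longlonglongrightarrow> f (M x + kl (M x))"
        unfolding j_def by (rule isCont_tendsto_compose) (intro tendsto_intros lim)
      then have "(\<lambda>n. k (Suc n) x) \<longlonglongrightarrow> L (kl (M x)) + f (M x + kl (M x))"
        unfolding k_simps by (intro tendsto_intros lim)
      then show ?thesis
        using LIMSEQ_unique LIMSEQ_Suc[OF kl(1)[OF x]] by blast
    qed
    show "kl x = kl y" if M_eq: "M x = M y" for x y
    proof -
      have "k n x = k n y" for n
        by (cases n) (simp_all only: k_simps j_def M_eq)
      then show ?thesis by (simp only: kl_def)
    qed
  qed (use hkl z in auto)
qed

text \<open>
  The invariance equation for \<open>k\<close> at the point \<open>L (P x)\<close>, where \<open>M (L (P x)) = P x\<close>.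
\<close>

lemma unstable_manifold_parametrization:
  fixes T :: "'a::banach \<Rightarrow> 'a" and L Li P :: "'a \<Rightarrow>\<^sub>L 'a"
  defines "M \<equiv> Li o\<^sub>L P"
  assumes T: "C1_germ \<alpha> T L" and "0 < \<alpha>"
    and inv': "\<And>x. Li (L x) = x" and PP: "\<And>x. P (P x) = P x" and PL: "\<And>x. P (L x) = L (P x)"
    and M: "norm M \<le> 1/4" and LM: "norm L * (norm M powr \<alpha> * norm M) \<le> 1/8"
  obtains k where "C1_germ \<alpha> k 0" "\<And>x. k (P x) = k x"
    "\<forall>\<^sub>F x in nhds 0. T (P x + k x) = L (P x) + k (L (P x))"
proof -
  have "C1_germ \<alpha> (\<lambda>x. T x + (- L) x) (L + - L)"
    by (intro C1_germ_add T C1_germ_linear)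
  then have germ: "C1_germ \<alpha> (\<lambda>x. T x - L x) 0" by (simp add: blinfun.minus_left)
  have "(0::real) < 1/16" "(0::real) < 1" by simp_all
  then obtain s Df where s: "0 < s" "Df 0 = 0"
    and zoom: "\<And>t. 0 < t \<Longrightarrow> t \<le> s \<Longrightarrow> holder_derivative \<alpha> (1/16) (ball 0 1)
      (\<lambda>x. (T (t *\<^sub>R x) - L (t *\<^sub>R x)) /\<^sub>R t) (\<lambda>x. Df (t *\<^sub>R x))"
    using C1_germ_zoom[OF germ _ _ \<open>0 < \<alpha>\<close>] by blast
  define f where "f x = (T (s *\<^sub>R x) - L (s *\<^sub>R x)) /\<^sub>R s" for x
  have "T 0 = 0" using T by (rule C1_germE)
  have Df0: "Df (s *\<^sub>R 0) = 0" by (simp add: s)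
  have sixteenth: "(0::real) \<le> 1/16" by simp
  have "f 0 = 0" by (simp add: f_def \<open>T 0 = 0\<close>)
  obtain k1 K1 where k1: "holder_derivative \<alpha> 1 (ball 0 1) k1 K1" "k1 0 = 0" "K1 0 = 0"
    "\<And>x. x \<in> ball 0 1 \<Longrightarrow> k1 x = L (k1 (M x)) + f (M x + k1 (M x))"
    "\<And>x y. M x = M y \<Longrightarrow> k1 x = k1 y"
    using unstable_manifold_in_unit_ball[OF zoom[OF s(1) order_refl, folded f_def] \<open>f 0 = 0\<close> Df0
        \<open>0 < \<alpha>\<close> sixteenth order_refl M LM]
    by blast
  define k where "k x = k1 (inverse s *\<^sub>R x) /\<^sub>R inverse s" for x
  show ?thesis
  proof
    have "C1_germ \<alpha> k1 0"
      unfolding C1_germ_def using k1(1-3) zero_less_one[where 'a = real] zero_le_one[where 'a = real] by blast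
    then show "C1_germ \<alpha> k 0"
      unfolding k_def by (rule C1_germ_scale) (use s \<open>0 < \<alpha>\<close> in auto)
    show kP: "k (P x) = k x" for x
      unfolding k_def using k1(5)[of "inverse s *\<^sub>R P x" "inverse s *\<^sub>R x"]
      by (simp add: M_def blinfun.bilinear_simps PP)
    have "filterlim (\<lambda>x. L (P x)) (nhds 0) (nhds 0)"
      using C1_germ_tendsto[OF C1_germ_linear[of 1 "L o\<^sub>L P"]] by (simp add: blinfun_compose.rep_eq o_def)
    moreover have "\<forall>\<^sub>F x in nhds (0::'a). norm x < s"
      unfolding eventually_nhds_metric using s(1) by auto
    ultimately have "\<forall>\<^sub>F x in nhds 0. norm (L (P x)) < s"
      by (rule eventually_compose_filterlim[rotated])
    then show "\<forall>\<^sub>F x in nhds 0. T (P x + k x) = L (P x) + k (L (P x))"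
    proof eventually_elim
      case (elim x)
      define y where "y = inverse s *\<^sub>R x"
      define z where "z = L (P y)"
      have x: "x = s *\<^sub>R y" using s(1) by (simp add: y_def)
      have "z \<in> ball 0 1" using elim s(1) by (simp add: z_def x blinfun.scaleR_right)
      moreover have "M z = P y" by (simp add: z_def M_def PL PP inv')
      moreover have "k1 (P y) = k1 y" by (rule k1(5)) (simp add: M_def PP)
      ultimately have eq: "k1 z = L (k1 y) + f (P y + k1 y)" using k1(4) by metis
      have kx: "k x = s *\<^sub>R k1 y" using s(1) by (simp add: k_def x)
      have kL: "k (L (P x)) = s *\<^sub>R k1 z" using s(1) by (simp add: k_def x z_def blinfun.scaleR_right)
      have "s *\<^sub>R f (P y + k1 y) = T (P x + k x) - L (P x + k x)"
        using s(1) by (simp add: f_def kx) (simp add: x blinfun.scaleR_right scaleR_add_right)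
      then have "k (L (P x)) = L (k x) + (T (P x + k x) - L (P x + k x))"
        unfolding kL eq by (simp add: scaleR_add_right kx blinfun.scaleR_right)
      then show ?case by (simp add: blinfun.add_right)
    qed
  qed
qed

text \<open>
  The coordinate change \<open>\<Psi> x = x + k x\<close> turns \<open>T\<close> into a germ that is linear on the range of
  \<open>P\<close>. After cutting off, the semiconjugacy on the tube applies, and its germ is transported
  back.
\<close>

lemma expanding_semiconjugacy:
  fixes T :: "'a::banach \<Rightarrow> 'a" and L Li P Q :: "'a \<Rightarrow>\<^sub>L 'a"
  defines "M \<equiv> Li o\<^sub>L P"
  assumes bump: "C1_holder_banach_space \<alpha> TYPE('a)" "\<exists>v::'a. v \<noteq> 0"
    and T: "C1_germ \<alpha> T L" and "0 < \<alpha>" "\<alpha> \<le> 1"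
    and inv: "\<And>x. L (Li x) = x" and inv': "\<And>x. Li (L x) = x"
    and PQ: "\<And>x. P x + Q x = x" and PP: "\<And>x. P (P x) = P x" and PL: "\<And>x. P (L x) = L (P x)"
    and M: "norm M \<le> 1/4" and LM: "norm L * (norm M powr \<alpha> * norm M) \<le> 1/8"
    and LQ: "norm (L o\<^sub>L Q) \<le> 1/2" and LPQ: "norm M * (norm (L o\<^sub>L P) * norm (L o\<^sub>L Q) powr \<alpha>) \<le> 1/4"
  obtains \<beta> R where "0 < \<beta>" "\<beta> < \<alpha>" "C1_germ \<beta> R P" "\<forall>\<^sub>F x in nhds 0. R (T x) = L (R x)"
proof -
  have idc: "id_blinfun o\<^sub>L X = X" "X o\<^sub>L id_blinfun = X" for X :: "'a \<Rightarrow>\<^sub>L 'a" by (rule blinfun_eqI, simp)+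
  obtain k where k: "C1_germ \<alpha> k 0" "\<And>x. k (P x) = k x"
    "\<forall>\<^sub>F x in nhds 0. T (P x + k x) = L (P x) + k (L (P x))"
    using unstable_manifold_parametrization[OF T \<open>0 < \<alpha>\<close> inv' PP PL M[unfolded M_def] LM[unfolded M_def]]
    by blast
  define \<Psi> where "\<Psi> x = x + k x" for x
  have \<Psi>: "C1_germ \<alpha> \<Psi> id_blinfun"
    using C1_germ_add[OF C1_germ_linear[of \<alpha> id_blinfun] k(1)] by (simp add: \<Psi>_def[abs_def])
  obtain \<Phi> where \<Phi>: "C1_germ \<alpha> \<Phi> id_blinfun" "\<forall>\<^sub>F x in nhds 0. \<Phi> (\<Psi> x) = x" "\<forall>\<^sub>F x in nhds 0. \<Psi> (\<Phi> x) = x"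
    using C1_germ_inverse[OF \<Psi> _ _ \<open>0 < \<alpha>\<close>, of id_blinfun] idc by auto
  define T' where "T' = \<Phi> \<circ> (T \<circ> \<Psi>)"
  have T': "C1_germ \<alpha> T' L"
    using C1_germ_compose[OF C1_germ_compose[OF \<Psi> T \<open>0 < \<alpha>\<close>] \<Phi>(1) \<open>0 < \<alpha>\<close>] by (simp add: T'_def idc)
  have T'P: "\<forall>\<^sub>F x in nhds 0. T' (P x) = L (P x)"
  proof -
    have "\<forall>\<^sub>F x in nhds 0. \<Phi> (\<Psi> ((L o\<^sub>L P) x)) = (L o\<^sub>L P) x"
      by (rule C1_germ_eventually[OF C1_germ_linear \<Phi>(2)])
    with k(3) show ?thesis
    proof eventually_elim
      case (elim x)
      have "T' (P x) = \<Phi> (T (P x + k x))" by (simp add: T'_def \<Psi>_def k(2))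
      then show ?case using elim by (simp add: \<Psi>_def)
    qed
  qed
  define g where "g x = T' x - L x" for x
  have "C1_germ \<alpha> (\<lambda>x. T' x + (- L) x) (L + - L)" by (intro C1_germ_add T' C1_germ_linear)
  then have g: "C1_germ \<alpha> g 0" by (simp add: g_def[abs_def] blinfun.minus_left)
  have gP: "\<forall>\<^sub>F x in nhds 0. g (P x) = 0" using T'P by eventually_elim (simp add: g_def)
  let ?a = "norm M" and ?b = "norm (L o\<^sub>L Q)" and ?l = "norm (L o\<^sub>L P)"
  have "\<forall>\<^sub>F \<eta> in at_right 0. ?b + norm Q * \<eta> < 1"
  proof (rule order_tendstoD)
    show "((\<lambda>\<eta>. ?b + norm Q * \<eta>) \<longlongrightarrow> ?b + norm Q * 0) (at_right 0)" by (intro tendsto_intros)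
  qed (use LQ in auto)
  moreover have "\<forall>\<^sub>F \<eta> in at_right 0. ?a * (?l * (?b + norm Q * \<eta>) powr \<alpha> + 2 * \<eta> * norm P) < 1/2"
  proof (rule order_tendstoD)
    have "\<forall>\<^sub>F \<eta> in at_right (0::real). 0 \<le> ?b + norm Q * \<eta>"
      using eventually_at_right_less[of 0] by eventually_elim auto
    then show "((\<lambda>\<eta>. ?a * (?l * (?b + norm Q * \<eta>) powr \<alpha> + 2 * \<eta> * norm P))
        \<longlongrightarrow> ?a * (?l * (?b + norm Q * 0) powr \<alpha> + 2 * 0 * norm P)) (at_right 0)"
      using \<open>0 < \<alpha>\<close> by (intro tendsto_intros) auto
  qed (use LPQ in auto)
  moreover have "\<forall>\<^sub>F \<eta> in at_right 0. ?a * (?b + 2 * \<eta> * norm Q) < 1/2"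
  proof (rule order_tendstoD)
    show "((\<lambda>\<eta>. ?a * (?b + 2 * \<eta> * norm Q)) \<longlongrightarrow> ?a * (?b + 2 * 0 * norm Q)) (at_right 0)"
      by (intro tendsto_intros)
    have "?a * ?b \<le> 1/4 * (1/2)" using M LQ by (intro mult_mono) auto
    then show "?a * (?b + 2 * 0 * norm Q) < 1/2" by simp
  qed
  moreover have "\<forall>\<^sub>F \<eta> in at_right 0. \<eta> \<in> {0<..<1::real}" by (rule eventually_at_right_real) simp
  ultimately have "\<forall>\<^sub>F \<eta> in at_right 0. ?b + norm Q * \<eta> < 1 \<and>
      ?a * (?l * (?b + norm Q * \<eta>) powr \<alpha> + 2 * \<eta> * norm P) < 1/2 \<and> ?a * (?b + 2 * \<eta> * norm Q) < 1/2 \<and> \<eta> \<in> {0<..<1}"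
    by eventually_elim blast
  from eventually_happens[OF this] obtain \<eta> where \<eta>: "0 < \<eta>" "\<eta> < 1" "?b + norm Q * \<eta> < 1"
      "?a * (?l * (?b + norm Q * \<eta>) powr \<alpha> + 2 * \<eta> * norm P) < 1/2" "?a * (?b + 2 * \<eta> * norm Q) < 1/2"
    by auto
  obtain s f Df where s: "0 < s" and f: "holder_derivative \<alpha> \<eta> UNIV f Df" "\<And>x. norm (Df x) \<le> \<eta>" "Df 0 = 0"
    "\<And>x. f (P x) = 0" "\<forall>\<^sub>F x in nhds 0. f x = g (s *\<^sub>R x) /\<^sub>R s"
    using cutoff_of_germ[OF bump(1) \<open>0 < \<alpha>\<close> \<open>\<alpha> \<le> 1\<close> bump(2) g PP gP \<eta>(1)] by blast
  obtain \<beta> R0 where \<beta>: "0 < \<beta>" "\<beta> < \<alpha>" and R0: "C1_germ \<beta> R0 P"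
    "\<And>x. norm (Q x) < 1 \<Longrightarrow> R0 (L x + f x) = L (R0 x)"
  proof (rule expanding_semiconjugacy_on_tube[OF inv inv' PQ PP PL holder_derivative_subset[OF f(1) subset_UNIV] f(2,4,3)])
    show "norm (Li o\<^sub>L P) \<le> 1/2" using M by (simp add: M_def)
  qed (use \<eta> \<open>0 < \<alpha>\<close> in \<open>auto simp: M_def\<close>)
  define R1 where "R1 x = R0 (inverse s *\<^sub>R x) /\<^sub>R inverse s" for x
  have R1: "C1_germ \<beta> R1 P"
    unfolding R1_def by (rule C1_germ_scale[OF R0(1)]) (use s \<beta> in auto)
  have scale: "filterlim (\<lambda>x. inverse s *\<^sub>R x) (nhds 0) (nhds (0::'a))"
    using C1_germ_tendsto[OF C1_germ_linear[of 1 "inverse s *\<^sub>R id_blinfun"]] by (simp add: scaleR_blinfun.rep_eq)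
  have "\<forall>\<^sub>F x in nhds 0. norm (Q x) < 1"
    by (rule C1_germ_eventually[OF C1_germ_linear]) (auto simp: eventually_nhds_metric intro!: exI[of _ 1])
  with f(5) have "\<forall>\<^sub>F y in nhds 0. f y = g (s *\<^sub>R y) /\<^sub>R s \<and> norm (Q y) < 1" by eventually_elim blast
  then have "\<forall>\<^sub>F x in nhds 0. f (inverse s *\<^sub>R x) = g (s *\<^sub>R (inverse s *\<^sub>R x)) /\<^sub>R s \<and> norm (Q (inverse s *\<^sub>R x)) < 1"
    using scale by (rule eventually_compose_filterlim)
  then have R1T: "\<forall>\<^sub>F x in nhds 0. R1 (T' x) = L (R1 x)"
  proof eventually_elim
    case (elim x)
    define y where "y = inverse s *\<^sub>R x"
    have "L y + f y = inverse s *\<^sub>R T' x"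
      using elim s by (simp add: y_def g_def blinfun.scaleR_right flip: scaleR_add_right)
    then have "R0 (inverse s *\<^sub>R T' x) = L (R0 y)" using R0(2)[of y] elim by (simp add: y_def)
    then show ?case using s by (simp add: R1_def y_def blinfun.scaleR_right)
  qed
  have "C1_germ \<beta> (R1 \<circ> \<Phi>) P"
    using C1_germ_compose[OF C1_germ_exponent[OF \<Phi>(1)] R1 \<beta>(1)] \<beta>(2) by (simp add: idc)
  moreover have "\<forall>\<^sub>F x in nhds 0. (R1 \<circ> \<Phi>) (T x) = L ((R1 \<circ> \<Phi>) x)"
    using C1_germ_eventually[OF \<Phi>(1) R1T] \<Phi>(3)
    by eventually_elim (simp add: T'_def)
  ultimately show ?thesis using that \<beta> by blast
qed

section \<open>Spectral radii and the hyperbolic splitting\<close>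

text \<open>
  Fekete's argument: writing \<open>n = q m + r\<close> with \<open>r < m\<close> gives \<open>a n \<le> t\<^sup>n C\<close> for the \<open>m\<close>-th
  root \<open>t\<close> of \<open>a m\<close>, and the \<open>n\<close>-th root of the constant \<open>C\<close> tends to \<open>1\<close>. So the limit is
  the infimum of the roots.
\<close>

lemma submultiplicative_root_convergent:
  fixes a :: "nat \<Rightarrow> real"
  assumes pos: "\<And>n. 0 < a n" and sub: "\<And>m n. a (m + n) \<le> a m * a n"
  shows "convergent (\<lambda>n. root n (a n))"
proof -
  define l where "l = (INF n\<in>{1..}. root n (a n))"
  have nonneg: "0 \<le> root n (a n)" for n by (simp add: pos less_imp_le real_root_ge_zero)
  have bdd: "bdd_below ((\<lambda>n. root n (a n)) ` {1..})" by (intro bdd_belowI[of _ 0]) (auto simp: nonneg)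
  have upper: "\<forall>\<^sub>F n in sequentially. root n (a n) < y" if "l < y" for y
  proof -
    obtain m where m: "m \<ge> 1" "root m (a m) < y"
      using \<open>l < y\<close> bdd unfolding l_def by (subst (asm) cINF_less_iff) auto
    \<comment> \<open>The index \<open>m\<close> comes from the infimum; \<open>C\<close> below absorbs the remainders modulo \<open>m\<close>.\<close>
    define t where "t = root m (a m)"
    have t: "0 < t" "t < y" "t ^ m = a m" using m pos[of m] by (auto simp: t_def)
    define C where "C = Max ((\<lambda>r. a r / t ^ r) ` {..<m})"
    have C: "a r / t ^ r \<le> C" if "r < m" for r unfolding C_def using that by (intro Max_ge) auto
    have "0 < a 0 / t ^ 0" using pos by simp
    then have "0 < C" using C[of 0] m(1) by linarith
    have powers: "a (q * m + r) \<le> a m ^ q * a r" for q r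
    proof (induction q)
      case (Suc q)
      have "a (Suc q * m + r) \<le> a m * a (q * m + r)" using sub[of m "q * m + r"] by (simp add: add.assoc)
      also have "\<dots> \<le> a m * (a m ^ q * a r)" by (rule mult_left_mono[OF Suc.IH less_imp_le[OF pos]])
      finally show ?case by (simp add: mult.assoc)
    qed simp
    have a_le: "a n \<le> t ^ n * C" for n
    proof -
      have "a n \<le> a m ^ (n div m) * a (n mod m)" using powers[of "n div m" "n mod m"] by simp
      also have "\<dots> = t ^ n * (a (n mod m) / t ^ (n mod m))"
      proof -
        have "t ^ n = t ^ (m * (n div m)) * t ^ (n mod m)" by (simp flip: power_add)
        then show ?thesis using t(1) by (simp add: power_mult t(3))
      qed
      also have "\<dots> \<le> t ^ n * C" using t(1) m(1) by (intro mult_left_mono C) auto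
      finally show ?thesis .
    qed
    have "(\<lambda>n. t * root n C) \<longlonglongrightarrow> t * 1" by (intro tendsto_intros LIMSEQ_root_const \<open>0 < C\<close>)
    then have "\<forall>\<^sub>F n in sequentially. t * root n C < y" by (rule order_tendstoD) (use t in simp)
    with eventually_gt_at_top[of 0] show ?thesis
    proof eventually_elim
      case (elim n)
      have "root n (a n) \<le> root n (t ^ n * C)" using elim a_le by (intro real_root_le_mono) auto
      also have "\<dots> = t * root n C" using elim t(1) by (simp add: real_root_mult real_root_power_cancel)
      finally show ?case using elim by linarith
    qed
  qed
  have "(\<lambda>n. root n (a n)) \<longlonglongrightarrow> l"
  proof (rule order_tendstoI)
    fix y assume "y < l"
    have "y < root n (a n)" if "n \<ge> 1" for n
      using cINF_lower[OF bdd, of n] that \<open>y < l\<close> unfolding l_def by auto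
    then show "\<forall>\<^sub>F n in sequentially. y < root n (a n)"
      unfolding eventually_sequentially by blast
  qed (rule upper)
  then show ?thesis by (rule convergentI)
qed

lemma funpow_in: "A ` S \<subseteq> S \<Longrightarrow> x \<in> S \<Longrightarrow> (A ^^ n) x \<in> S"
  by (induction n) auto

text \<open>
  The spectral radius is defined by \<open>lim\<close>, so it carries information only once the limit is
  known to exist.
\<close>

lemma onorm_on_iterates:
  fixes A :: "'a::banach \<Rightarrow> 'a"
  assumes bij: "bij_betw A S S" and zero: "0 \<in> S" "A 0 = 0" and ne: "S \<noteq> {0}"
    and bd: "\<And>x. x \<in> S \<Longrightarrow> norm (A x) \<le> K * norm x"
  shows "0 < onorm_on S (A ^^ n)"
    and "x \<in> S \<Longrightarrow> norm ((A ^^ n) x) \<le> onorm_on S (A ^^ n) * norm x"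
    and "(\<lambda>n. root n (onorm_on S (A ^^ n))) \<longlonglongrightarrow> spectral_radius_on S A"
proof -
  have AS: "A ` S \<subseteq> S" using bij by (simp add: bij_betw_def)
  note in_S = funpow_in[OF AS]
  have bdn: "norm ((A ^^ n) x) \<le> (max K 0) ^ n * norm x" if "x \<in> S" for n x
  proof (induction n)
    case (Suc n)
    have "norm (A ((A ^^ n) x)) \<le> max K 0 * norm ((A ^^ n) x)"
      by (rule order_trans[OF bd[OF in_S[OF that]]]) (intro mult_right_mono, auto)
    also have "\<dots> \<le> max K 0 * (max K 0 ^ n * norm x)" by (intro mult_left_mono Suc) auto
    finally show ?case by (simp add: mult.assoc)
  qed simp
  have bdd: "bdd_above ((\<lambda>x. norm ((A ^^ n) x) / norm x) ` S)" for n
  proof (intro bdd_aboveI2)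
    show "norm ((A ^^ n) x) / norm x \<le> (max K 0) ^ n" if "x \<in> S" for x
      using bdn[OF that, of n] by (cases "x = 0") (simp_all add: pos_divide_le_eq)
  qed
  have fix0: "(A ^^ n) 0 = 0" for n by (induction n) (simp_all add: zero)
  have upper: "norm ((A ^^ n) x) \<le> onorm_on S (A ^^ n) * norm x" if "x \<in> S" for n x
  proof (cases "x = 0")
    case False
    have "norm ((A ^^ n) x) / norm x \<le> onorm_on S (A ^^ n)"
      unfolding onorm_on_def by (rule cSUP_upper[OF that bdd])
    then show ?thesis using False by (simp add: pos_divide_le_eq)
  qed (simp add: fix0)
  obtain v where v: "v \<in> S" "v \<noteq> 0" using ne zero(1) by blast
  have pos: "0 < onorm_on S (A ^^ n)" for n
  proof -
    have "inj_on (A ^^ n) S"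
      using bij_betw_funpow[OF bij, of n] by (simp add: bij_betw_def)
    then have "(A ^^ n) v \<noteq> 0" using v zero(1) fix0[of n] inj_onD by metis
    then have "0 < norm ((A ^^ n) v) / norm v" using v(2) by simp
    also have "\<dots> \<le> onorm_on S (A ^^ n)" unfolding onorm_on_def by (rule cSUP_upper[OF v(1) bdd])
    finally show ?thesis .
  qed
  have sub: "onorm_on S (A ^^ (m + n)) \<le> onorm_on S (A ^^ m) * onorm_on S (A ^^ n)" for m n
    unfolding onorm_on_def[of S "A ^^ (m + n)"]
  proof (rule cSUP_least)
    fix x assume x: "x \<in> S"
    show "norm ((A ^^ (m + n)) x) / norm x \<le> onorm_on S (A ^^ m) * onorm_on S (A ^^ n)"
    proof (cases "x = 0")
      case False
      have "norm ((A ^^ (m + n)) x) \<le> onorm_on S (A ^^ m) * norm ((A ^^ n) x)"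
        using upper[OF in_S[OF x]] by (simp add: funpow_add)
      also have "\<dots> \<le> onorm_on S (A ^^ m) * (onorm_on S (A ^^ n) * norm x)"
        by (intro mult_left_mono upper[OF x] less_imp_le[OF pos])
      finally show ?thesis using False by (simp add: pos_divide_le_eq mult.assoc)
    qed (simp add: less_imp_le[OF pos])
  qed (use v in auto)
  show "0 < onorm_on S (A ^^ n)" by (rule pos)
  show "norm ((A ^^ n) x) \<le> onorm_on S (A ^^ n) * norm x" if "x \<in> S" by (rule upper[OF that])
  show "(\<lambda>n. root n (onorm_on S (A ^^ n))) \<longlonglongrightarrow> spectral_radius_on S A"
    unfolding spectral_radius_on_def
    using submultiplicative_root_convergent[of "\<lambda>n. onorm_on S (A ^^ n)", OF pos sub]
    by (rule convergent_LIMSEQ_iff[THEN iffD1])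
qed

lemma automorphism_on_iterates:
  fixes A :: "'a::banach \<Rightarrow> 'a"
  assumes A: "automorphism_on S A" and ne: "S \<noteq> {0}"
  defines "B \<equiv> inv_into S A"
  shows "0 < onorm_on S (A ^^ n)" "0 < onorm_on S (B ^^ n)"
    and "x \<in> S \<Longrightarrow> norm ((A ^^ n) x) \<le> onorm_on S (A ^^ n) * norm x"
    and "x \<in> S \<Longrightarrow> norm ((B ^^ n) x) \<le> onorm_on S (B ^^ n) * norm x"
    and "(\<lambda>n. root n (onorm_on S (A ^^ n))) \<longlonglongrightarrow> spectral_radius_on S A"
    and "(\<lambda>n. root n (onorm_on S (B ^^ n))) \<longlonglongrightarrow> spectral_radius_on S B"
proof -
  have S: "0 \<in> S" "bij_betw A S S" "bounded_linear_on S A" "bounded_linear_on S B"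
    using A by (auto simp: automorphism_on_def B_def subspace_0)
  have lin0: "C 0 = 0" if "bounded_linear_on S C" for C :: "'a \<Rightarrow> 'a"
    using that S(1) unfolding bounded_linear_on_def by (metis scale_zero_left)
  obtain K where K: "\<And>x. x \<in> S \<Longrightarrow> norm (A x) \<le> K * norm x" using S(3) unfolding bounded_linear_on_def by blast
  obtain K' where K': "\<And>x. x \<in> S \<Longrightarrow> norm (B x) \<le> K' * norm x" using S(4) unfolding bounded_linear_on_def by blast
  have B: "bij_betw B S S" unfolding B_def by (rule bij_betw_inv_into[OF S(2)])
  note 1 = onorm_on_iterates[OF S(2,1) lin0[OF S(3)] ne K] and 2 = onorm_on_iterates[OF B S(1) lin0[OF S(4)] ne K']
  show "0 < onorm_on S (A ^^ n)" "0 < onorm_on S (B ^^ n)" by (rule 1(1) 2(1); assumption)+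
  show "x \<in> S \<Longrightarrow> norm ((A ^^ n) x) \<le> onorm_on S (A ^^ n) * norm x" by (rule 1(2))
  show "x \<in> S \<Longrightarrow> norm ((B ^^ n) x) \<le> onorm_on S (B ^^ n) * norm x" by (rule 2(2))
  show "(\<lambda>n. root n (onorm_on S (A ^^ n))) \<longlonglongrightarrow> spectral_radius_on S A" by (rule 1(3))
  show "(\<lambda>n. root n (onorm_on S (B ^^ n))) \<longlonglongrightarrow> spectral_radius_on S B" by (rule 2(3))
qed

lemma tendsto_zero_from_root:
  fixes a :: "nat \<Rightarrow> real"
  assumes "\<And>n. 0 \<le> a n" "(\<lambda>n. root n (a n)) \<longlonglongrightarrow> \<rho>" "\<rho> < 1"
  shows "a \<longlonglongrightarrow> 0"
proof -
  have "0 \<le> \<rho>" using assms(1) by (intro LIMSEQ_le_const[OF assms(2)]) (auto simp: real_root_ge_zero)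
  obtain q where q: "\<rho> < q" "q < 1" using dense[OF assms(3)] by blast
  have "\<forall>\<^sub>F n in sequentially. root n (a n) < q" by (rule order_tendstoD(2)[OF assms(2) q(1)])
  with eventually_gt_at_top[of 0] have le: "\<forall>\<^sub>F n in sequentially. norm (a n) \<le> q ^ n"
  proof eventually_elim
    case (elim n)
    have "a n = root n (a n) ^ n" using elim assms(1) by simp
    also have "\<dots> \<le> q ^ n" using elim assms(1) by (intro power_mono) (auto simp: real_root_ge_zero)
    finally show ?case using assms(1) by simp
  qed
  have "(\<lambda>n. q ^ n) \<longlonglongrightarrow> 0" using q \<open>0 \<le> \<rho>\<close> by (intro LIMSEQ_realpow_zero) auto
  then show ?thesis by (rule Lim_null_comparison[OF le])
qed

lemma product_tendsto_zero_from_root: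
  fixes a b d :: "nat \<Rightarrow> real"
  assumes pos: "\<And>n. 0 < a n" "\<And>n. 0 < b n" "\<And>n. 0 < d n"
    and lim: "(\<lambda>n. root n (a n)) \<longlonglongrightarrow> x" "(\<lambda>n. root n (b n)) \<longlonglongrightarrow> y" "(\<lambda>n. root n (d n)) \<longlonglongrightarrow> z"
    and "0 < \<alpha>" and less: "x * y * z powr \<alpha> < 1"
  shows "(\<lambda>n. a n * b n * d n powr \<alpha>) \<longlonglongrightarrow> 0"
proof (rule tendsto_zero_from_root[OF _ _ less])
  show "0 \<le> a n * b n * d n powr \<alpha>" for n using pos[of n] by simp
  have "\<forall>\<^sub>F n in sequentially. root n (d n) powr \<alpha> = root n (d n powr \<alpha>)"
    using eventually_gt_at_top[of 0]
  proof eventually_elim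
    case (elim n)
    then show ?case using pos(3)[of n] by (simp add: root_powr_inverse powr_powr mult.commute)
  qed
  moreover have "(\<lambda>n. root n (d n) powr \<alpha>) \<longlonglongrightarrow> z powr \<alpha>"
    using pos(3) \<open>0 < \<alpha>\<close> by (intro tendsto_powr' lim tendsto_const) (auto simp: real_root_ge_zero less_imp_le)
  ultimately have "(\<lambda>n. root n (d n powr \<alpha>)) \<longlonglongrightarrow> z powr \<alpha>"
    by (rule Lim_transform_eventually[rotated])
  then show "(\<lambda>n. root n (a n * b n * d n powr \<alpha>)) \<longlonglongrightarrow> x * y * z powr \<alpha>"
    unfolding real_root_mult by (intro tendsto_mult lim)
qed

text \<open>
  A case of the open mapping theorem, by its usual proof. By Baire's theorem the points whose
  \<open>Eu\<close>-component \<open>p x\<close> is bounded by some \<open>n\<close> are dense in a ball. By differences and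
  scaling, every \<open>y\<close> is within \<open>norm y / 2\<close> of a point \<open>Z y\<close> with
  \<open>norm (p (Z y)) \<le> c * norm y\<close>. Repeating this with the remainders \<open>y - Z y\<close> writes \<open>x\<close> as a
  series whose components are summable, and by closedness of both subspaces their sum is
  \<open>p x\<close>.
\<close>

lemma bounded_projections:
  fixes Eu Es :: "'a::banach set"
  assumes u: "subspace Eu" "closed Eu" and s: "subspace Es" "closed Es"
    and "Eu \<inter> Es = {0}" and ex: "\<And>x. \<exists>u\<in>Eu. \<exists>s\<in>Es. x = u + s"
  obtains P Q :: "'a \<Rightarrow>\<^sub>L 'a" where "\<And>x. P x \<in> Eu" "\<And>x. Q x \<in> Es" "\<And>x. P x + Q x = x"
    "\<And>x. x \<in> Eu \<Longrightarrow> P x = x" "\<And>x. x \<in> Es \<Longrightarrow> P x = 0"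
proof -
  have uniq: "a = b" if "a \<in> Eu" "b \<in> Eu" "x - a \<in> Es" "x - b \<in> Es" for a b x
  proof -
    have "a - b \<in> Eu" using that u(1) by (simp add: subspace_diff)
    moreover have "(x - b) - (x - a) \<in> Es" by (rule subspace_diff[OF s(1) that(4,3)])
    ultimately have "a - b \<in> Eu \<inter> Es" by simp
    then show ?thesis using \<open>Eu \<inter> Es = {0}\<close> by simp
  qed
  define p where "p x = (SOME a. a \<in> Eu \<and> x - a \<in> Es)" for x
  have p: "p x \<in> Eu" "x - p x \<in> Es" for x
  proof -
    have "\<exists>a. a \<in> Eu \<and> x - a \<in> Es" using ex[of x] by (metis add_diff_cancel_left')
    then have "p x \<in> Eu \<and> x - p x \<in> Es" unfolding p_def by (rule someI_ex)
    then show "p x \<in> Eu" "x - p x \<in> Es" by auto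
  qed
  have p_eq: "p x = a" if "a \<in> Eu" "x - a \<in> Es" for x a using uniq[OF p(1) that(1) p(2) that(2)] .
  have p_add: "p (x + y) = p x + p y" for x y
  proof (rule p_eq)
    show "p x + p y \<in> Eu" using p u(1) by (intro subspace_add)
    have "(x - p x) + (y - p y) \<in> Es" using p s(1) by (intro subspace_add)
    then show "x + y - (p x + p y) \<in> Es" by (simp add: algebra_simps)
  qed
  have p_scale: "p (c *\<^sub>R x) = c *\<^sub>R p x" for c x
  proof (rule p_eq)
    show "c *\<^sub>R p x \<in> Eu" using p u(1) by (intro subspace_scale)
    have "c *\<^sub>R (x - p x) \<in> Es" using p s(1) by (intro subspace_scale)
    then show "c *\<^sub>R x - c *\<^sub>R p x \<in> Es" by (simp add: algebra_simps)
  qed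
  have lin: "linear p" by (rule linearI) (simp_all add: p_add p_scale)
  define A where "A n = {x. norm (p x) \<le> real n}" for n
  have "\<exists>n. interior (closure (A n)) \<noteq> {}"
  proof (rule ccontr)
    assume "\<not> ?thesis"
    then have "euclidean interior_of \<Union>(range (\<lambda>n. closure (A n))) = {}"
      by (intro Baire_category_alt) (auto simp: completely_metrizable_space_euclidean)
    moreover have "\<Union>(range (\<lambda>n. closure (A n))) = UNIV"
    proof -
      have "x \<in> closure (A (nat \<lceil>norm (p x)\<rceil>))" for x
        by (rule subsetD[OF closure_subset]) (auto simp: A_def of_nat_ceiling)
      then show ?thesis by blast
    qed
    ultimately show False by simp
  qed
  then obtain n x0 where "x0 \<in> interior (closure (A n))" by blast
  then obtain e where e: "e > 0" "ball x0 e \<subseteq> closure (A n)"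
    by (meson mem_interior)
  have approx: "\<exists>z. norm (p z) \<le> 2 * real n \<and> norm (y - z) < \<delta>" if "norm y < e" "\<delta> > 0" for y \<delta>
  proof -
    have "x0 + y \<in> closure (A n)" "x0 \<in> closure (A n)"
      using e \<open>norm y < e\<close> by (auto simp: subset_iff dist_norm)
    then obtain z1 z2 where z: "z1 \<in> A n" "dist z1 (x0 + y) < \<delta> / 2" "z2 \<in> A n" "dist z2 x0 < \<delta> / 2"
      using \<open>\<delta> > 0\<close> unfolding closure_approachable by (meson half_gt_zero)
    have "norm (p (z1 - z2)) \<le> norm (p z1) + norm (p z2)"
      using linear_diff[OF lin] norm_triangle_ineq4 by metis
    then have 1: "norm (p (z1 - z2)) \<le> 2 * real n" using z by (simp add: A_def)
    have "y - (z1 - z2) = (z2 - x0) - (z1 - (x0 + y))" by simp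
    then have "norm (y - (z1 - z2)) \<le> norm (z2 - x0) + norm (z1 - (x0 + y))"
      using norm_triangle_ineq4 by metis
    then have "norm (y - (z1 - z2)) < \<delta>" using z by (simp add: dist_norm)
    with 1 show ?thesis by blast
  qed
  \<comment> \<open>A vector \<open>y\<close> is scaled to length \<open>e / 2\<close> and approximated up to \<open>e / 4\<close> there.\<close>
  define c where "c = 4 * real n / e"
  have "0 \<le> c" using e by (simp add: c_def)
  have "\<exists>z. norm (p z) \<le> c * norm y \<and> norm (y - z) \<le> norm y / 2" for y
  proof (cases "y = 0")
    case True
    then show ?thesis using linear_0[OF lin] by (intro exI[of _ 0]) simp
  next
    case False
    define t where "t = 2 * norm y / e"
    have t: "t > 0" using False e by (simp add: t_def)
    have "norm (y /\<^sub>R t) < e" using False e t by (simp add: t_def)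
    moreover have "e / 4 > 0" using e by simp
    ultimately obtain z where z: "norm (p z) \<le> 2 * real n" "norm (y /\<^sub>R t - z) < e / 4"
      using approx by blast
    have "norm (p (t *\<^sub>R z)) \<le> t * (2 * real n)" using z(1) t by (simp add: p_scale)
    also have "\<dots> = c * norm y" by (simp add: t_def c_def)
    finally have 1: "norm (p (t *\<^sub>R z)) \<le> c * norm y" .
    have "y - t *\<^sub>R z = t *\<^sub>R (y /\<^sub>R t - z)" using t by (simp add: algebra_simps)
    then have "norm (y - t *\<^sub>R z) = t * norm (y /\<^sub>R t - z)" using t by simp
    also have "\<dots> \<le> t * (e / 4)" using z(2) t by (intro mult_left_mono) auto
    also have "\<dots> = norm y / 2" using e by (simp add: t_def)
    finally show ?thesis using 1 by blast
  qed
  then obtain Z where Z: "\<And>y. norm (p (Z y)) \<le> c * norm y" "\<And>y. norm (y - Z y) \<le> norm y / 2" by metis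
  have p_le: "norm (p x) \<le> norm x * (2 * c)" for x
  proof -
    define y where "y k = ((\<lambda>y. y - Z y) ^^ k) x" for k
    have y_le: "norm (y k) \<le> norm x * (1/2) ^ k" for k
    proof (induction k)
      case (Suc k)
      then show ?case using Z(2)[of "y k"] by (simp add: y_def)
    qed (simp add: y_def)
    have sumZ: "(\<Sum>k<N. Z (y k)) = x - y N" for N
      by (induction N) (simp_all add: y_def)
    have geo: "(\<lambda>k. c * norm x * (1/2::real) ^ k) sums (c * norm x * 2)"
      using geometric_sums[of "1/2::real"] by (intro sums_mult) auto
    have term_le: "norm (p (Z (y k))) \<le> c * norm x * (1/2) ^ k" for k
      using Z(1)[of "y k"] mult_left_mono[OF y_le[of k] \<open>0 \<le> c\<close>] by (simp add: mult.assoc)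
    have sm: "summable (\<lambda>k. p (Z (y k)))"
      by (rule summable_comparison_test'[OF sums_summable[OF geo] term_le])
    define v where "v = (\<Sum>k. p (Z (y k)))"
    have lim: "(\<lambda>N. p (x - y N)) \<longlonglongrightarrow> v"
      using summable_LIMSEQ[OF sm] unfolding v_def by (simp add: linear_sum[OF lin, symmetric] sumZ)
    have "(\<lambda>k. norm x * (1/2::real) ^ k) \<longlonglongrightarrow> norm x * 0" by (intro tendsto_intros) auto
    then have "(\<lambda>k. norm x * (1/2::real) ^ k) \<longlonglongrightarrow> 0" by simp
    then have "y \<longlonglongrightarrow> 0" by (rule Lim_null_comparison[rotated]) (simp add: y_le)
    then have "(\<lambda>N. x - y N) \<longlonglongrightarrow> x - 0" by (intro tendsto_intros)
    then have lim': "(\<lambda>N. (x - y N) - p (x - y N)) \<longlonglongrightarrow> x - v" using lim by (intro tendsto_diff) auto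
    have "v \<in> Eu" by (rule Lim_in_closed_set[OF u(2) _ _ lim]) (use p in auto)
    moreover have "x - v \<in> Es" by (rule Lim_in_closed_set[OF s(2) _ _ lim']) (use p in auto)
    ultimately have "p x = v" by (rule p_eq)
    also have "norm v \<le> (\<Sum>k. c * norm x * (1/2) ^ k)"
      unfolding v_def by (rule norm_suminf_le[OF term_le sums_summable[OF geo]])
    also have "\<dots> = c * norm x * 2" using geo by (rule sums_unique[symmetric])
    finally show ?thesis by (simp add: mult_ac)
  qed
  have "bounded_linear p" by (rule bounded_linear_intro[OF p_add p_scale p_le])
  then have P: "blinfun_apply (Blinfun p) = p" by (rule bounded_linear_Blinfun_apply)
  have "p x = x" if "x \<in> Eu" for x using that s(1) by (intro p_eq) (simp_all add: subspace_0)
  moreover have "p x = 0" if "x \<in> Es" for x using that u(1) by (intro p_eq) (simp_all add: subspace_0)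
  ultimately show ?thesis
    using that[of "Blinfun p" "id_blinfun - Blinfun p"] p by (simp add: P blinfun.diff_left)
qed

lemma inv_into_invariant_funpow:
  assumes "bij_betw A S S" "inj A" "x \<in> S"
  shows "(inv_into S A ^^ n) x = (inv A ^^ n) x"
proof -
  have "(inv_into S A ^^ n) x \<in> S \<and> (inv_into S A ^^ n) x = (inv A ^^ n) x"
  proof (induction n)
    case (Suc n)
    let ?y = "(inv A ^^ n) x"
    have "?y \<in> S" using Suc by auto
    then have y: "?y \<in> A ` S" using assms(1) by (simp add: bij_betw_def)
    then have "inv_into S A ?y \<in> S" "A (inv_into S A ?y) = ?y" by (auto intro: inv_into_into f_inv_into_f)
    then have "inv_into S A ?y = inv A ?y" using assms(2) by (metis inv_f_f)
    then show ?case using Suc \<open>inv_into S A ?y \<in> S\<close> by simp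
  qed (use assms in simp)
  then show ?thesis by blast
qed

lemma norm_blinfun_compose_projection:
  fixes A :: "'b::real_normed_vector \<Rightarrow>\<^sub>L 'c::real_normed_vector" and P :: "'a::real_normed_vector \<Rightarrow>\<^sub>L 'b"
  assumes "\<And>x. P x \<in> S" "\<And>x. x \<in> S \<Longrightarrow> norm (blinfun_apply A x) \<le> c * norm x" "0 \<le> c"
  shows "norm (A o\<^sub>L P) \<le> c * norm P"
proof (rule norm_blinfun_bound)
  show "norm ((A o\<^sub>L P) x) \<le> c * norm P * norm x" for x
  proof -
    have "norm (A (P x)) \<le> c * norm (P x)" by (rule assms(2)[OF assms(1)])
    also have "\<dots> \<le> c * (norm P * norm x)" by (intro mult_left_mono norm_blinfun assms(3))
    finally show ?thesis by (simp add: mult.assoc)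
  qed
qed (use assms(3) in simp)

text \<open>
  All quantities are bounded, up to constants that come from the norms of the projections, by
  products of norms of powers of \<open>A\<close> and of its inverse on \<open>Eu\<close> and \<open>Es\<close>, and these products
  tend to \<open>0\<close> because their \<open>n\<close>-th roots have limits below \<open>1\<close>.
\<close>

lemma alpha_hyperbolic_iterate:
  fixes A :: "'a::banach \<Rightarrow>\<^sub>L 'a"
  assumes hyp: "alpha_hyperbolic \<alpha> (blinfun_apply A)" and "0 < \<alpha>" and \<epsilon>: "0 < \<epsilon>"
  obtains B P Q :: "'a \<Rightarrow>\<^sub>L 'a" and m :: nat where "0 < m"
    "\<And>x. A (B x) = x" "\<And>x. B (A x) = x"
    "\<And>x. P x + Q x = x" "\<And>x. P (P x) = P x" "\<And>x. Q (Q x) = Q x"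
    "\<And>x. P (A x) = A (P x)" "\<And>x. Q (A x) = A (Q x)" "\<exists>v::'a. v \<noteq> 0"
    "norm (blinfun_power B m o\<^sub>L P) \<le> \<epsilon>" "norm (blinfun_power A m o\<^sub>L Q) \<le> \<epsilon>"
    "norm (blinfun_power A m) * (norm (blinfun_power B m o\<^sub>L P) powr \<alpha> * norm (blinfun_power B m o\<^sub>L P)) \<le> \<epsilon>"
    "norm (blinfun_power B m) * (norm (blinfun_power A m o\<^sub>L Q) powr \<alpha> * norm (blinfun_power A m o\<^sub>L Q)) \<le> \<epsilon>"
    "norm (blinfun_power B m o\<^sub>L P) * (norm (blinfun_power A m o\<^sub>L P) * norm (blinfun_power A m o\<^sub>L Q) powr \<alpha>) \<le> \<epsilon>"
    "norm (blinfun_power A m o\<^sub>L Q) * (norm (blinfun_power B m o\<^sub>L Q) * norm (blinfun_power B m o\<^sub>L P) powr \<alpha>) \<le> \<epsilon>"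
proof -
  define L where "L = blinfun_apply A"
  have A: "blinfun_apply A = L" by (simp add: L_def)
  obtain Eu Es where aut: "automorphism_on UNIV L" and split: "saddle_splitting L Eu Es"
    and cond: "max (spectral_condition_on Eu L) (spectral_condition_on Es L) *
        max (spectral_radius_on Eu (inv_into Eu L)) (spectral_radius_on Es L) powr \<alpha> < 1"
    using hyp unfolding A alpha_hyperbolic_def by blast
  have sp: "subspace Eu" "closed Eu" "Eu \<noteq> {0}" "subspace Es" "closed Es" "Es \<noteq> {0}" "Eu \<inter> Es = {0}"
    "\<And>x. \<exists>u\<in>Eu. \<exists>s\<in>Es. x = u + s" "L ` Eu \<subseteq> Eu" "L ` Es \<subseteq> Es"
    "automorphism_on Eu L" "spectral_radius_on Eu (inv_into Eu L) < 1"
    "automorphism_on Es L" "spectral_radius_on Es L < 1"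
    using split unfolding saddle_splitting_def expanding_on_def contracting_on_def by blast+
  have nontrivial: "\<exists>v::'a. v \<noteq> 0" using sp(3) subspace_0[OF sp(1)] by blast
  have "bij L" using aut by (simp add: automorphism_on_def)
  have "bounded_linear (inv L)"
  proof -
    have b: "bounded_linear_on UNIV (inv L)" using aut by (simp add: automorphism_on_def)
    then obtain K where "\<And>x. norm (inv L x) \<le> K * norm x" unfolding bounded_linear_on_def by blast
    then show ?thesis
      using b by (intro bounded_linear_intro[of _ K]) (auto simp: bounded_linear_on_def mult.commute)
  qed
  define B where "B = Blinfun (inv L)"
  have B: "blinfun_apply B = inv L"
    unfolding B_def by (rule bounded_linear_Blinfun_apply[OF \<open>bounded_linear (inv L)\<close>])
  have AB: "A (B x) = x" "B (A x) = x" for x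
    using \<open>bij L\<close> by (simp_all add: A B bij_is_inj bij_is_surj surj_f_inv_f)
  obtain P Q :: "'a \<Rightarrow>\<^sub>L 'a" where PQ: "\<And>x. P x \<in> Eu" "\<And>x. Q x \<in> Es" "\<And>x. P x + Q x = x"
    "\<And>x. x \<in> Eu \<Longrightarrow> P x = x" "\<And>x. x \<in> Es \<Longrightarrow> P x = 0"
    using bounded_projections[OF sp(1,2,4,5,7,8)] by blast
  have PP: "P (P x) = P x" for x using PQ(1,4) by blast
  have PA: "P (A x) = A (P x)" for x
  proof -
    have "A (P x) \<in> Eu" "A (Q x) \<in> Es" using PQ(1,2) sp(9,10) A by auto
    then have "P (A (P x) + A (Q x)) = A (P x)" using PQ(4,5) by (simp add: blinfun.add_right)
    then show ?thesis by (simp add: PQ(3) flip: blinfun.add_right)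
  qed
  have Q: "Q x = x - P x" for x using PQ(3)[of x] by (simp add: algebra_simps)
  have bij: "bij_betw L Eu Eu" "bij_betw L Es Es" using sp(11,13) by (auto simp: automorphism_on_def)
  define u where "u n = onorm_on Eu (L ^^ n)" for n
  define u' where "u' n = onorm_on Eu (inv_into Eu L ^^ n)" for n
  define s where "s n = onorm_on Es (L ^^ n)" for n
  define s' where "s' n = onorm_on Es (inv_into Es L ^^ n)" for n
  note U = automorphism_on_iterates[OF sp(11,3), folded u_def u'_def]
  note S = automorphism_on_iterates[OF sp(13,6), folded s_def s'_def]
  let ?ru = "spectral_radius_on Eu L" and ?ru' = "spectral_radius_on Eu (inv_into Eu L)"
  let ?rs = "spectral_radius_on Es L" and ?rs' = "spectral_radius_on Es (inv_into Es L)"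
  have rad0: "0 \<le> ?ru" "0 \<le> ?ru'" "0 \<le> ?rs" "0 \<le> ?rs'"
  proof -
    have root0: "0 \<le> root n (u n)" "0 \<le> root n (u' n)" "0 \<le> root n (s n)" "0 \<le> root n (s' n)" for n
      using U(1,2)[of n] S(1,2)[of n] by (simp_all add: real_root_ge_zero less_imp_le)
    show "0 \<le> ?ru" by (rule LIMSEQ_le_const[OF U(5)]) (use root0 in blast)
    show "0 \<le> ?ru'" by (rule LIMSEQ_le_const[OF U(6)]) (use root0 in blast)
    show "0 \<le> ?rs" by (rule LIMSEQ_le_const[OF S(5)]) (use root0 in blast)
    show "0 \<le> ?rs'" by (rule LIMSEQ_le_const[OF S(6)]) (use root0 in blast)
  qed
  have less1: "x * y * z powr \<alpha> < 1"
    if "x * y \<le> max (spectral_condition_on Eu L) (spectral_condition_on Es L)" "0 \<le> x * y" "0 \<le> z" "z \<le> max ?ru' ?rs" for x y z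
  proof -
    have "x * y * z powr \<alpha> \<le> max (spectral_condition_on Eu L) (spectral_condition_on Es L) * max ?ru' ?rs powr \<alpha>"
      using that \<open>0 < \<alpha>\<close> by (intro mult_mono powr_mono2) auto
    then show ?thesis using cond by linarith
  qed
  have cu: "?ru * ?ru' \<le> max (spectral_condition_on Eu L) (spectral_condition_on Es L)"
    and cs: "?rs * ?rs' \<le> max (spectral_condition_on Eu L) (spectral_condition_on Es L)"
    by (auto simp: spectral_condition_on_def)
  have lim1: "(\<lambda>n. u n * u' n * u' n powr \<alpha>) \<longlonglongrightarrow> 0"
    by (rule product_tendsto_zero_from_root[OF U(1,2,2,5,6,6) \<open>0 < \<alpha>\<close> less1[OF cu]]) (use rad0 in auto)
  have lim2: "(\<lambda>n. u n * u' n * s n powr \<alpha>) \<longlonglongrightarrow> 0"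
    by (rule product_tendsto_zero_from_root[OF U(1,2) S(1) U(5,6) S(5) \<open>0 < \<alpha>\<close> less1[OF cu]]) (use rad0 in auto)
  have lim3: "(\<lambda>n. s n * s' n * s n powr \<alpha>) \<longlonglongrightarrow> 0"
    by (rule product_tendsto_zero_from_root[OF S(1,2,1,5,6,5) \<open>0 < \<alpha>\<close> less1[OF cs]]) (use rad0 in auto)
  have lim4: "(\<lambda>n. s n * s' n * u' n powr \<alpha>) \<longlonglongrightarrow> 0"
    by (rule product_tendsto_zero_from_root[OF S(1,2) U(2) S(5,6) U(6) \<open>0 < \<alpha>\<close> less1[OF cs]]) (use rad0 in auto)
  have lim5: "u' \<longlonglongrightarrow> 0" by (rule tendsto_zero_from_root[OF less_imp_le[OF U(2)] U(6) sp(12)])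
  have lim6: "s \<longlonglongrightarrow> 0" by (rule tendsto_zero_from_root[OF less_imp_le[OF S(1)] S(5) sp(14)])
  have lim5': "(\<lambda>n. u' n powr \<alpha>) \<longlonglongrightarrow> 0"
    using tendsto_powr'[OF lim5 tendsto_const, of \<alpha>] \<open>0 < \<alpha>\<close> U(2) by (simp add: less_imp_le)
  have lim6': "(\<lambda>n. s n powr \<alpha>) \<longlonglongrightarrow> 0"
    using tendsto_powr'[OF lim6 tendsto_const, of \<alpha>] \<open>0 < \<alpha>\<close> S(1) by (simp add: less_imp_le)
  \<comment> \<open>Restricting a power of \<open>L\<close> to a subspace and composing it with the projection costs at most \<open>c\<close>.\<close>
  define c where "c = max (max (norm P) (norm Q)) 1"
  have c: "norm P \<le> c" "norm Q \<le> c" "0 \<le> c" by (auto simp: c_def)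
  have pos: "0 \<le> u n" "0 \<le> u' n" "0 \<le> s n" "0 \<le> s' n" for n
    using U(1,2)[of n] S(1,2)[of n] by simp_all
  have nAP: "norm (blinfun_power A n o\<^sub>L P) \<le> c * u n" for n
  proof -
    have "norm (blinfun_power A n o\<^sub>L P) \<le> u n * norm P"
      by (rule norm_blinfun_compose_projection[OF PQ(1) _ pos(1)]) (simp add: blinfun_power_apply A U(3))
    also have "\<dots> \<le> u n * c" using pos c by (intro mult_left_mono)
    finally show ?thesis by (simp add: mult.commute)
  qed
  have nAQ: "norm (blinfun_power A n o\<^sub>L Q) \<le> c * s n" for n
  proof -
    have "norm (blinfun_power A n o\<^sub>L Q) \<le> s n * norm Q"
      by (rule norm_blinfun_compose_projection[OF PQ(2) _ pos(3)]) (simp add: blinfun_power_apply A S(3))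
    also have "\<dots> \<le> s n * c" using pos c by (intro mult_left_mono)
    finally show ?thesis by (simp add: mult.commute)
  qed
  have nBP: "norm (blinfun_power B n o\<^sub>L P) \<le> c * u' n" for n
  proof -
    have "norm (blinfun_power B n o\<^sub>L P) \<le> u' n * norm P"
      by (rule norm_blinfun_compose_projection[OF PQ(1) _ pos(2)])
         (simp add: blinfun_power_apply B U(4) flip: inv_into_invariant_funpow[OF bij(1) bij_is_inj[OF \<open>bij L\<close>]])
    also have "\<dots> \<le> u' n * c" using pos c by (intro mult_left_mono)
    finally show ?thesis by (simp add: mult.commute)
  qed
  have nBQ: "norm (blinfun_power B n o\<^sub>L Q) \<le> c * s' n" for n
  proof -
    have "norm (blinfun_power B n o\<^sub>L Q) \<le> s' n * norm Q"
      by (rule norm_blinfun_compose_projection[OF PQ(2) _ pos(4)])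
         (simp add: blinfun_power_apply B S(4) flip: inv_into_invariant_funpow[OF bij(2) bij_is_inj[OF \<open>bij L\<close>]])
    also have "\<dots> \<le> s' n * c" using pos c by (intro mult_left_mono)
    finally show ?thesis by (simp add: mult.commute)
  qed
  have nsplit: "norm X \<le> norm (X o\<^sub>L P) + norm (X o\<^sub>L Q)" for X :: "'a \<Rightarrow>\<^sub>L 'a"
  proof -
    have "X = (X o\<^sub>L P) + (X o\<^sub>L Q)"
      by (intro blinfun_eqI) (simp add: blinfun.bilinear_simps PQ(3) flip: blinfun.add_right)
    then show ?thesis by (metis norm_triangle_ineq)
  qed
  have nA: "norm (blinfun_power A n) \<le> c * u n + c * s n" for n
    using nsplit[of "blinfun_power A n"] nAP[of n] nAQ[of n] by linarith
  have nB: "norm (blinfun_power B n) \<le> c * u' n + c * s' n" for n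
    using nsplit[of "blinfun_power B n"] nBP[of n] nBQ[of n] by linarith
  have pw: "x powr \<alpha> \<le> c powr \<alpha> * y powr \<alpha>" if "0 \<le> x" "x \<le> c * y" "0 \<le> y" for x y
    using powr_mono2[of \<alpha> x "c * y"] that c \<open>0 < \<alpha>\<close> by (simp add: powr_mult)
  have E1: "\<forall>\<^sub>F n in sequentially. c * u' n < \<epsilon>"
    by (rule order_tendstoD(2)[OF tendsto_mult_right_zero[OF lim5] \<epsilon>])
  have E2: "\<forall>\<^sub>F n in sequentially. c * s n < \<epsilon>"
    by (rule order_tendstoD(2)[OF tendsto_mult_right_zero[OF lim6] \<epsilon>])
  have E3: "\<forall>\<^sub>F n in sequentially. (c * u n + c * s n) * (c powr \<alpha> * u' n powr \<alpha> * (c * u' n)) < \<epsilon>"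
  proof -
    have "(\<lambda>n. c * c powr \<alpha> * c * (u n * u' n * u' n powr \<alpha> + s n * (u' n powr \<alpha> * u' n)))
        \<longlonglongrightarrow> c * c powr \<alpha> * c * (0 + 0 * (0 * 0))"
      by (intro tendsto_intros lim1 lim6 lim5' lim5)
    then show ?thesis using order_tendstoD(2)[OF _ \<epsilon>] by (simp add: algebra_simps)
  qed
  have E4: "\<forall>\<^sub>F n in sequentially. (c * u' n + c * s' n) * (c powr \<alpha> * s n powr \<alpha> * (c * s n)) < \<epsilon>"
  proof -
    have "(\<lambda>n. c * c powr \<alpha> * c * (s n * s' n * s n powr \<alpha> + u' n * (s n powr \<alpha> * s n)))
        \<longlonglongrightarrow> c * c powr \<alpha> * c * (0 + 0 * (0 * 0))"
      by (intro tendsto_intros lim3 lim5 lim6' lim6)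
    then show ?thesis using order_tendstoD(2)[OF _ \<epsilon>] by (simp add: algebra_simps)
  qed
  have E5: "\<forall>\<^sub>F n in sequentially. c * u' n * (c * u n * (c powr \<alpha> * s n powr \<alpha>)) < \<epsilon>"
  proof -
    have "(\<lambda>n. c * c * c powr \<alpha> * (u n * u' n * s n powr \<alpha>)) \<longlonglongrightarrow> c * c * c powr \<alpha> * 0"
      by (intro tendsto_intros lim2)
    then show ?thesis using order_tendstoD(2)[OF _ \<epsilon>] by (simp add: algebra_simps)
  qed
  have E6: "\<forall>\<^sub>F n in sequentially. c * s n * (c * s' n * (c powr \<alpha> * u' n powr \<alpha>)) < \<epsilon>"
  proof -
    have "(\<lambda>n. c * c * c powr \<alpha> * (s n * s' n * u' n powr \<alpha>)) \<longlonglongrightarrow> c * c * c powr \<alpha> * 0"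
      by (intro tendsto_intros lim4)
    then show ?thesis using order_tendstoD(2)[OF _ \<epsilon>] by (simp add: algebra_simps)
  qed
  have "\<forall>\<^sub>F n in sequentially. 0 < n \<and> c * u' n < \<epsilon> \<and> c * s n < \<epsilon>
      \<and> (c * u n + c * s n) * (c powr \<alpha> * u' n powr \<alpha> * (c * u' n)) < \<epsilon>
      \<and> (c * u' n + c * s' n) * (c powr \<alpha> * s n powr \<alpha> * (c * s n)) < \<epsilon>
      \<and> c * u' n * (c * u n * (c powr \<alpha> * s n powr \<alpha>)) < \<epsilon>
      \<and> c * s n * (c * s' n * (c powr \<alpha> * u' n powr \<alpha>)) < \<epsilon>"
    by (intro eventually_conj E1 E2 E3 E4 E5 E6 eventually_gt_at_top)
  then obtain m where m: "0 < m" "c * u' m < \<epsilon>" "c * s m < \<epsilon>"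
    "(c * u m + c * s m) * (c powr \<alpha> * u' m powr \<alpha> * (c * u' m)) < \<epsilon>"
    "(c * u' m + c * s' m) * (c powr \<alpha> * s m powr \<alpha> * (c * s m)) < \<epsilon>"
    "c * u' m * (c * u m * (c powr \<alpha> * s m powr \<alpha>)) < \<epsilon>"
    "c * s m * (c * s' m * (c powr \<alpha> * u' m powr \<alpha>)) < \<epsilon>"
    using eventually_happens'[OF sequentially_bot] by blast
  have nonneg: "0 \<le> c * u m" "0 \<le> c * u' m" "0 \<le> c * s m" "0 \<le> c * s' m"
    using pos c by simp_all
  note pBP = pw[OF norm_ge_zero nBP pos(2), of m] and pAQ = pw[OF norm_ge_zero nAQ pos(3), of m]
  show ?thesis
  proof (rule that[of m B P Q])
    show "norm (blinfun_power B m o\<^sub>L P) \<le> \<epsilon>" using nBP[of m] m(2) by linarith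
    show "norm (blinfun_power A m o\<^sub>L Q) \<le> \<epsilon>" using nAQ[of m] m(3) by linarith
    have "norm (blinfun_power A m) * (norm (blinfun_power B m o\<^sub>L P) powr \<alpha> * norm (blinfun_power B m o\<^sub>L P))
        \<le> (c * u m + c * s m) * (c powr \<alpha> * u' m powr \<alpha> * (c * u' m))"
      using nonneg by (intro mult_mono nA pBP nBP) auto
    then show "norm (blinfun_power A m) * (norm (blinfun_power B m o\<^sub>L P) powr \<alpha> * norm (blinfun_power B m o\<^sub>L P)) \<le> \<epsilon>"
      using m(4) by linarith
    have "norm (blinfun_power B m) * (norm (blinfun_power A m o\<^sub>L Q) powr \<alpha> * norm (blinfun_power A m o\<^sub>L Q))
        \<le> (c * u' m + c * s' m) * (c powr \<alpha> * s m powr \<alpha> * (c * s m))"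
      using nonneg by (intro mult_mono nB pAQ nAQ) auto
    then show "norm (blinfun_power B m) * (norm (blinfun_power A m o\<^sub>L Q) powr \<alpha> * norm (blinfun_power A m o\<^sub>L Q)) \<le> \<epsilon>"
      using m(5) by linarith
    have "norm (blinfun_power B m o\<^sub>L P) * (norm (blinfun_power A m o\<^sub>L P) * norm (blinfun_power A m o\<^sub>L Q) powr \<alpha>)
        \<le> c * u' m * (c * u m * (c powr \<alpha> * s m powr \<alpha>))"
      using nonneg by (intro mult_mono nBP nAP pAQ) auto
    then show "norm (blinfun_power B m o\<^sub>L P) * (norm (blinfun_power A m o\<^sub>L P) * norm (blinfun_power A m o\<^sub>L Q) powr \<alpha>) \<le> \<epsilon>"
      using m(6) by linarith
    have "norm (blinfun_power A m o\<^sub>L Q) * (norm (blinfun_power B m o\<^sub>L Q) * norm (blinfun_power B m o\<^sub>L P) powr \<alpha>)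
        \<le> c * s m * (c * s' m * (c powr \<alpha> * u' m powr \<alpha>))"
      using nonneg by (intro mult_mono nAQ nBQ pBP) auto
    then show "norm (blinfun_power A m o\<^sub>L Q) * (norm (blinfun_power B m o\<^sub>L Q) * norm (blinfun_power B m o\<^sub>L P) powr \<alpha>) \<le> \<epsilon>"
      using m(7) by linarith
    show "Q (Q x) = Q x" for x by (simp add: Q PP blinfun.diff_right)
    show "Q (A x) = A (Q x)" for x by (simp add: Q PA blinfun.diff_right)
  qed (use m(1) A AB PQ(3) PP PA nontrivial in auto)
qed

section \<open>Linearization of \<open>\<alpha>\<close>-hyperbolic maps\<close>

text \<open>
  The average of the germs \<open>B\<^sup>k \<circ> R \<circ> T\<^sup>k\<close> for \<open>k < m\<close>: applying \<open>B\<close> after and \<open>T\<close> before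
  shifts the index by one, and the conjugacy for the \<open>m\<close>-th iterate says that the last term
  becomes the first.
\<close>

lemma conjugacy_from_iterate:
  fixes T R :: "'a::real_normed_vector \<Rightarrow> 'a" and A B :: "'a \<Rightarrow>\<^sub>L 'a"
  assumes T: "C1_germ \<gamma> T A" and R: "C1_germ \<gamma> R id_blinfun" and "0 < \<gamma>" "0 < m"
    and AB: "\<And>x. A (B x) = x" "\<And>x. B (A x) = x"
    and conj: "\<forall>\<^sub>F x in nhds 0. R ((T ^^ m) x) = blinfun_power A m (R x)"
  obtains R' where "C1_germ \<gamma> R' id_blinfun" "\<forall>\<^sub>F x in nhds 0. R' (T x) = A (R' x)"
proof -
  define W where "W N x = (\<Sum>k<N. (blinfun_apply B ^^ k) (R ((T ^^ k) x)))" for N x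
  have inv_pow: "(blinfun_apply B ^^ k) ((blinfun_apply A ^^ k) x) = x" for k x
    by (induction k arbitrary: x) (simp_all add: funpow_swap1 AB)
  have "C1_germ \<gamma> (W N) (real N *\<^sub>R id_blinfun)" for N
  proof (induction N)
    case 0
    have "W 0 = blinfun_apply 0" by (simp add: W_def fun_eq_iff)
    then show ?case using C1_germ_linear[of \<gamma> "0 :: 'a \<Rightarrow>\<^sub>L 'a"] by (simp only: of_nat_0 scaleR_zero_left)
  next
    case (Suc N)
    have "C1_germ \<gamma> (blinfun_apply (blinfun_power B N) \<circ> (R \<circ> (T ^^ N)))
        (blinfun_power B N o\<^sub>L (id_blinfun o\<^sub>L blinfun_power A N))"
      by (intro C1_germ_compose C1_germ_linear C1_germ_funpow T R \<open>0 < \<gamma>\<close>)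
    moreover have "blinfun_power B N o\<^sub>L (id_blinfun o\<^sub>L blinfun_power A N) = id_blinfun"
      by (intro blinfun_eqI) (simp add: blinfun_power_apply inv_pow)
    ultimately have "C1_germ \<gamma> (\<lambda>x. W N x + (blinfun_apply (blinfun_power B N) \<circ> (R \<circ> (T ^^ N))) x)
        (real N *\<^sub>R id_blinfun + id_blinfun)"
      using C1_germ_add[OF Suc.IH] by metis
    moreover have "(\<lambda>x. W N x + (blinfun_apply (blinfun_power B N) \<circ> (R \<circ> (T ^^ N))) x) = W (Suc N)"
      by (simp add: W_def fun_eq_iff blinfun_power_apply)
    moreover have "real N *\<^sub>R id_blinfun + id_blinfun = real (Suc N) *\<^sub>R (id_blinfun :: 'a \<Rightarrow>\<^sub>L 'a)"
      by (simp add: algebra_simps)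
    ultimately show ?case by simp
  qed
  from C1_germ_compose[OF this[of m] C1_germ_linear[of \<gamma> "(1 / real m) *\<^sub>R id_blinfun"] \<open>0 < \<gamma>\<close>]
  have "C1_germ \<gamma> (blinfun_apply ((1 / real m) *\<^sub>R id_blinfun) \<circ> W m)
      ((1 / real m) *\<^sub>R id_blinfun o\<^sub>L real m *\<^sub>R id_blinfun)" .
  moreover have "(1 / real m) *\<^sub>R id_blinfun o\<^sub>L real m *\<^sub>R id_blinfun = (id_blinfun :: 'a \<Rightarrow>\<^sub>L 'a)"
    using \<open>0 < m\<close> by (intro blinfun_eqI) (simp add: blinfun.bilinear_simps)
  ultimately have germ: "C1_germ \<gamma> (blinfun_apply ((1 / real m) *\<^sub>R id_blinfun) \<circ> W m) id_blinfun"
    by simp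
  have "\<forall>\<^sub>F x in nhds 0. W m (T x) = A (W m x)"
    using conj
  proof eventually_elim
    case (elim x)
    let ?t = "\<lambda>k. (blinfun_apply B ^^ k) (R ((T ^^ k) x))"
    have "B (W m (T x)) = (\<Sum>k<m. ?t (Suc k))"
      by (simp add: W_def blinfun.sum_right funpow_swap1)
    also have "\<dots> + ?t 0 = (\<Sum>k<Suc m. ?t k)"
      by (simp only: sum.lessThan_Suc_shift add.commute)
    also have "\<dots> = W m x + ?t m" by (simp add: W_def)
    also have "?t m = ?t 0" using elim by (simp add: blinfun_power_apply inv_pow)
    finally have "B (W m (T x)) = W m x" by simp
    then show ?case using AB(1) by metis
  qed
  then have "\<forall>\<^sub>F x in nhds 0. (blinfun_apply ((1 / real m) *\<^sub>R id_blinfun) \<circ> W m) (T x)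
      = A ((blinfun_apply ((1 / real m) *\<^sub>R id_blinfun) \<circ> W m) x)"
    by eventually_elim (simp add: blinfun.bilinear_simps)
  with germ show ?thesis using that by blast
qed

text \<open>
  The semiconjugacy for the expanding directions is applied to a high iterate of \<open>T\<close> and,
  with \<open>P\<close> and \<open>Q\<close> exchanged, to the local inverse of this iterate.
\<close>

lemma alpha_hyperbolic_germ_linearization:
  fixes T :: "'a::banach \<Rightarrow> 'a" and A :: "'a \<Rightarrow>\<^sub>L 'a"
  assumes bump: "C1_holder_banach_space \<alpha> TYPE('a)" and "0 < \<alpha>" "\<alpha> \<le> 1"
    and T: "C1_germ \<alpha> T A" and hyp: "alpha_hyperbolic \<alpha> (blinfun_apply A)"
  shows "\<exists>\<beta> R. 0 < \<beta> \<and> \<beta> < \<alpha> \<and> C1_germ \<beta> R id_blinfun \<and> (\<forall>\<^sub>F x in nhds 0. R (T x) = A (R x))"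
proof (rule alpha_hyperbolic_iterate[OF hyp \<open>0 < \<alpha>\<close>])
  show "(0::real) < 1/8" by simp
  fix B P Q :: "'a \<Rightarrow>\<^sub>L 'a" and m :: nat
  assume m: "0 < m"
    and AB: "\<And>x. A (B x) = x" "\<And>x. B (A x) = x"
    and PQ: "\<And>x. P x + Q x = x" "\<And>x. P (P x) = P x" "\<And>x. Q (Q x) = Q x"
    "\<And>x. P (A x) = A (P x)" "\<And>x. Q (A x) = A (Q x)" "\<exists>v::'a. v \<noteq> 0"
    and small: "norm (blinfun_power B m o\<^sub>L P) \<le> 1/8" "norm (blinfun_power A m o\<^sub>L Q) \<le> 1/8"
    "norm (blinfun_power A m) * (norm (blinfun_power B m o\<^sub>L P) powr \<alpha> * norm (blinfun_power B m o\<^sub>L P)) \<le> 1/8"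
    "norm (blinfun_power B m) * (norm (blinfun_power A m o\<^sub>L Q) powr \<alpha> * norm (blinfun_power A m o\<^sub>L Q)) \<le> 1/8"
    "norm (blinfun_power B m o\<^sub>L P) * (norm (blinfun_power A m o\<^sub>L P) * norm (blinfun_power A m o\<^sub>L Q) powr \<alpha>) \<le> 1/8"
    "norm (blinfun_power A m o\<^sub>L Q) * (norm (blinfun_power B m o\<^sub>L Q) * norm (blinfun_power B m o\<^sub>L P) powr \<alpha>) \<le> 1/8"
  let ?A = "blinfun_power A m" and ?B = "blinfun_power B m"
  have pow_inv: "(blinfun_apply B ^^ m) ((blinfun_apply A ^^ m) x) = x" "(blinfun_apply A ^^ m) ((blinfun_apply B ^^ m) x) = x" for x
    by (induction m arbitrary: x) (simp_all add: funpow_swap1 AB)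
  have AB_m: "?A (?B x) = x" "?B (?A x) = x" for x
    using pow_inv by (simp_all add: blinfun_power_apply)
  have PB: "P (B x) = B (P x)" "Q (B x) = B (Q x)" for x
    using PQ(4,5) AB by metis+
  have "P ((blinfun_apply A ^^ m) x) = (blinfun_apply A ^^ m) (P x)" "Q ((blinfun_apply B ^^ m) x) = (blinfun_apply B ^^ m) (Q x)" for x
    by (induction m) (simp_all add: PQ PB)
  then have comm: "P (?A x) = ?A (P x)" "Q (?B x) = ?B (Q x)" for x by (simp_all add: blinfun_power_apply)
  have Tm: "C1_germ \<alpha> (T ^^ m) ?A" by (rule C1_germ_funpow[OF T \<open>0 < \<alpha>\<close>])
  have "?B o\<^sub>L ?A = id_blinfun" "?A o\<^sub>L ?B = id_blinfun" by (intro blinfun_eqI; simp add: AB_m)+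
  then obtain G where G: "C1_germ \<alpha> G ?B" "\<forall>\<^sub>F x in nhds 0. G ((T ^^ m) x) = x"
    using C1_germ_inverse[OF Tm _ _ \<open>0 < \<alpha>\<close>] by blast
  obtain \<beta>1 R1 where R1: "0 < \<beta>1" "\<beta>1 < \<alpha>" "C1_germ \<beta>1 R1 P" "\<forall>\<^sub>F x in nhds 0. R1 ((T ^^ m) x) = ?A (R1 x)"
    by (rule expanding_semiconjugacy[OF bump PQ(6) Tm \<open>0 < \<alpha>\<close> \<open>\<alpha> \<le> 1\<close> AB_m PQ(1,2) comm(1)])
       (use small in auto)
  have QP: "Q x + P x = x" for x using PQ(1)[of x] by (simp add: add.commute)
  obtain \<beta>2 R2 where R2: "0 < \<beta>2" "\<beta>2 < \<alpha>" "C1_germ \<beta>2 R2 Q" "\<forall>\<^sub>F x in nhds 0. R2 (G x) = ?B (R2 x)"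
    by (rule expanding_semiconjugacy[OF bump PQ(6) G(1) \<open>0 < \<alpha>\<close> \<open>\<alpha> \<le> 1\<close> AB_m(2,1) QP PQ(3) comm(2)])
       (use small in auto)
  have R2': "\<forall>\<^sub>F x in nhds 0. R2 ((T ^^ m) x) = ?A (R2 x)"
    using C1_germ_eventually[OF Tm R2(4)] G(2)
  proof eventually_elim
    case (elim x)
    then show ?case using AB_m(1)[of "R2 ((T ^^ m) x)"] by simp
  qed
  define \<beta> where "\<beta> = min \<beta>1 \<beta>2"
  have \<beta>: "0 < \<beta>" "\<beta> < \<alpha>" "\<beta> \<le> \<beta>1" "\<beta> \<le> \<beta>2" using R1 R2 by (auto simp: \<beta>_def)
  have "C1_germ \<beta> (\<lambda>x. R1 x + R2 x) (P + Q)"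
    by (intro C1_germ_add C1_germ_exponent[OF R1(3)] C1_germ_exponent[OF R2(3)] \<beta>)
  moreover have "P + Q = id_blinfun" by (intro blinfun_eqI) (simp add: blinfun.add_left PQ)
  ultimately have R12: "C1_germ \<beta> (\<lambda>x. R1 x + R2 x) id_blinfun" by simp
  have R12_conj: "\<forall>\<^sub>F x in nhds 0. R1 ((T ^^ m) x) + R2 ((T ^^ m) x) = ?A (R1 x + R2 x)"
    using R1(4) R2' by eventually_elim (simp add: blinfun.add_right)
  obtain R where R: "C1_germ \<beta> R id_blinfun" "\<forall>\<^sub>F x in nhds 0. R (T x) = A (R x)"
    using conjugacy_from_iterate[OF C1_germ_exponent[OF T less_imp_le[OF \<beta>(2)]] R12 \<beta>(1) m AB R12_conj] by blast
  show ?thesis using \<beta>(1,2) R by blast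
qed

theorem theorem1p5:
  fixes \<alpha> :: real and U :: "'a::banach set" and T L :: "'a \<Rightarrow> 'a"
  assumes "0 < \<alpha>" and "\<alpha> < 1"
    and "C1_holder_banach_space \<alpha> TYPE('a)"
    and "open U" and "connected U" and "0 \<in> U"
    and "C1_holder_on \<alpha> U T"
    and "T 0 = 0"
    and "(T has_derivative L) (at 0)"
    and "alpha_hyperbolic \<alpha> L"
  shows "\<exists>V \<beta> (R :: 'a \<Rightarrow> 'a).
           open V \<and> connected V \<and> 0 \<in> V \<and> V \<subseteq> U \<and> 0 < \<beta> \<and> \<beta> < \<alpha> \<and>
           C1_holder_diffeo_on \<beta> V R \<and> R 0 = 0 \<and>
           (\<forall>x \<in> V \<inter> T -` V. L (R x) = R (T x))"
proof -
  define A where "A = Blinfun L"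
  have A: "blinfun_apply A = L"
    unfolding A_def by (rule bounded_linear_Blinfun_apply[OF has_derivative_bounded_linear[OF assms(9)]])
  obtain r where r: "r > 0" "ball 0 r \<subseteq> U" using assms(4,6) open_contains_ball by blast
  have T: "C1_germ \<alpha> T A"
  proof -
    obtain H Df where H: "0 \<le> H" "holder_derivative \<alpha> H U T Df"
      using C1_holder_on_imp_holder_derivative[OF assms(7)] .
    have "blinfun_apply (Df 0) = L"
      using has_derivative_unique[OF holder_derivativeD(1)[OF H(2) assms(6)] assms(9)] .
    then have "Df 0 = A" by (intro blinfun_eqI) (simp add: A)
    then show ?thesis
      unfolding C1_germ_def using r(1) H(1) assms(8) holder_derivative_subset[OF H(2) r(2)] by blast
  qed
  obtain \<beta> R where \<beta>: "0 < \<beta>" "\<beta> < \<alpha>"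
    and R: "C1_germ \<beta> R id_blinfun" "\<forall>\<^sub>F x in nhds 0. R (T x) = A (R x)"
    using alpha_hyperbolic_germ_linearization[OF assms(3,1) less_imp_le[OF assms(2)] T] assms(10) A by auto
  obtain r' where r': "0 < r'" "\<And>s. 0 < s \<Longrightarrow> s \<le> r' \<Longrightarrow> C1_holder_diffeo_on \<beta> (ball 0 s) R"
    using C1_germ_local_diffeo[OF R(1) \<beta>(1)] by blast
  obtain d where d: "d > 0" "\<And>x. x \<in> ball 0 d \<Longrightarrow> R (T x) = L (R x)"
    using R(2) A unfolding eventually_nhds_metric by (auto simp: dist_commute)
  define s where "s = min (min r r') d"
  have s: "0 < s" "s \<le> r" "s \<le> r'" "s \<le> d" using r r' d by (auto simp: s_def)
  have "R 0 = 0" using R(1) by (rule C1_germE)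
  show ?thesis
  proof (intro exI conjI)
    show "ball 0 s \<subseteq> U" using r(2) s(2) by (meson subset_ball subset_trans)
    show "C1_holder_diffeo_on \<beta> (ball 0 s) R" using r'(2) s by blast
    show "\<forall>x\<in>ball 0 s \<inter> T -` ball 0 s. L (R x) = R (T x)" using d(2) s(4) by auto
  qed (use \<beta> s(1) \<open>R 0 = 0\<close> in auto)
qed

end
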